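(* Suppose $\eta\in[1,O(1)]$ and positive integers $(d_u,T_u)_{u=1}^m$ satisfy $d_u\le T_u$, $\sum_ud_u\le d$, and $\min_uT_u/d_u\ge\eta$. Fix $c\in\big[\max_u\frac{d_u}{T_u},\frac1{\eta^2}\min_u\frac{T_u}{d_u}\big]$. Then: (1) in every environment of the linear oblivious setting with domain structure $(d_u,T_u)_{u=1}^m$ (with $\|\theta^*\|_2\le C$, $|\langle\theta^*,x_t\rangle|\le1$), QuFUR$(c)$ has total cost $W=\tilde O\big(\sqrt c\sum_u\sqrt{T_ud_u}\big)$ with probability at least $1-\delta$; (2) for every algorithm there exists an environment with domain structure $(d_u,T_u)_{u=1}^m$, $\|\theta^*\|_2\le\sqrt d$ and $|\langle\theta^*,x_t\rangle|\le1$, under which its expected total cost is $\Omega\big(\sqrt c\sum_u\sqrt{T_ud_u}\big)$.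
   Context: Linear oblivious setting: $\theta^*\in\mathbb{R}^d$, $x_1,\dots,x_T$ ($\|x_t\|_2\le1$) fixed in advance; $y_t=\langle\theta^*,x_t\rangle+\xi_t$ with $\xi_t$ independent zero-mean sub-Gaussian with variance proxy $\eta^2$; $\tilde\eta=\max\{1,\eta\}$. Domain structure $(d_u,T_u)_{u=1}^m$: $[T]$ ($T=\sum_uT_u$) is partitioned into disjoint nonempty $I_1,\dots,I_m$ with $|I_u|=T_u$ and $\{x_t:t\in I_u\}$ in a subspace of dimension $d_u$. Regret $R=\sum_t(\hat y_t-\langle\theta^*,x_t\rangle)^2$, $Q=\sum_tq_t$, total cost $W=cR+Q$. QuFUR$(\alpha)$: $M\leftarrow C^{-2}I$, $\mathcal{Q}\leftarrow\emptyset$; at round $t$ with current $M_t$: $\hat\theta_t=M_t^{-1}\sum_{s\in\mathcal{Q}}x_sy_s$, predict $\hat y_t=\min(1,\max(-1,\langle\hat\theta_t,x_t\rangle))$, $\Delta_t=\tilde\eta^2\min\{1,x_t^\top M_t^{-1}x_t\}$, query independently with probability $\min\{1,\alpha\Delta_t\}$; if queried, $M\leftarrow M+x_tx_t^\top$, $\mathcal{Q}\leftarrow\mathcal{Q}\cup\{t\}$. $\tilde O$ hides absolute constants and factors polylogarithmic in $T,1/\delta,C$. *)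

theory Defs
  imports "HOL-Probability.Probability"
begin

text \<open>A vector of R^d is a function nat => real vanishing outside {..<d}.
  The dimension d is an ordinary value, so that constants hidden in O-notation
  can be chosen independently of d.\<close>

type_synonym vect = "nat \<Rightarrow> real"

definition in_dim :: "nat \<Rightarrow> vect \<Rightarrow> bool" where
  "in_dim d v \<longleftrightarrow> (\<forall>i\<ge>d. v i = 0)"

definition ip :: "nat \<Rightarrow> vect \<Rightarrow> vect \<Rightarrow> real" where
  "ip d v w = (\<Sum>i<d. v i * w i)"

definition vnorm :: "nat \<Rightarrow> vect \<Rightarrow> real" where
  "vnorm d v = sqrt (ip d v v)"

definition matvec :: "nat \<Rightarrow> (nat \<Rightarrow> nat \<Rightarrow> real) \<Rightarrow> vect \<Rightarrow> vect" where
  "matvec d A v = (\<lambda>i. if i < d then (\<Sum>j<d. A i j * v j) else 0)"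

text \<open>A^{-1} b (for invertible A): the unique solution v in R^d of A v = b.\<close>
definition mat_solve :: "nat \<Rightarrow> (nat \<Rightarrow> nat \<Rightarrow> real) \<Rightarrow> vect \<Rightarrow> vect" where
  "mat_solve d A b = (THE v. in_dim d v \<and> matvec d A v = b)"

definition domain_structure ::
  "nat \<Rightarrow> nat \<Rightarrow> (nat \<Rightarrow> nat) \<Rightarrow> (nat \<Rightarrow> nat) \<Rightarrow> (nat \<Rightarrow> nat set) \<Rightarrow> (nat \<Rightarrow> vect) \<Rightarrow> bool" where
  "domain_structure d m du Tu I xs \<longleftrightarrow>
     (\<forall>u<m. finite (I u) \<and> I u \<noteq> {} \<and> card (I u) = Tu u) \<and>
     (\<forall>u<m. \<forall>v<m. u \<noteq> v \<longrightarrow> I u \<inter> I v = {}) \<and>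
     (\<Union>u<m. I u) = {..<(\<Sum>u<m. Tu u)} \<and>
     (\<forall>u<m. \<exists>B :: nat \<Rightarrow> vect. (\<forall>j<du u. in_dim d (B j)) \<and>
        (\<forall>t\<in>I u. \<exists>a :: nat \<Rightarrow> real. xs t = (\<lambda>i. \<Sum>j<du u. a j * B j i)))"

definition subgaussian :: "real measure \<Rightarrow> real \<Rightarrow> bool" where
  "subgaussian N s \<longleftrightarrow> prob_space N \<and> sets N = sets borel \<and>
     integrable N (\<lambda>x. x) \<and> (\<integral>x. x \<partial>N) = 0 \<and>
     (\<forall>l::real. integrable N (\<lambda>x. exp (l * x)) \<and>
        (\<integral>x. exp (l * x) \<partial>N) \<le> exp (l\<^sup>2 * s\<^sup>2 / 2))"

text \<open>Linear oblivious environment: theta in R^d, x_0..x_{T-1} in R^d with norm <= 1,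
  independent noises xi_t ~ N t (product measure), each zero-mean sub-Gaussian with proxy eta^2.\<close>
definition lin_env :: "nat \<Rightarrow> nat \<Rightarrow> real \<Rightarrow> vect \<Rightarrow> (nat \<Rightarrow> vect) \<Rightarrow> (nat \<Rightarrow> real measure) \<Rightarrow> bool" where
  "lin_env d T eta \<theta> xs N \<longleftrightarrow> in_dim d \<theta> \<and>
     (\<forall>t<T. in_dim d (xs t) \<and> vnorm d (xs t) \<le> 1 \<and> subgaussian (N t) eta)"

definition noise_space :: "nat \<Rightarrow> (nat \<Rightarrow> real measure) \<Rightarrow> (nat \<Rightarrow> real) measure" where
  "noise_space T N = PiM {..<T} N"

definition labels :: "nat \<Rightarrow> vect \<Rightarrow> (nat \<Rightarrow> vect) \<Rightarrow> (nat \<Rightarrow> real) \<Rightarrow> nat \<Rightarrow> real" where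
  "labels d \<theta> xs \<xi> t = ip d \<theta> (xs t) + \<xi> t"

definition qM :: "real \<Rightarrow> (nat \<Rightarrow> vect) \<Rightarrow> nat set \<Rightarrow> nat \<Rightarrow> nat \<Rightarrow> real" where
  "qM C xs S = (\<lambda>i j. (if i = j then 1 / C\<^sup>2 else 0) + (\<Sum>s\<in>S. xs s i * xs s j))"

definition qb :: "(nat \<Rightarrow> vect) \<Rightarrow> (nat \<Rightarrow> real) \<Rightarrow> nat set \<Rightarrow> vect" where
  "qb xs y S = (\<lambda>i. \<Sum>s\<in>S. y s * xs s i)"

definition qtheta :: "nat \<Rightarrow> real \<Rightarrow> (nat \<Rightarrow> vect) \<Rightarrow> (nat \<Rightarrow> real) \<Rightarrow> nat set \<Rightarrow> vect" where
  "qtheta d C xs y S = mat_solve d (qM C xs S) (qb xs y S)"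

definition qpred :: "nat \<Rightarrow> real \<Rightarrow> (nat \<Rightarrow> vect) \<Rightarrow> (nat \<Rightarrow> real) \<Rightarrow> nat set \<Rightarrow> nat \<Rightarrow> real" where
  "qpred d C xs y S t = min 1 (max (-1) (ip d (qtheta d C xs y S) (xs t)))"

definition qDelta :: "nat \<Rightarrow> real \<Rightarrow> real \<Rightarrow> (nat \<Rightarrow> vect) \<Rightarrow> nat set \<Rightarrow> nat \<Rightarrow> real" where
  "qDelta d eta C xs S t =
     (max 1 eta)\<^sup>2 * min 1 (ip d (xs t) (mat_solve d (qM C xs S) (xs t)))"

text \<open>Set of queried rounds before round t; u t is the uniform [0,1] coin of round t,
  so round t is queried with probability min 1 (alpha * Delta_t), independently.\<close>
fun qufur_Q :: "nat \<Rightarrow> real \<Rightarrow> real \<Rightarrow> real \<Rightarrow> (nat \<Rightarrow> vect) \<Rightarrow> (nat \<Rightarrow> real) \<Rightarrow> nat \<Rightarrow> nat set" where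
  "qufur_Q d eta C alpha xs u 0 = {}"
| "qufur_Q d eta C alpha xs u (Suc t) =
     (let S = qufur_Q d eta C alpha xs u t in
      if u t < min 1 (alpha * qDelta d eta C xs S t) then insert t S else S)"

definition coin_space :: "nat \<Rightarrow> (nat \<Rightarrow> real) measure" where
  "coin_space T = PiM {..<T} (\<lambda>_. uniform_measure lborel {0..1})"

definition qufur_cost ::
  "nat \<Rightarrow> nat \<Rightarrow> real \<Rightarrow> real \<Rightarrow> real \<Rightarrow> real \<Rightarrow> vect \<Rightarrow> (nat \<Rightarrow> vect) \<Rightarrow>
   (nat \<Rightarrow> real) \<times> (nat \<Rightarrow> real) \<Rightarrow> real" where
  "qufur_cost d T eta C alpha c \<theta> xs \<omega> =
     (let u = fst \<omega>; y = labels d \<theta> xs (snd \<omega>) in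
      c * (\<Sum>t<T. (qpred d C xs y (qufur_Q d eta C alpha xs u t) t - ip d \<theta> (xs t))\<^sup>2)
      + real (card (qufur_Q d eta C alpha xs u T)))"

text \<open>An algorithm receives a random seed r (drawn from an arbitrary probability measure on
  the reals), the history (past contexts with the observed label, None if not queried) and
  the current context; it outputs a prediction and a query decision.\<close>
type_synonym algorithm = "real \<Rightarrow> (vect \<times> real option) list \<Rightarrow> vect \<Rightarrow> real \<times> bool"

fun alg_hist :: "algorithm \<Rightarrow> real \<Rightarrow> (nat \<Rightarrow> vect) \<Rightarrow> (nat \<Rightarrow> real) \<Rightarrow> nat \<Rightarrow> (vect \<times> real option) list" where
  "alg_hist A r xs y 0 = []"
| "alg_hist A r xs y (Suc t) =
     alg_hist A r xs y t @
       [(xs t, if snd (A r (alg_hist A r xs y t) (xs t)) then Some (y t) else None)]"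

definition alg_act :: "algorithm \<Rightarrow> real \<Rightarrow> (nat \<Rightarrow> vect) \<Rightarrow> (nat \<Rightarrow> real) \<Rightarrow> nat \<Rightarrow> real \<times> bool" where
  "alg_act A r xs y t = A r (alg_hist A r xs y t) (xs t)"

definition alg_cost ::
  "algorithm \<Rightarrow> nat \<Rightarrow> nat \<Rightarrow> real \<Rightarrow> vect \<Rightarrow> (nat \<Rightarrow> vect) \<Rightarrow> real \<times> (nat \<Rightarrow> real) \<Rightarrow> real" where
  "alg_cost A d T c \<theta> xs \<omega> =
     (let r = fst \<omega>; y = labels d \<theta> xs (snd \<omega>) in
      c * (\<Sum>t<T. (fst (alg_act A r xs y t) - ip d \<theta> (xs t))\<^sup>2)
      + real (card {t. t < T \<and> snd (alg_act A r xs y t)}))"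

definition admissible_alg :: "real measure \<Rightarrow> algorithm \<Rightarrow> bool" where
  "admissible_alg Rm A \<longleftrightarrow>
     (\<forall>d T \<theta> xs t. t < T \<longrightarrow>
        (\<lambda>\<omega>. alg_act A (fst \<omega>) xs (labels d \<theta> xs (snd \<omega>)) t)
          \<in> measurable (Rm \<Otimes>\<^sub>M PiM {..<T} (\<lambda>_. borel)) (borel \<Otimes>\<^sub>M count_space UNIV))"

end

theory Submission
  imports Defs "HOL-Probability.Hoeffding"
begin

text \<open>
  Upper bound. The query decisions depend only on the coins, so for fixed coins the design is fixed
  and, by a sub-Gaussian tail bound for each round, the prediction error at round \<open>t\<close> is at most a
  logarithmic factor times the square root of \<open>w = \<langle>x\<^sub>t, M\<^sub>t\<^sup>-\<^sup>1 x\<^sub>t\<rangle>\<close>. It remains to bound, in each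
  domain \<open>u\<close>, the sum of the widths \<open>a = min 1 w\<close>. Over the queried rounds it is \<open>O(d\<^sub>u log)\<close>: the
  Gram kernel of the domain is a sum of \<open>d\<^sub>u\<close> rank-one kernels, and adding them one at a time bounds
  the elliptical potential. A round is queried with probability \<open>p = min 1 (c \<eta>\<^sup>2 a)\<close>, so an
  exponential supermartingale transfers this bound to the sum of \<open>p a\<close> over all rounds, and AM-GM
  turns it into a bound on the sum of \<open>a\<close>.

  Lower bound. The contexts are basis vectors, each repeated about \<open>T\<^sub>u / d\<^sub>u\<close> times, the labels are
  \<open>\<plusminus>1\<close> with mean \<open>\<theta>\<^sub>k = \<plusminus>\<epsilon>\<^sub>k\<close>, and the signs are uniformly random. The posterior probability \<open>\<pi>\<close> of
  a sign has variance \<open>\<pi> (1 - \<pi>)\<close>, which drops by at most \<open>\<epsilon>\<^sup>2 / 4\<close> per query in expectation, while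
  each round costs at least \<open>4 c \<epsilon>\<^sup>2 \<pi> (1 - \<pi>)\<close>. With \<open>\<epsilon>\<^sup>2 = 1 / (2 sqrt (c n))\<close> the \<open>n\<close> rounds of
  a coordinate cost at least \<open>sqrt (c n) / 2\<close> on average over the signs.
\<close>

text \<open>The matrix \<open>M\<close> mixes the queries of all domains, while the bound may see
  only the dimension d_u of each. This is why the potential is proved for kernels on rounds instead
  of d x d matrices: the Gram kernel of a domain has rank at most d_u, whatever d is. Each bound on
  c has its own task. The upper bound makes the AM-GM weight sqrt (T_u / (c d_u)) at least 1, which
  absorbs the rounds queried with certainty. The lower bound makes c n at least 1/2 for every
  coordinate, which keeps \<epsilon> below 1, and makes the target bound at least 1, which absorbs
  additive logarithms. In the lower bound, c n \<epsilon>^4 \<le> 1 says that a query never lowers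
  the bound on later regret by more than its price 1. A backward induction over rounds with
  unnormalised posterior weights then handles adaptive algorithms without any information-theoretic
  inequality.\<close>

section \<open>Elliptical potential for kernels\<close>

text \<open>Posterior covariance of a Gaussian process after a unit-variance observation at \<open>t\<close>.\<close>
definition kernel_update :: "(nat \<Rightarrow> nat \<Rightarrow> real) \<Rightarrow> nat \<Rightarrow> nat \<Rightarrow> nat \<Rightarrow> real" where
  "kernel_update K t = (\<lambda>i j. K i j - K i t * K t j / (1 + K t t))"

definition residual :: "(nat \<Rightarrow> nat \<Rightarrow> real) \<Rightarrow> (nat \<Rightarrow> real) \<Rightarrow> nat \<Rightarrow> nat \<Rightarrow> real" where
  "residual K f t = (\<lambda>i. f i - K i t * f t / (1 + K t t))"

text \<open>For the Gram matrix \<open>G\<close> of \<open>K\<close> on a list of points, \<open>kernel_det\<close> is \<open>det (I + G)\<close> and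
  \<open>kernel_gain\<close> is the quadratic form of \<open>(I + G)\<^sup>-\<^sup>1\<close> at the values of \<open>f\<close>, both computed by
  conditioning on one point at a time.\<close>
fun kernel_det :: "(nat \<Rightarrow> nat \<Rightarrow> real) \<Rightarrow> nat list \<Rightarrow> real" where
  "kernel_det K [] = 1"
| "kernel_det K (t # ts) = (1 + K t t) * kernel_det (kernel_update K t) ts"

fun kernel_gain :: "(nat \<Rightarrow> nat \<Rightarrow> real) \<Rightarrow> (nat \<Rightarrow> real) \<Rightarrow> nat list \<Rightarrow> real" where
  "kernel_gain K f [] = 0"
| "kernel_gain K f (t # ts) = (f t)\<^sup>2 / (1 + K t t) + kernel_gain (kernel_update K t) (residual K f t) ts"

text \<open>Restricted to kernels of finite rank.\<close>
inductive psd_kernel :: "(nat \<Rightarrow> nat \<Rightarrow> real) \<Rightarrow> bool" where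
  psd_zero: "psd_kernel (\<lambda>i j. 0)"
| psd_add: "psd_kernel K \<Longrightarrow> c \<ge> 0 \<Longrightarrow> psd_kernel (\<lambda>i j. K i j + c * f i * f j)"

lemma psd_kernel_diag: "psd_kernel K \<Longrightarrow> K t t \<ge> 0"
  by (induction rule: psd_kernel.induct) (auto simp: mult.assoc)

text \<open>Add to a Gaussian process an independent random multiple of \<open>f\<close> with
  variance \<open>c\<close>. The observation at \<open>t\<close> turns \<open>f\<close> into its
  residual, and for c > 0 the precision 1/c of the multiple grows by f(t)^2 / (1 + K t t).\<close>

lemma kernel_update_add:
  assumes "K t t \<ge> 0" "c \<ge> 0" "\<And>i j. K i j = K j i"
  shows "kernel_update (\<lambda>i j. K i j + c * f i * f j) t =
    (\<lambda>i j. kernel_update K t i j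
       + (c / (1 + c * (f t)\<^sup>2 / (1 + K t t))) * residual K f t i * residual K f t j)"
proof (intro ext)
  fix i j
  define k where "k = K t t" define p where "p = K i t" define q where "q = K t j"
  define F where "F = f t"
  have sym: "K j t = q" using assms(3) q_def by simp
  have k: "1 + k > 0" using assms(1) k_def by simp
  have D: "1 + k + c * F\<^sup>2 > 0" using k assms(2) by (simp add: add_pos_nonneg)
  have e: "c / (1 + c * F\<^sup>2 / (1 + k)) = c * (1 + k) / (1 + k + c * F\<^sup>2)"
    using k D by (simp add: field_simps)
  have D2: "1 + (k + c * F * F) = 1 + k + c * F\<^sup>2" by (simp add: power2_eq_square)
  have "K i j + c * f i * f j - (p + c * f i * F) * (q + c * F * f j) / (1 + k + c * F\<^sup>2)
    = K i j - p * q / (1 + k)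
      + (c * (1 + k) / (1 + k + c * F\<^sup>2)) * (f i - p * F / (1 + k)) * (f j - q * F / (1 + k))"
  proof -
    have "(K i j + c * f i * f j) * ((1 + k + c * F\<^sup>2) * (1 + k)) - (p + c * f i * F) * (q + c * F * f j) * (1 + k)
      = (K i j * (1 + k) - p * q) * (1 + k + c * F\<^sup>2)
       + c * ((f i * (1 + k) - p * F) * (f j * (1 + k) - q * F))"
      by algebra
    then show ?thesis using k D by (simp add: divide_simps) (simp add: algebra_simps power2_eq_square)
  qed
  then show "kernel_update (\<lambda>i j. K i j + c * f i * f j) t i j = kernel_update K t i j
       + (c / (1 + c * (f t)\<^sup>2 / (1 + K t t))) * residual K f t i * residual K f t j"
    by (simp only: kernel_update_def residual_def k_def[symmetric] p_def[symmetric]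
        q_def[symmetric] F_def[symmetric] sym D2 e)
qed

lemma psd_kernel_sym: "psd_kernel K \<Longrightarrow> K i j = K j i"
  by (induction rule: psd_kernel.induct) (auto simp: mult.commute)

lemma psd_kernel_update: "psd_kernel K \<Longrightarrow> psd_kernel (kernel_update K t)"
proof (induction rule: psd_kernel.induct)
  case psd_zero
  then show ?case by (simp add: kernel_update_def psd_kernel.psd_zero)
next
  case (psd_add K c f)
  have k: "K t t \<ge> 0" using psd_add psd_kernel_diag by blast
  show ?case
    unfolding kernel_update_add[of K t c f, OF k psd_add(2) psd_kernel_sym[OF psd_add(1)]]
    using psd_add k by (intro psd_kernel.psd_add) auto
qed

lemma residual_diff: "residual K (\<lambda>i. f i - l * h i) t = (\<lambda>i. residual K f t i - l * residual K h t i)"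
  by (auto simp: residual_def algebra_simps diff_divide_distrib)

text \<open>Matrix determinant lemma for I + G. In the induction the factor 1 + Z gained on the
  diagonal at \<open>t\<close>, with Z = c f(t)^2 / (1 + K t t), undoes the shrinking of the
  coefficient: (1 + Z) c' = c.\<close>

lemma kernel_det_add:
  assumes "psd_kernel K" "c \<ge> 0"
  shows "kernel_det (\<lambda>i j. K i j + c * f i * f j) ts = kernel_det K ts * (1 + c * kernel_gain K f ts)"
  using assms
proof (induction ts arbitrary: K c f)
  case (Cons t ts)
  let ?k = "K t t"
  have k: "?k \<ge> 0" using Cons psd_kernel_diag by blast
  define c' where "c' = c / (1 + c * (f t)\<^sup>2 / (1 + ?k))"
  have z: "c * (f t)\<^sup>2 / (1 + ?k) \<ge> 0" using k Cons by simp
  have c': "c' \<ge> 0" using z Cons by (simp add: c'_def)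
  have expand: "(1 + k) * (1 + Z) * (D * (1 + e * G)) = (1 + k) * D * ((1 + Z) + ((1 + Z) * e) * G)"
    for k Z D e G :: real by algebra
  have "kernel_det (\<lambda>i j. K i j + c * f i * f j) (t # ts)
     = (1 + ?k + c * f t * f t) * (kernel_det (kernel_update K t) ts
         * (1 + c' * kernel_gain (kernel_update K t) (residual K f t) ts))"
    using kernel_update_add[of K t c f] psd_kernel_sym[OF Cons.prems(1)] k Cons.prems
      Cons.IH[OF psd_kernel_update[OF Cons.prems(1)] c', of t "residual K f t"]
    by (simp add: c'_def add.assoc)
  also have "1 + ?k + c * f t * f t = (1 + ?k) * (1 + c * (f t)\<^sup>2 / (1 + ?k))"
    using k by (simp add: field_simps power2_eq_square)
  also have "(1 + ?k) * (1 + c * (f t)\<^sup>2 / (1 + ?k)) * (kernel_det (kernel_update K t) ts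
         * (1 + c' * kernel_gain (kernel_update K t) (residual K f t) ts))
     = (1 + ?k) * kernel_det (kernel_update K t) ts * ((1 + c * (f t)\<^sup>2 / (1 + ?k)) 
          + ((1 + c * (f t)\<^sup>2 / (1 + ?k)) * c') * kernel_gain (kernel_update K t) (residual K f t) ts)"
    by (rule expand)
  also have "(1 + c * (f t)\<^sup>2 / (1 + ?k)) * c' = c" using z by (simp add: c'_def)
  finally show ?case by (simp add: algebra_simps)
qed auto

text \<open>The free parameter \<open>l\<close> makes the statement inductive; \<open>l = 0\<close> says that the gain decreases
  when the kernel grows.\<close>
lemma kernel_gain_add_le:
  assumes "psd_kernel K" "c > 0"
  shows "kernel_gain (\<lambda>i j. K i j + c * h i * h j) f ts \<le> kernel_gain K (\<lambda>i. f i - l * h i) ts + l\<^sup>2 / c"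
  using assms
proof (induction ts arbitrary: K c f h l)
  case (Cons t ts)
  define k where "k = K t t" define F where "F = f t" define H where "H = h t"
  have k: "1 + k > 0" using Cons psd_kernel_diag[of K t] unfolding k_def by force
  define D where "D = 1 + k + c * H\<^sup>2"
  have D: "D > 0" using k Cons by (simp add: D_def add_pos_nonneg)
  have kk: "K t t \<ge> 0" using Cons psd_kernel_diag by blast
  define c' where "c' = c / (1 + c * H\<^sup>2 / (1 + k))"
  have c'e: "c' = c * (1 + k) / D" using k D unfolding c'_def D_def by (simp add: field_simps)
  have c': "c' > 0" using k D Cons by (simp add: c'e)
  define m where "m = c * H * F / D"
  have res: "residual (\<lambda>i j. K i j + c * h i * h j) f t = (\<lambda>i. residual K f t i - m * residual K h t i)"
  proof
    fix i
    have D2: "1 + (k + c * H * H) = D" by (simp add: D_def power2_eq_square)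
    have "f i - (K i t + c * h i * H) * F / D = f i - K i t * F / (1 + k) - c * H * F / D * (h i - K i t * H / (1 + k))"
    proof -
      have "(K i t + c * h i * H) * F / D = K i t * F / (1 + k) + c * H * F / D * (h i - K i t * H / (1 + k))"
        using k D by (simp add: divide_simps) (simp add: D_def algebra_simps power2_eq_square)
      then show ?thesis by simp
    qed
    then show "residual (\<lambda>i j. K i j + c * h i * h j) f t i = residual K f t i - m * residual K h t i"
      unfolding residual_def m_def using D2 by (simp add: k_def F_def H_def)
  qed
  have upd: "kernel_update (\<lambda>i j. K i j + c * h i * h j) t =
     (\<lambda>i j. kernel_update K t i j + c' * residual K h t i * residual K h t j)"
    using kernel_update_add[of K t c h] psd_kernel_sym[OF Cons.prems(1)] kk Cons.prems
    by (simp add: c'_def k_def H_def)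
  have "kernel_gain (\<lambda>i j. K i j + c * h i * h j) f (t # ts)
     = F\<^sup>2 / D + kernel_gain (\<lambda>i j. kernel_update K t i j + c' * residual K h t i * residual K h t j)
         (\<lambda>i. residual K f t i - m * residual K h t i) ts"
    using res upd by (simp add: D_def F_def H_def k_def power2_eq_square algebra_simps)
  \<comment> \<open>Enlarging the kernel subtracts \<open>m\<close> times the residual of
    \<open>h\<close> from the residual of \<open>f\<close>, so the induction hypothesis is used with
    \<open>l - m\<close>: its argument is then the residual of f - l h under \<open>K\<close>. The
    remaining squares recombine exactly.\<close>
  also have "\<dots> \<le> F\<^sup>2 / D + (kernel_gain (kernel_update K t) 
        (\<lambda>i. (residual K f t i - m * residual K h t i) - (l - m) * residual K h t i) ts + (l - m)\<^sup>2 / c')"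
    using Cons.IH[OF psd_kernel_update[OF Cons.prems(1)] c'] by simp
  also have "(\<lambda>i. (residual K f t i - m * residual K h t i) - (l - m) * residual K h t i)
      = residual K (\<lambda>i. f i - l * h i) t"
    by (simp add: residual_diff algebra_simps)
  also have "F\<^sup>2 / D + (kernel_gain (kernel_update K t) (residual K (\<lambda>i. f i - l * h i) t) ts + (l - m)\<^sup>2 / c')
     = (F - l * H)\<^sup>2 / (1 + k) + l\<^sup>2 / c + kernel_gain (kernel_update K t) (residual K (\<lambda>i. f i - l * h i) t) ts"
  proof -
    have c0: "c \<noteq> 0" using Cons by simp
    have "c * (1+k) * (F\<^sup>2 + 0) + (l * D - c * H * F)\<^sup>2 = D * (c * (F - l * H)\<^sup>2 + l\<^sup>2 * (1 + k))"
      unfolding D_def by algebra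
    moreover have "(l - m)\<^sup>2 / c' = (l * D - c * H * F)\<^sup>2 / (D * (c * (1 + k)))"
    proof -
      have "l - m = (l * D - c * H * F) / D" using D by (simp add: m_def diff_divide_distrib)
      then show ?thesis using D by (simp add: c'e power_divide power2_eq_square)
    qed
    ultimately have "F\<^sup>2 / D + (l - m)\<^sup>2 / c' = (F - l * H)\<^sup>2 / (1 + k) + l\<^sup>2 / c"
    proof -
      assume "c * (1+k) * (F\<^sup>2 + 0) + (l * D - c * H * F)\<^sup>2 = D * (c * (F - l * H)\<^sup>2 + l\<^sup>2 * (1 + k))"
        and e: "(l - m)\<^sup>2 / c' = (l * D - c * H * F)\<^sup>2 / (D * (c * (1 + k)))"
      then have "(c * (1+k) * F\<^sup>2 + (l * D - c * H * F)\<^sup>2) / (D * (c * (1 + k)))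
         = D * (c * (F - l * H)\<^sup>2 + l\<^sup>2 * (1 + k)) / (D * (c * (1 + k)))" by simp
      then show ?thesis using D k c0 unfolding e by (simp add: add_divide_distrib)
    qed
    then show ?thesis by simp
  qed
  finally show ?case by (simp add: k_def F_def H_def)
qed auto

lemma kernel_gain_zero: "kernel_gain (\<lambda>i j. 0) f ts = (\<Sum>t\<leftarrow>ts. (f t)\<^sup>2)"
  by (induction ts arbitrary: f) (auto simp: kernel_update_def residual_def)

lemma psd_kernel_sum: "psd_kernel (\<lambda>i j. \<Sum>l<(k::nat). c * f l i * f l j)" if "c \<ge> 0"
  using that by (induction k) (auto intro: psd_zero psd_add)

lemma kernel_gain_le:
  fixes c :: real and k :: nat
  assumes "c > 0"
  shows "kernel_gain (\<lambda>i j. \<Sum>l<k. c * h l i * h l j) f ts \<le> (\<Sum>t\<leftarrow>ts. (f t)\<^sup>2)"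
proof (induction k)
  case (Suc k)
  then show ?case
    using kernel_gain_add_le[OF psd_kernel_sum[of c h k] assms, of "h k" f ts 0] assms by simp
qed (simp add: kernel_gain_zero)

lemma kernel_det_pos: "psd_kernel K \<Longrightarrow> kernel_det K ts > 0"
proof (induction ts arbitrary: K)
  case (Cons t ts)
  then show ?case using psd_kernel_diag[of K t] psd_kernel_update by (auto intro!: mult_pos_pos add_pos_nonneg)
qed simp

text \<open>A Hadamard-type bound: the rank-one terms are added one at a time, and each multiplies
  the determinant by at most what it would contribute alone, because its gain only drops in the
  presence of the earlier ones.\<close>

lemma kernel_det_le:
  fixes c :: real and k :: nat
  assumes "c > 0"
  shows "kernel_det (\<lambda>i j. \<Sum>l<k. c * h l i * h l j) ts \<le> (\<Prod>l<k. 1 + c * (\<Sum>t\<leftarrow>ts. (h l t)\<^sup>2))"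
proof (induction k)
  case 0
  have "kernel_det (\<lambda>i j. 0) ts = 1" by (induction ts) (auto simp: kernel_update_def)
  then show ?case by simp
next
  case (Suc k)
  have p: "psd_kernel (\<lambda>i j. \<Sum>l<k. c * h l i * h l j)" using psd_kernel_sum assms by simp
  have "kernel_det (\<lambda>i j. \<Sum>l<Suc k. c * h l i * h l j) ts
     = kernel_det (\<lambda>i j. \<Sum>l<k. c * h l i * h l j) ts * (1 + c * kernel_gain (\<lambda>i j. \<Sum>l<k. c * h l i * h l j) (h k) ts)"
    using kernel_det_add[OF p, of c "h k" ts] assms by simp
  also have "\<dots> \<le> kernel_det (\<lambda>i j. \<Sum>l<k. c * h l i * h l j) ts * (1 + c * (\<Sum>t\<leftarrow>ts. (h k t)\<^sup>2))"
    using kernel_gain_le[OF assms] kernel_det_pos[OF p, of ts] assms by (intro mult_left_mono) auto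
  also have "\<dots> \<le> (\<Prod>l<k. 1 + c * (\<Sum>t\<leftarrow>ts. (h l t)\<^sup>2)) * (1 + c * (\<Sum>t\<leftarrow>ts. (h k t)\<^sup>2))"
    using Suc assms by (intro mult_right_mono) (auto intro!: add_nonneg_nonneg mult_nonneg_nonneg sum_list_nonneg)
  finally show ?case by simp
qed

text \<open>The low-rank form of a Gram kernel holds only between rounds of one domain, so kernels
  have to be exchanged on the listed points alone.\<close>

lemma kernel_det_cong:
  assumes "set ts \<subseteq> A" "\<And>i j. i \<in> A \<Longrightarrow> j \<in> A \<Longrightarrow> K i j = K' i j"
  shows "kernel_det K ts = kernel_det K' ts"
  using assms
proof (induction ts arbitrary: K K')
  case (Cons t ts)
  have "kernel_det (kernel_update K t) ts = kernel_det (kernel_update K' t) ts"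
    using Cons.prems by (intro Cons.IH) (auto simp: kernel_update_def)
  then show ?case using Cons.prems by auto
qed simp

text \<open>The recursion of \<open>kernel_det\<close> peels off the earliest point; here the latest
  one is split off, and its factor is 1 plus its variance given all earlier points.\<close>

lemma kernel_det_snoc: "kernel_det K (ts @ [t]) = kernel_det K ts * (1 + foldl kernel_update K ts t t)"
  by (induction ts arbitrary: K) auto

section \<open>Ridge regression\<close>

lemma ip_commute: "ip d v w = ip d w v"
  by (simp add: ip_def mult.commute)

lemma ip_add_right: "ip d v (\<lambda>i. w i + z i) = ip d v w + ip d v z"
  by (simp add: ip_def algebra_simps sum.distrib)

lemma ip_diff_right: "ip d v (\<lambda>i. w i - z i) = ip d v w - ip d v z"
  by (simp add: ip_def algebra_simps sum_subtractf)

lemma ip_scale_right: "ip d v (\<lambda>i. a * w i) = a * ip d v w"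
  by (simp add: ip_def sum_distrib_left algebra_simps)

lemma ip_sum_right: "ip d v (\<lambda>i. \<Sum>s\<in>S. a s * w s i) = (\<Sum>s\<in>S. a s * ip d v (w s))"
proof -
  have "ip d v (\<lambda>i. \<Sum>s\<in>S. a s * w s i) = (\<Sum>i<d. \<Sum>s\<in>S. v i * (a s * w s i))"
    by (simp add: ip_def sum_distrib_left)
  also have "\<dots> = (\<Sum>s\<in>S. \<Sum>i<d. v i * (a s * w s i))" by (rule sum.swap)
  finally show ?thesis by (simp add: ip_def sum_distrib_left mult.left_commute)
qed

lemma ip_sum_left: "ip d (\<lambda>i. \<Sum>s\<in>S. a s * w s i) v = (\<Sum>s\<in>S. a s * ip d (w s) v)"
  unfolding ip_commute[of d _ v] by (rule ip_sum_right)

lemma ip_self_nonneg: "ip d v v \<ge> 0"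
  by (simp add: ip_def sum_nonneg)

lemma ip_self_eq_0: "ip d v v = 0 \<Longrightarrow> in_dim d v \<Longrightarrow> v = (\<lambda>i. 0)"
proof
  fix i assume "ip d v v = 0" "in_dim d v"
  then have "\<forall>i<d. v i * v i = 0" unfolding ip_def by (subst (asm) sum_nonneg_eq_0_iff) auto
  then show "v i = 0" using \<open>in_dim d v\<close> unfolding in_dim_def by (cases "i < d") auto
qed

lemma Cauchy_Schwarz_ip: "(ip d v w)\<^sup>2 \<le> ip d v v * ip d w w"
  using Cauchy_Schwarz_ineq_sum[of v w "{..<d}"] by (simp add: ip_def power2_eq_square)

lemma vnorm_sq: "(vnorm d v)\<^sup>2 = ip d v v"
  by (simp add: vnorm_def ip_self_nonneg)

lemma vnorm_nonneg: "vnorm d v \<ge> 0"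
  by (simp add: vnorm_def ip_self_nonneg)

lemma matvec_qM:
  assumes "finite S" "\<And>s. s \<in> S \<Longrightarrow> in_dim d (xs s)" "in_dim d v"
  shows "matvec d (qM C xs S) v = (\<lambda>i. v i / C\<^sup>2 + (\<Sum>s\<in>S. ip d (xs s) v * xs s i))"
proof
  fix i
  show "matvec d (qM C xs S) v i = v i / C\<^sup>2 + (\<Sum>s\<in>S. ip d (xs s) v * xs s i)"
  proof (cases "i < d")
    case True
    have "matvec d (qM C xs S) v i = (\<Sum>j<d. (if i = j then v j / C\<^sup>2 else 0) + (\<Sum>s\<in>S. xs s i * xs s j * v j))"
      using True unfolding matvec_def qM_def by (auto intro!: sum.cong simp: algebra_simps sum_distrib_left)
    also have "\<dots> = v i / C\<^sup>2 + (\<Sum>s\<in>S. \<Sum>j<d. xs s i * xs s j * v j)"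
      using True by (simp add: sum.distrib sum.swap[of _ S])
    finally show ?thesis by (simp add: ip_def sum_distrib_left sum_distrib_right algebra_simps)
  next
    case False
    then show ?thesis using assms unfolding matvec_def in_dim_def by auto
  qed
qed

locale design =
  fixes d T :: nat and C :: real and xs :: "nat \<Rightarrow> vect"
  assumes C_pos: "C > 0" and xs_dim: "t < T \<Longrightarrow> in_dim d (xs t)"
begin

text \<open>\<open>M v = b\<close> as a relation, so that solutions can be combined and compared
  before the \<open>THE\<close> in \<open>mat_solve\<close> is known to denote anything.\<close>

definition solves :: "nat set \<Rightarrow> vect \<Rightarrow> vect \<Rightarrow> bool" where
  "solves S b v \<longleftrightarrow> in_dim d v \<and> (\<lambda>i. v i / C\<^sup>2 + (\<Sum>s\<in>S. ip d (xs s) v * xs s i)) = b"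

lemma solves_iff:
  assumes "S \<subseteq> {..<T}"
  shows "solves S b v \<longleftrightarrow> in_dim d v \<and> matvec d (qM C xs S) v = b"
proof -
  have "finite S" using assms finite_subset by blast
  then have "matvec d (qM C xs S) v = (\<lambda>i. v i / C\<^sup>2 + (\<Sum>s\<in>S. ip d (xs s) v * xs s i))"
    if "in_dim d v" using assms xs_dim that by (intro matvec_qM) auto
  then show ?thesis unfolding solves_def by auto
qed

lemma solves_at: "solves S b v \<Longrightarrow> v i / C\<^sup>2 + (\<Sum>s\<in>S. ip d (xs s) v * xs s i) = b i"
  by (auto simp: solves_def)

lemma solves_ip:
  assumes "solves S b v"
  shows "ip d b w = ip d v w / C\<^sup>2 + (\<Sum>s\<in>S. ip d (xs s) v * ip d (xs s) w)"
proof -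
  have "ip d b w = ip d w (\<lambda>i. (1 / C\<^sup>2) * v i + (\<Sum>s\<in>S. ip d (xs s) v * xs s i))"
    using assms unfolding solves_def by (auto simp: ip_commute)
  then show ?thesis unfolding ip_add_right ip_scale_right ip_sum_right by (simp add: ip_commute)
qed

lemma solves_energy:
  assumes "solves S b v"
  shows "ip d b v = ip d v v / C\<^sup>2 + (\<Sum>s\<in>S. (ip d (xs s) v)\<^sup>2)"
  using solves_ip[OF assms, of v] by (simp add: power2_eq_square)

lemma solves_nonneg: "solves S b v \<Longrightarrow> ip d b v \<ge> 0"
  by (simp add: solves_energy sum_nonneg ip_self_nonneg)

lemma solves_sym: "solves S b v \<Longrightarrow> solves S b' v' \<Longrightarrow> ip d b v' = ip d b' v"
  using solves_ip[of S b v v'] solves_ip[of S b' v' v] by (simp add: ip_commute mult.commute)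

text \<open>The difference w of two solutions has zero energy, and the ridge term |w|^2 / C^2 then
  forces w = 0.\<close>

lemma solves_unique:
  assumes "solves S b v" "solves S b v'"
  shows "v = v'"
proof -
  let ?w = "\<lambda>i. v i - v' i"
  have w: "solves S (\<lambda>i. 0) ?w"
    unfolding solves_def
  proof (intro conjI ext)
    show "in_dim d ?w" using assms unfolding solves_def in_dim_def by auto
    fix i
    have "v i / C\<^sup>2 + (\<Sum>s\<in>S. ip d (xs s) v * xs s i) = v' i / C\<^sup>2 + (\<Sum>s\<in>S. ip d (xs s) v' * xs s i)"
      using solves_at[OF assms(1)] solves_at[OF assms(2)] by simp
    then show "?w i / C\<^sup>2 + (\<Sum>s\<in>S. ip d (xs s) ?w * xs s i) = 0"
      by (simp add: ip_diff_right diff_divide_distrib left_diff_distrib sum_subtractf)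
  qed
  have "ip d ?w ?w / C\<^sup>2 + (\<Sum>s\<in>S. (ip d (xs s) ?w)\<^sup>2) = 0"
    using solves_energy[OF w] by (simp add: ip_def)
  then have "ip d ?w ?w / C\<^sup>2 \<le> 0" using sum_nonneg[of S "\<lambda>s. (ip d (xs s) ?w)\<^sup>2"] by simp
  then have "ip d ?w ?w \<le> 0" using C_pos by (simp add: divide_le_0_iff)
  then have "ip d ?w ?w = 0" using ip_self_nonneg[of d ?w] by simp
  then have "?w = (\<lambda>i. 0)" using ip_self_eq_0 w unfolding solves_def by blast
  then show ?thesis by (simp add: fun_eq_iff)
qed

text \<open>Sherman-Morrison formula for M + x_t x_t^T. The coefficient subtracted is also the inner
  product of x_t with the new solution (\<open>tg\<close>), which is why the additional summand of
  the system matches.\<close>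

lemma solves_insert:
  assumes "finite S" "t \<notin> S" "solves S b v" "solves S (xs t) z"
  shows "solves (insert t S) b (\<lambda>i. v i - ip d (xs t) v / (1 + ip d (xs t) z) * z i)"
proof -
  define g where "g = ip d (xs t) v / (1 + ip d (xs t) z)"
  have p: "1 + ip d (xs t) z > 0" using solves_nonneg[OF assms(4)] by simp
  have tg: "ip d (xs t) v - g * ip d (xs t) z = g" using p by (simp add: g_def field_simps)
  have "solves (insert t S) b (\<lambda>i. v i - g * z i)"
    unfolding solves_def
  proof (intro conjI ext)
    show "in_dim d (\<lambda>i. v i - g * z i)" using assms unfolding solves_def in_dim_def by auto
    fix i
    have 1: "v i / C\<^sup>2 + (\<Sum>s\<in>S. ip d (xs s) v * xs s i) = b i"
      by (rule solves_at[OF assms(3)])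
    have 2: "z i / C\<^sup>2 + (\<Sum>s\<in>S. ip d (xs s) z * xs s i) = xs t i"
      by (rule solves_at[OF assms(4)])
    have "(\<Sum>s\<in>insert t S. ip d (xs s) (\<lambda>i. v i - g * z i) * xs s i) = g * xs t i + 
      (\<Sum>s\<in>S. ip d (xs s) (\<lambda>i. v i - g * z i) * xs s i)"
      using assms(1,2) by (simp add: ip_diff_right ip_scale_right tg)
    also have "(\<Sum>s\<in>S. ip d (xs s) (\<lambda>i. v i - g * z i) * xs s i)
       = (\<Sum>s\<in>S. ip d (xs s) v * xs s i) - g * (\<Sum>s\<in>S. ip d (xs s) z * xs s i)"
      by (simp add: ip_diff_right ip_scale_right sum_subtractf sum_distrib_left left_diff_distrib mult.assoc)
    finally have 3: "(\<Sum>s\<in>insert t S. ip d (xs s) (\<lambda>i. v i - g * z i) * xs s i)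
       = g * xs t i + (\<Sum>s\<in>S. ip d (xs s) v * xs s i) - g * (\<Sum>s\<in>S. ip d (xs s) z * xs s i)" by simp
    show "(v i - g * z i) / C\<^sup>2 + (\<Sum>s\<in>insert t S. ip d (xs s) (\<lambda>i. v i - g * z i) * xs s i) = b i"
      unfolding 3 using 1 2[symmetric] by (simp add: diff_divide_distrib algebra_simps)
  qed
  then show ?thesis by (simp add: g_def)
qed

lemma solves_exists:
  assumes "S \<subseteq> {..<T}" "in_dim d b"
  shows "\<exists>v. solves S b v"
proof -
  have "finite S" using assms finite_subset by blast
  then show ?thesis using assms
  proof (induction S arbitrary: b rule: finite_induct)
    case empty
    have "solves {} b (\<lambda>i. C\<^sup>2 * b i)" using C_pos empty unfolding solves_def in_dim_def by auto
    then show ?case by blast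
  next
    case (insert t S)
    obtain v where "solves S b v" using insert by blast
    moreover obtain z where "solves S (xs t) z" using insert xs_dim[of t] by blast
    ultimately show ?case using solves_insert insert by blast
  qed
qed

lemma mat_solve_solves:
  assumes "S \<subseteq> {..<T}" "in_dim d b"
  shows "solves S b (mat_solve d (qM C xs S) b)"
proof -
  obtain v where v: "solves S b v" using solves_exists assms by blast
  have "mat_solve d (qM C xs S) b = v"
    unfolding mat_solve_def
  proof (rule the_equality)
    show "in_dim d v \<and> matvec d (qM C xs S) v = b" using v solves_iff[OF assms(1)] by blast
    show "w = v" if "in_dim d w \<and> matvec d (qM C xs S) w = b" for w
      using that v solves_iff[OF assms(1)] solves_unique by blast
  qed
  then show ?thesis using v by simp
qed

text \<open>Covariance of the Gaussian process with prior C^2 <x_i, x_j> after unit-noise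
  observations at \<open>S\<close>, hence one \<open>kernel_update\<close> per insertion. On the
  diagonal it is the quantity x^T M^-1 x of the query rule.\<close>

definition kern :: "nat set \<Rightarrow> nat \<Rightarrow> nat \<Rightarrow> real" where
  "kern S i j = ip d (xs i) (mat_solve d (qM C xs S) (xs j))"

lemma kern_insert:
  assumes "insert t S \<subseteq> {..<T}" "t \<notin> S" "i < T" "j < T"
  shows "kern (insert t S) i j = kernel_update (kern S) t i j"
proof -
  have S: "S \<subseteq> {..<T}" "t < T" using assms by auto
  have f: "finite S" using S finite_subset by blast
  note sol = mat_solve_solves[OF S(1) xs_dim]
  have "solves (insert t S) (xs j) (\<lambda>i. mat_solve d (qM C xs S) (xs j) i - kern S t j / (1 + kern S t t) * mat_solve d (qM C xs S) (xs t) i)"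
    unfolding kern_def
    by (rule solves_insert[OF f assms(2) sol sol]) (use assms S in auto)
  then have "mat_solve d (qM C xs (insert t S)) (xs j) =
     (\<lambda>i. mat_solve d (qM C xs S) (xs j) i - kern S t j / (1 + kern S t t) * mat_solve d (qM C xs S) (xs t) i)"
    using solves_unique mat_solve_solves[OF assms(1) xs_dim[OF assms(4)]] by blast
  then have "kern (insert t S) i j = kern S i j - kern S t j / (1 + kern S t t) * kern S i t"
    by (simp only: kern_def[of "insert t S"] ip_diff_right ip_scale_right kern_def[symmetric])
  then show ?thesis unfolding kernel_update_def by simp
qed

lemma kern_sym: "S \<subseteq> {..<T} \<Longrightarrow> i < T \<Longrightarrow> j < T \<Longrightarrow> kern S i j = kern S j i"
  unfolding kern_def by (intro solves_sym[of S] mat_solve_solves xs_dim)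

lemma kern_nonneg: "S \<subseteq> {..<T} \<Longrightarrow> i < T \<Longrightarrow> kern S i i \<ge> 0"
  unfolding kern_def by (intro solves_nonneg[of S] mat_solve_solves xs_dim)

lemma kern_empty: "i < T \<Longrightarrow> j < T \<Longrightarrow> kern {} i j = C\<^sup>2 * ip d (xs i) (xs j)"
proof -
  assume "i < T" "j < T"
  have "solves {} (xs j) (\<lambda>i. C\<^sup>2 * xs j i)"
    using C_pos xs_dim[OF \<open>j < T\<close>] unfolding solves_def in_dim_def by auto
  then have "mat_solve d (qM C xs {}) (xs j) = (\<lambda>i. C\<^sup>2 * xs j i)"
    using solves_unique mat_solve_solves[of "{}" "xs j"] xs_dim[OF \<open>j < T\<close>] by blast
  then show ?thesis unfolding kern_def by (simp add: ip_scale_right)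
qed

text \<open>Each further query at t subtracts k(i,t)^2 / (1 + k(t,t)). This is what later allows the
  queries of other domains to be forgotten.\<close>

lemma kern_antimono:
  assumes "S \<subseteq> S'" "S' \<subseteq> {..<T}" "i < T"
  shows "kern S' i i \<le> kern S i i"
proof -
  have f: "finite (S' - S)" using assms finite_subset by blast
  have "kern (S \<union> D) i i \<le> kern S i i" if "finite D" "D \<subseteq> S' - S" for D
    using that
  proof (induction D rule: finite_induct)
    case (insert t D)
    have sub: "insert t (S \<union> D) \<subseteq> {..<T}" using assms insert by auto
    have "kern (S \<union> insert t D) i i = kern (S \<union> D) i i - kern (S \<union> D) i t * kern (S \<union> D) t i / (1 + kern (S \<union> D) t t)"
      using kern_insert[OF sub, of i i] insert assms by (auto simp: kernel_update_def)
    also have "kern (S \<union> D) t i = kern (S \<union> D) i t" using sub assms by (intro kern_sym) auto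
    also have "kern (S \<union> D) i i - kern (S \<union> D) i t * kern (S \<union> D) i t / (1 + kern (S \<union> D) t t) \<le> kern (S \<union> D) i i"
      using kern_nonneg[of "S \<union> D" t] sub by simp
    finally show ?case using insert by auto
  qed simp
  from this[OF f] show ?thesis using assms by (simp add: Un_absorb1)
qed

lemma foldl_kernel_update:
  assumes "distinct ts" "set ts \<subseteq> {..<T}" "i < T" "j < T"
  shows "foldl kernel_update (kern {}) ts i j = kern (set ts) i j"
  using assms
proof (induction ts arbitrary: i j rule: rev_induct)
  case (snoc t ts)
  have "foldl kernel_update (kern {}) (ts @ [t]) i j = kernel_update (kern (set ts)) t i j"
  proof -
    have IH: "foldl kernel_update (kern {}) ts i j = kern (set ts) i j" if "i < T" "j < T" for i j
      using snoc that by simp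
    have "t < T" using snoc.prems by simp
    then have "kernel_update (foldl kernel_update (kern {}) ts) t i j = kernel_update (kern (set ts)) t i j"
      unfolding kernel_update_def[of "foldl kernel_update (kern {}) ts"] kernel_update_def[of "kern (set ts)"]
      using IH snoc.prems by simp
    then show ?thesis by simp
  qed
  also have "\<dots> = kern (insert t (set ts)) i j" using kern_insert[of t "set ts" i j] snoc by auto
  finally show ?case by simp
qed simp

lemma ip_qtheta:
  assumes S: "S \<subseteq> {..<T}" and t: "t < T"
  shows "ip d (qtheta d C xs y S) (xs t) = (\<Sum>s\<in>S. y s * kern S s t)"
proof -
  have z: "solves S (xs t) (mat_solve d (qM C xs S) (xs t))" using mat_solve_solves[OF S xs_dim[OF t]] .
  have "in_dim d (qb xs y S)" using S xs_dim unfolding qb_def in_dim_def by (auto intro!: sum.neutral)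
  then have "solves S (qb xs y S) (qtheta d C xs y S)"
    unfolding qtheta_def using mat_solve_solves[OF S] by blast
  then have "ip d (qtheta d C xs y S) (xs t) = ip d (qb xs y S) (mat_solve d (qM C xs S) (xs t))"
    using solves_sym[OF _ z] by (metis ip_commute)
  then show ?thesis unfolding qb_def ip_sum_left kern_def .
qed

text \<open>The error splits into the noise sum and the ridge bias <\<theta>, z> / C^2 with z = M^-1
  x_t. Since |\<theta>| \<le> C, the bias is at most |z| / C, and |z|^2 / C^2 is one part of the
  energy <x_t, z> = \<open>kern S t t\<close>.\<close>

lemma qtheta_error:
  assumes S: "S \<subseteq> {..<T}" and t: "t < T" and th: "vnorm d \<theta> \<le> C"
  shows "\<bar>ip d (qtheta d C xs (labels d \<theta> xs \<xi>) S) (xs t) - ip d \<theta> (xs t)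
          - (\<Sum>s\<in>S. kern S s t * \<xi> s)\<bar> \<le> sqrt (kern S t t)"
proof -
  define z where "z = mat_solve d (qM C xs S) (xs t)"
  have z: "solves S (xs t) z" using mat_solve_solves[OF S xs_dim[OF t]] z_def by simp
  have 1: "ip d (qtheta d C xs (labels d \<theta> xs \<xi>) S) (xs t)
     = (\<Sum>s\<in>S. ip d \<theta> (xs s) * ip d (xs s) z) + (\<Sum>s\<in>S. kern S s t * \<xi> s)"
    unfolding ip_qtheta[OF S t] labels_def
    by (simp add: distrib_right sum.distrib kern_def z_def mult.commute)
  have 2: "ip d \<theta> (xs t) = ip d \<theta> z / C\<^sup>2 + (\<Sum>s\<in>S. ip d \<theta> (xs s) * ip d (xs s) z)"
    using solves_ip[OF z, of \<theta>] by (simp add: ip_commute mult.commute)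
  have "(ip d \<theta> z / C\<^sup>2)\<^sup>2 \<le> ip d \<theta> \<theta> * ip d z z / (C\<^sup>2)\<^sup>2"
    using Cauchy_Schwarz_ip[of d \<theta> z] by (simp add: power_divide divide_right_mono)
  also have "ip d \<theta> \<theta> \<le> C\<^sup>2"
    using th vnorm_nonneg[of d \<theta>] by (metis vnorm_sq power_mono)
  then have "ip d \<theta> \<theta> * ip d z z / (C\<^sup>2)\<^sup>2 \<le> C\<^sup>2 * ip d z z / (C\<^sup>2)\<^sup>2"
    by (intro divide_right_mono mult_right_mono) (auto simp: ip_self_nonneg)
  also have "\<dots> = ip d z z / C\<^sup>2" using C_pos by (simp add: power2_eq_square)
  also have "\<dots> \<le> kern S t t"
    using solves_energy[OF z] sum_nonneg[of S "\<lambda>s. (ip d (xs s) z)\<^sup>2"] by (simp add: kern_def z_def)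
  finally have "\<bar>ip d \<theta> z / C\<^sup>2\<bar> \<le> sqrt (kern S t t)" by (simp add: real_le_rsqrt abs_le_iff power2_eq_square)
  then show ?thesis using 1 2 by simp
qed

text \<open>The other part of the same energy. It controls the variance of the noise sum in
  \<open>qtheta_error\<close>.\<close>

lemma sum_kern_sq_le:
  assumes S: "S \<subseteq> {..<T}" and t: "t < T"
  shows "(\<Sum>s\<in>S. (kern S s t)\<^sup>2) \<le> kern S t t"
proof -
  define z where "z = mat_solve d (qM C xs S) (xs t)"
  have z: "solves S (xs t) z" using mat_solve_solves[OF S xs_dim[OF t]] z_def by simp
  show ?thesis using solves_energy[OF z] ip_self_nonneg[of d z] C_pos by (simp add: kern_def z_def)
qed

end

section \<open>Coordinates of a domain and its elliptical potential\<close>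

text \<open>Zero vectors are allowed in \<open>E\<close>: the list keeps its length \<open>k\<close>
  even when \<open>B\<close> is linearly dependent, so no rank has to be chosen.\<close>

lemma Gram_Schmidt:
  fixes B :: "nat \<Rightarrow> vect"
  assumes "\<forall>j<k. in_dim d (B j)"
  shows "\<exists>E :: nat \<Rightarrow> vect. (\<forall>l<k. in_dim d (E l)) \<and>
     (\<forall>l<k. \<forall>l'<k. l \<noteq> l' \<longrightarrow> ip d (E l) (E l') = 0) \<and>
     (\<forall>l<k. ip d (E l) (E l) = 1 \<or> E l = (\<lambda>i. 0)) \<and>
     (\<forall>a. \<exists>e. \<forall>i. (\<Sum>j<k. a j * B j i) = (\<Sum>j<k. e j * E j i))"
  using assms
proof (induction k)
  case (Suc k)
  have "\<forall>j<k. in_dim d (B j)" using Suc.prems by simp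
  from Suc.IH[OF this] obtain E where E0: "\<forall>l<k. in_dim d (E l)"
    and E: "\<forall>l<k. \<forall>l'<k. l \<noteq> l' \<longrightarrow> ip d (E l) (E l') = 0"
      "\<forall>l<k. ip d (E l) (E l) = 1 \<or> E l = (\<lambda>i. 0)"
      "\<forall>a. \<exists>e. \<forall>i. (\<Sum>j<k. a j * B j i) = (\<Sum>j<k. e j * E j i)" by (elim exE conjE) (rule that; assumption)
  define r where "r = (\<lambda>i. B k i - (\<Sum>j<k. ip d (B k) (E j) * E j i))"
  have rdim: "in_dim d r" using Suc.prems E0 unfolding r_def in_dim_def by simp
  have zero: "ip d v (\<lambda>i. 0) = 0" for v by (simp add: ip_def)
  have orth: "ip d (E l) r = 0" if "l < k" for l
  proof -
    have "ip d (E l) r = ip d (E l) (B k) - (\<Sum>j<k. ip d (B k) (E j) * ip d (E l) (E j))"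
      unfolding r_def ip_diff_right ip_sum_right ..
    also have "(\<Sum>j<k. ip d (B k) (E j) * ip d (E l) (E j)) = (\<Sum>j<k. if j = l then ip d (B k) (E l) * ip d (E l) (E l) else 0)"
      using E(1) that by (intro sum.cong) auto
    also have "\<dots> = ip d (B k) (E l) * ip d (E l) (E l)" using that by simp
    finally show ?thesis using E(2) that zero by (auto simp: ip_commute)
  qed
  \<comment> \<open>If \<open>r\<close> vanishes, division by zero makes \<open>q\<close> zero and
    hence the new vector zero.\<close>
  define q where "q = 1 / sqrt (ip d r r)"
  define E' where "E' = E(k := (\<lambda>i. q * r i))"
  have small: "E' l = E l" if "l < k" for l using that by (simp add: E'_def)
  have ort': "ip d (E l) (E' k) = 0" if "l < k" for l
    using orth[OF that] by (simp add: E'_def ip_scale_right)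
  have E0': "\<forall>l<Suc k. in_dim d (E' l)"
    using E0 rdim by (auto simp: less_Suc_eq E'_def in_dim_def)
  have 1: "\<forall>l<Suc k. \<forall>l'<Suc k. l \<noteq> l' \<longrightarrow> ip d (E' l) (E' l') = 0"
    using E(1) ort' small by (auto simp: less_Suc_eq) (metis ip_commute)
  have 2: "\<forall>l<Suc k. ip d (E' l) (E' l) = 1 \<or> E' l = (\<lambda>i. 0)"
  proof -
    have "ip d (E' k) (E' k) = 1" if "ip d r r \<noteq> 0"
    proof -
      have "ip d (E' k) (E' k) = q * (q * ip d r r)"
        unfolding E'_def by (simp add: ip_scale_right) (metis ip_commute ip_scale_right)
      also have "\<dots> = 1" using that ip_self_nonneg[of d r] by (simp add: q_def)
      finally show ?thesis .
    qed
    moreover have "E' k = (\<lambda>i. 0)" if "ip d r r = 0" using that by (simp add: E'_def q_def)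
    ultimately show ?thesis using E(2) small by (auto simp: less_Suc_eq)
  qed
  have r: "r i = sqrt (ip d r r) * E' k i" for i
    using ip_self_eq_0[OF _ rdim] by (cases "ip d r r = 0") (auto simp: E'_def q_def fun_eq_iff)
  have 3: "\<forall>a. \<exists>e. \<forall>i. (\<Sum>j<Suc k. a j * B j i) = (\<Sum>j<Suc k. e j * E' j i)"
  proof
    fix a :: "nat \<Rightarrow> real"
    obtain e where e: "\<forall>i. (\<Sum>j<k. a j * B j i) = (\<Sum>j<k. e j * E j i)" using E(3)[rule_format, of a] ..
    let ?e = "\<lambda>j. if j = k then a k * sqrt (ip d r r) else e j + a k * ip d (B k) (E j)"
    have "(\<Sum>j<Suc k. a j * B j i) = (\<Sum>j<Suc k. ?e j * E' j i)" for i
    proof -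
      have "B k i = r i + (\<Sum>j<k. ip d (B k) (E j) * E j i)" by (simp add: r_def)
      then have "(\<Sum>j<Suc k. a j * B j i) = (\<Sum>j<k. e j * E j i) + a k * r i + a k * (\<Sum>j<k. ip d (B k) (E j) * E j i)"
        using e by (simp add: algebra_simps)
      also have "\<dots> = (\<Sum>j<k. (e j + a k * ip d (B k) (E j)) * E j i) + a k * r i"
        by (simp add: sum.distrib sum_distrib_left algebra_simps)
      also have "a k * r i = a k * sqrt (ip d r r) * E' k i" by (subst r) simp
      also have "(\<Sum>j<k. (e j + a k * ip d (B k) (E j)) * E j i) = (\<Sum>j<k. ?e j * E' j i)"
        using small by (intro sum.cong) auto
      finally show ?thesis by simp
    qed
    then show "\<exists>e. \<forall>i. (\<Sum>j<Suc k. a j * B j i) = (\<Sum>j<Suc k. e j * E' j i)"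
      by (intro exI[of _ ?e] allI)
  qed
  show ?case using E0' 1 2 3 by (intro exI[of _ E'] conjI)
qed simp

lemma subspace_coordinates:
  fixes B :: "nat \<Rightarrow> vect"
  assumes "\<And>j. j < k \<Longrightarrow> in_dim d (B j)"
    and "\<And>t. t \<in> A \<Longrightarrow> \<exists>a :: nat \<Rightarrow> real. xs t = (\<lambda>i. \<Sum>j<k. a j * B j i)"
  shows "\<exists>h :: nat \<Rightarrow> nat \<Rightarrow> real. \<forall>s\<in>A. \<forall>t\<in>A. ip d (xs s) (xs t) = (\<Sum>l<k. h l s * h l t)"
proof -
  have dims: "\<forall>j<k. in_dim d (B j)" using assms(1) by simp
  obtain E where E: "\<forall>l<k. \<forall>l'<k. l \<noteq> l' \<longrightarrow> ip d (E l) (E l') = 0"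
      "\<forall>l<k. ip d (E l) (E l) = 1 \<or> E l = (\<lambda>i. 0)"
      "\<forall>a. \<exists>e. \<forall>i. (\<Sum>j<k. a j * B j i) = (\<Sum>j<k. e j * E j i)"
    using Gram_Schmidt[OF dims] by (elim exE conjE) (rule that; assumption)
  have "\<forall>t\<in>A. \<exists>e. xs t = (\<lambda>i. \<Sum>j<k. e j * E j i)"
  proof
    fix t assume "t \<in> A"
    then obtain a where a: "xs t = (\<lambda>i. \<Sum>j<k. a j * B j i)" using assms(2) by blast
    obtain e where "\<forall>i. (\<Sum>j<k. a j * B j i) = (\<Sum>j<k. e j * E j i)" using E(3)[rule_format, of a] ..
    then show "\<exists>e. xs t = (\<lambda>i. \<Sum>j<k. e j * E j i)" using a by auto
  qed
  then obtain e where e: "\<And>t. t \<in> A \<Longrightarrow> xs t = (\<lambda>i. \<Sum>j<k. e t j * E j i)" by metis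
  \<comment> \<open>The factor is 1 or 0; it removes the arbitrary coefficients along zero
    vectors.\<close>
  define h where "h l t = e t l * ip d (E l) (E l)" for l t
  have "ip d (xs s) (xs t) = (\<Sum>l<k. h l s * h l t)" if st: "s \<in> A" "t \<in> A" for s t
  proof -
    have "ip d (xs s) (xs t) = (\<Sum>l<k. e t l * (\<Sum>j<k. e s j * ip d (E j) (E l)))"
      unfolding e[OF st(1)] e[OF st(2)] ip_sum_right ip_sum_left ..
    also have "\<dots> = (\<Sum>l<k. h l s * h l t)"
    proof (intro sum.cong refl)
      fix l assume l: "l \<in> {..<k}"
      have "(\<Sum>j<k. e s j * ip d (E j) (E l)) = (\<Sum>j<k. if j = l then e s l * ip d (E l) (E l) else 0)"
        using E(1) l by (intro sum.cong) auto
      also have "\<dots> = e s l * ip d (E l) (E l)" using l by simp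
      finally have "e t l * (\<Sum>j<k. e s j * ip d (E j) (E l)) = e t l * (e s l * ip d (E l) (E l))" by simp
      moreover have "ip d (E l) (E l) = ip d (E l) (E l) * ip d (E l) (E l)"
        using E(2) l by (auto simp: ip_def)
      ultimately show "e t l * (\<Sum>j<k. e s j * ip d (E j) (E l)) = h l s * h l t"
        unfolding h_def by algebra
    qed
    finally show ?thesis .
  qed
  then show ?thesis by blast
qed

lemma min_one_le_ln: "w \<ge> 0 \<Longrightarrow> min 1 w \<le> 2 * ln (1 + w)" for w :: real
proof (cases "w \<le> 1")
  case True
  assume "w \<ge> 0"
  have "w / (1 + w) \<le> ln (1 + w)"
    using \<open>w \<ge> 0\<close> ln_le_minus_one[of "1 / (1 + w)"] by (simp add: ln_div field_simps)
  moreover have "w / (1 + w) \<ge> w / 2" using \<open>w \<ge> 0\<close> True by (intro divide_left_mono) auto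
  ultimately have "w \<le> 2 * ln (1 + w)" by linarith
  then show ?thesis using True by simp
next
  case False
  assume "w \<ge> 0"
  have "ln 2 \<le> ln (1 + w)" using False by simp
  moreover have "(1::real) / 2 \<le> ln 2" using ln_le_minus_one[of "1/2::real"] by (simp add: ln_div)
  ultimately have "1 \<le> 2 * ln (1 + w)" by linarith
  then show ?thesis using False by simp
qed

context design begin

text \<open>In chronological order the factors 1 + k(t,t) multiply to \<open>kernel_det\<close>, so
  their logarithms, which dominate the widths up to the factor 2, telescope. In orthogonal
  coordinates each of the \<open>k\<close> rank-one terms contributes at most 1 + C^2
  \<open>card S\<close>, because the contexts have norm at most 1.\<close>

lemma elliptical_potential:
  assumes I: "S \<subseteq> {..<T}" and nrm: "\<And>t. t \<in> S \<Longrightarrow> vnorm d (xs t) \<le> 1"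
    and B: "\<And>j. j < k \<Longrightarrow> in_dim d (B j)"
      "\<And>t. t \<in> S \<Longrightarrow> \<exists>a :: nat \<Rightarrow> real. xs t = (\<lambda>i. \<Sum>j<k. a j * B j i)"
  shows "(\<Sum>t\<in>S. min 1 (kern (S \<inter> {..<t}) t t)) \<le> 2 * real k * ln (1 + C\<^sup>2 * real (card S))"
proof -
  have fin: "finite S" using I finite_subset by blast
  obtain h where h: "\<forall>s\<in>S. \<forall>t\<in>S. ip d (xs s) (xs t) = (\<Sum>l<k. h l s * h l t)"
    using subspace_coordinates[of k d B S xs] B by blast
  let ?K = "\<lambda>i j. \<Sum>l<k. C\<^sup>2 * h l i * h l j"
  define L where "L = sorted_list_of_set S"
  have L: "sorted_wrt (<) L" "set L = S" "distinct L" using fin by (auto simp: L_def)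
  have pre: "ln (kernel_det (kern {}) ts) = (\<Sum>t\<in>set ts. ln (1 + kern (set ts \<inter> {..<t}) t t)) \<and> kernel_det (kern {}) ts > 0"
    if "sorted_wrt (<) ts" "set ts \<subseteq> {..<T}" for ts
    using that
  proof (induction ts rule: rev_induct)
    case (snoc t ts)
    have IH: "ln (kernel_det (kern {}) ts) = (\<Sum>t\<in>set ts. ln (1 + kern (set ts \<inter> {..<t}) t t))"
      "kernel_det (kern {}) ts > 0" using snoc by (auto simp: sorted_wrt_append)
    have dts: "distinct ts" using snoc.prems(1) strict_sorted_iff sorted_wrt_append by blast
    have lt: "\<forall>s\<in>set ts. s < t" using snoc.prems by (auto simp: sorted_wrt_append)
    have eq: "foldl kernel_update (kern {}) ts t t = kern (set ts) t t"
      using foldl_kernel_update[OF dts] snoc.prems by auto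
    have pos: "kern (set ts) t t \<ge> 0" using kern_nonneg snoc.prems by auto
    have "ln (kernel_det (kern {}) (ts @ [t])) = ln (kernel_det (kern {}) ts) + ln (1 + kern (set ts) t t)"
      using IH(2) pos by (simp add: kernel_det_snoc eq ln_mult)
    also have "ln (1 + kern (set ts) t t) = ln (1 + kern (set (ts @ [t]) \<inter> {..<t}) t t)"
    proof -
      have "set (ts @ [t]) \<inter> {..<t} = set ts" using lt by auto
      then show ?thesis by simp
    qed
    also have "ln (kernel_det (kern {}) ts) = (\<Sum>s\<in>set ts. ln (1 + kern (set (ts @ [t]) \<inter> {..<s}) s s))"
      unfolding IH(1)
    proof (intro sum.cong refl)
      fix s assume "s \<in> set ts"
      then have "set (ts @ [t]) \<inter> {..<s} = set ts \<inter> {..<s}" using lt by auto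
      then show "ln (1 + kern (set ts \<inter> {..<s}) s s) = ln (1 + kern (set (ts @ [t]) \<inter> {..<s}) s s)" by simp
    qed
    finally show ?case using lt IH(2) pos by (auto simp: kernel_det_snoc eq intro!: mult_pos_pos)
  qed simp
  have "(\<Sum>t\<in>S. min 1 (kern (S \<inter> {..<t}) t t)) \<le> (\<Sum>t\<in>S. 2 * ln (1 + kern (S \<inter> {..<t}) t t))"
    using I by (intro sum_mono min_one_le_ln kern_nonneg) auto
  also have "\<dots> = 2 * ln (kernel_det (kern {}) L)" using pre[OF L(1)] L(2) I by (simp add: sum_distrib_left)
  also have "kernel_det (kern {}) L = kernel_det ?K L"
    using L(2) h I by (intro kernel_det_cong[of _ S])
      (auto simp: kern_empty subset_iff sum_distrib_left mult.assoc)
  also have "2 * ln (kernel_det ?K L) \<le> 2 * ln ((1 + C\<^sup>2 * card S) ^ k)"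
  proof -
    have pos: "kernel_det ?K L > 0" using C_pos by (intro kernel_det_pos psd_kernel_sum) auto
    have "kernel_det ?K L \<le> (\<Prod>l<k. 1 + C\<^sup>2 * (\<Sum>t\<leftarrow>L. (h l t)\<^sup>2))"
      using C_pos by (intro kernel_det_le) auto
    also have "\<dots> \<le> (\<Prod>l<k. 1 + C\<^sup>2 * card S)"
    proof (intro prod_mono conjI)
      fix l assume l: "l \<in> {..<k}"
      have "(\<Sum>t\<leftarrow>L. (h l t)\<^sup>2) = (\<Sum>t\<in>S. (h l t)\<^sup>2)" using L by (metis sum_list_distinct_conv_sum_set)
      also have "\<dots> \<le> (\<Sum>t\<in>S. 1)"
      proof (intro sum_mono)
        fix t assume t: "t \<in> S"
        have "(h l t)\<^sup>2 \<le> (\<Sum>l<k. h l t * h l t)"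
          using l member_le_sum[of l "{..<k}" "\<lambda>l. h l t * h l t"] by (simp add: power2_eq_square)
        also have "\<dots> = (vnorm d (xs t))\<^sup>2" using h t by (simp add: vnorm_sq)
        also have "\<dots> \<le> 1" using nrm[OF t] vnorm_nonneg[of d "xs t"] by (simp add: power_le_one)
        finally show "(h l t)\<^sup>2 \<le> 1" .
      qed
      finally show "1 + C\<^sup>2 * (\<Sum>t\<leftarrow>L. (h l t)\<^sup>2) \<le> 1 + C\<^sup>2 * card S" by (simp add: mult_left_mono)
      show "0 \<le> 1 + C\<^sup>2 * (\<Sum>t\<leftarrow>L. (h l t)\<^sup>2)"
        by (auto intro!: add_nonneg_nonneg mult_nonneg_nonneg sum_list_nonneg)
    qed
    finally show ?thesis using pos by simp
  qed
  also have "\<dots> = 2 * real k * ln (1 + C\<^sup>2 * card S)"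
    by (simp add: ln_realpow add_pos_nonneg)
  finally show ?thesis .
qed

end

section \<open>Random coins and noise\<close>

abbreviation coin :: "real measure" where "coin \<equiv> uniform_measure lborel {0..1}"

lemma prob_space_coin: "prob_space coin"
  by (rule prob_space_uniform_measure) auto

lemma prob_space_coin_space: "prob_space (coin_space n)"
  unfolding coin_space_def by (intro prob_space_PiM prob_space_coin)

lemma nn_integral_coin:
  assumes "0 \<le> p" "p \<le> 1" "0 \<le> a" "0 \<le> b"
  shows "(\<integral>\<^sup>+v. ennreal (if v < p then a else b) \<partial>coin) = ennreal (p * a + (1 - p) * b)"
proof -
  have e: "emeasure coin A = emeasure lborel ({0..1} \<inter> A)" if "A \<in> sets borel" for A
    using that by (subst emeasure_uniform_measure) (auto simp: divide_ennreal_def)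
  have s1: "{0..1} \<inter> {..<p} = {0..<p}" and s2: "{0..1} \<inter> {p..} = {p..1}"
    using assms by auto
  have "(\<integral>\<^sup>+v. ennreal (if v < p then a else b) \<partial>coin)
     = (\<integral>\<^sup>+v. ennreal a * indicator {..<p} v + ennreal b * indicator {p..} v \<partial>coin)"
    by (intro nn_integral_cong) (auto simp: indicator_def)
  also have "\<dots> = ennreal a * emeasure coin {..<p} + ennreal b * emeasure coin {p..}"
    by (subst nn_integral_add) (auto simp: nn_integral_cmult_indicator)
  also have "\<dots> = ennreal (p * a + (1 - p) * b)"
  proof -
    have "emeasure coin {..<p} = ennreal p" "emeasure coin {p..} = ennreal (1 - p)"
      using assms by (simp_all add: e s1 s2 divide_ennreal_def)
    then have "ennreal a * emeasure coin {..<p} + ennreal b * emeasure coin {p..} = ennreal (a * p) + ennreal (b * (1 - p))"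
      using assms by (simp add: ennreal_mult')
    also have "\<dots> = ennreal (a * p + b * (1 - p))" using assms by (intro ennreal_plus[symmetric]) auto
    finally show ?thesis by (simp add: mult.commute)
  qed
  finally show ?thesis .
qed

lemma qufur_Q_subset: "qufur_Q d eta C alpha xs u t \<subseteq> {..<t}"
  by (induction t) (auto simp: Let_def less_Suc_eq)

lemma qufur_Q_cong: "(\<And>s. s < t \<Longrightarrow> u s = u' s) \<Longrightarrow> qufur_Q d eta C alpha xs u t = qufur_Q d eta C alpha xs u' t"
  by (induction t) (auto simp: Let_def)

lemma qufur_Q_mem:
  "t < n \<Longrightarrow> t \<in> qufur_Q d eta C alpha xs u n \<longleftrightarrow>
     u t < min 1 (alpha * qDelta d eta C xs (qufur_Q d eta C alpha xs u t) t)"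
proof (induction n)
  case (Suc n)
  then show ?case
    using qufur_Q_subset[of d eta C alpha xs u t] by (cases "t = n") (auto simp: Let_def)
qed simp

lemma qufur_Q_Int: "t \<le> n \<Longrightarrow> qufur_Q d eta C alpha xs u n \<inter> {..<t} = qufur_Q d eta C alpha xs u t"
  using qufur_Q_mem qufur_Q_subset
  by (auto 4 4 simp: subset_iff) (meson less_le_trans qufur_Q_mem)+

lemma measurable_qufur_Q:
  assumes "t \<le> n"
  shows "(\<lambda>u. qufur_Q d eta C alpha xs u t) \<in> measurable (coin_space n) (count_space (Pow {..<t}))"
  using assms
proof (induction t)
  case 0
  then show ?case by (simp add: measurable_count_space_eq2)
next
  case (Suc t)
  define f where "f S u = (if u t < min 1 (alpha * qDelta d eta C xs S t) then insert t S else S)" for S and u :: "nat \<Rightarrow> real"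
  have comp: "(\<lambda>u. u t) \<in> borel_measurable (coin_space n)"
    using Suc.prems unfolding coin_space_def
    by (subst measurable_cong_sets[OF refl, of _ "uniform_measure lborel {0..1}"])
       (auto intro!: measurable_component_singleton)
  have "(\<lambda>u. f (qufur_Q d eta C alpha xs u t) u) \<in> measurable (coin_space n) (count_space (Pow {..<Suc t}))"
  proof (rule measurable_compose_countable'[of "Pow {..<t}" f])
    show "(\<lambda>u. qufur_Q d eta C alpha xs u t) \<in> measurable (coin_space n) (count_space (Pow {..<t}))"
      using Suc by simp
    show "countable (Pow {..<t})" by (simp add: countable_finite)
    fix S assume S: "S \<in> Pow {..<t}"
    have "{u \<in> space (coin_space n). u t < min 1 (alpha * qDelta d eta C xs S t)} \<in> sets (coin_space n)"
      using comp by measurable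
    then show "(\<lambda>u. f S u) \<in> measurable (coin_space n) (count_space (Pow {..<Suc t}))"
      unfolding f_def using S by (intro measurable_If measurable_const) auto
  qed
  then show ?case by (simp add: f_def Let_def)
qed

text \<open>The last coin is integrated first: the query set before round \<open>k\<close> is a
  function of the coins below \<open>k\<close>, so the factor of round \<open>k\<close> sees a fixed
  set and a fresh coin. For this reason \<open>g\<close> takes the set and the coin as separate
  arguments.\<close>

lemma coin_supermartingale:
  fixes g :: "nat \<Rightarrow> nat set \<Rightarrow> real \<Rightarrow> ennreal"
  assumes meas: "\<And>t S. g t S \<in> borel_measurable borel"
    and le: "\<And>t S. S \<subseteq> {..<t} \<Longrightarrow> t < n \<Longrightarrow> (\<integral>\<^sup>+v. g t S v \<partial>coin) \<le> 1"
  shows "(\<lambda>u. \<Prod>t<n. g t (qufur_Q d eta C alpha xs u t) (u t)) \<in> borel_measurable (coin_space n) \<and>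
    (\<integral>\<^sup>+u. (\<Prod>t<n. g t (qufur_Q d eta C alpha xs u t) (u t)) \<partial>coin_space n) \<le> 1"
proof -
  interpret P: product_prob_space "\<lambda>_::nat. coin" UNIV
    using prob_space_coin by (intro product_prob_spaceI)
  have m: "(\<lambda>u. g t (qufur_Q d eta C alpha xs u t) (u t)) \<in> borel_measurable (coin_space k)" if "t < k" for t k
  proof (rule measurable_compose_countable'[of "Pow {..<t}" "\<lambda>S u. g t S (u t)"])
    show "(\<lambda>u. qufur_Q d eta C alpha xs u t) \<in> measurable (coin_space k) (count_space (Pow {..<t}))"
      using that by (intro measurable_qufur_Q) simp
    show "countable (Pow {..<t})" by (simp add: countable_finite)
    fix S assume S: "S \<in> Pow {..<t}"
    have "(\<lambda>u. u t) \<in> borel_measurable (coin_space k)"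
      using that unfolding coin_space_def
      by (subst measurable_cong_sets[OF refl, of _ "uniform_measure lborel {0..1}"])
         (auto intro!: measurable_component_singleton)
    then show "(\<lambda>u. g t S (u t)) \<in> borel_measurable (coin_space k)"
      using meas by (rule measurable_compose)
  qed
  have mm: "(\<lambda>u. \<Prod>t<k. g t (qufur_Q d eta C alpha xs u t) (u t)) \<in> borel_measurable (coin_space k)" for k
    by (intro borel_measurable_prod_ennreal m) simp
  have "(\<integral>\<^sup>+u. (\<Prod>t<k. g t (qufur_Q d eta C alpha xs u t) (u t)) \<partial>coin_space k) \<le> 1" if "k \<le> n" for k
    using that
  proof (induction k)
    case 0
    show ?case by (simp add: coin_space_def PiM_empty)
  next
    case (Suc k)
    let ?F = "\<lambda>k u. \<Prod>t<k. g t (qufur_Q d eta C alpha xs u t) (u t)"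
    have ins: "{..<Suc k} = insert k {..<k}" by auto
    have "(\<integral>\<^sup>+u. ?F (Suc k) u \<partial>coin_space (Suc k))
       = (\<integral>\<^sup>+u. (\<integral>\<^sup>+v. ?F (Suc k) (u(k := v)) \<partial>coin) \<partial>coin_space k)"
      using mm[of "Suc k"] unfolding coin_space_def ins
      by (intro P.product_nn_integral_insert) auto
    also have "\<dots> = (\<integral>\<^sup>+u. (\<integral>\<^sup>+v. ?F k u * g k (qufur_Q d eta C alpha xs u k) v \<partial>coin) \<partial>coin_space k)"
    proof (intro nn_integral_cong)
      fix u :: "nat \<Rightarrow> real" and v :: real
      have q: "qufur_Q d eta C alpha xs (u(k := v)) t = qufur_Q d eta C alpha xs u t" if "t \<le> k" for t
        using that by (intro qufur_Q_cong) auto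
      have "?F k (u(k := v)) = ?F k u" using q by (intro prod.cong) auto
      then show "?F (Suc k) (u(k := v)) = ?F k u * g k (qufur_Q d eta C alpha xs u k) v"
        using q[of k] by simp
    qed
    also have "\<dots> = (\<integral>\<^sup>+u. ?F k u * (\<integral>\<^sup>+v. g k (qufur_Q d eta C alpha xs u k) v \<partial>coin) \<partial>coin_space k)"
      using meas by (intro nn_integral_cong nn_integral_cmult) simp
    also have "\<dots> \<le> (\<integral>\<^sup>+u. ?F k u * 1 \<partial>coin_space k)"
      using le[OF qufur_Q_subset] Suc.prems by (intro nn_integral_mono mult_left_mono) auto
    also have "\<dots> \<le> 1" using Suc by simp
    finally show ?case .
  qed
  then show ?thesis using mm by blast
qed

lemma exp_Markov:
  assumes [measurable]: "X \<in> borel_measurable M"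
  shows "{x \<in> space M. X x \<ge> l} \<in> sets M"
    and "emeasure M {x \<in> space M. X x \<ge> l} \<le> ennreal (exp (- l)) * (\<integral>\<^sup>+x. ennreal (exp (X x)) \<partial>M)"
proof -
  show "{x \<in> space M. X x \<ge> l} \<in> sets M" by measurable
  have m: "(\<lambda>x. ennreal (exp (X x)) * indicator (space M) x) \<in> borel_measurable M" by measurable
  have "{x \<in> space M. X x \<ge> l} = {x \<in> space M. 1 \<le> ennreal (exp (- l)) * ennreal (exp (X x))}"
  proof -
    have "l \<le> y \<longleftrightarrow> 1 \<le> ennreal (exp (- l)) * ennreal (exp y)" for y
    proof -
      have "ennreal (exp (- l)) * ennreal (exp y) = ennreal (exp (y - l))"
        by (simp flip: ennreal_mult exp_add)
      then show ?thesis by simp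
    qed
    then show ?thesis by simp
  qed
  then have "emeasure M {x \<in> space M. X x \<ge> l}
     \<le> ennreal (exp (- l)) * (\<integral>\<^sup>+x. ennreal (exp (X x)) * indicator (space M) x \<partial>M)"
    using nn_integral_Markov_inequality[OF m, of "ennreal (exp (- l))"] by simp
  also have "(\<integral>\<^sup>+x. ennreal (exp (X x)) * indicator (space M) x \<partial>M) = (\<integral>\<^sup>+x. ennreal (exp (X x)) \<partial>M)"
    by (intro nn_integral_cong) auto
  finally show "emeasure M {x \<in> space M. X x \<ge> l} \<le> ennreal (exp (- l)) * (\<integral>\<^sup>+x. ennreal (exp (X x)) \<partial>M)" .
qed

lemma coin_tail:
  fixes Y :: "nat \<Rightarrow> nat set \<Rightarrow> real \<Rightarrow> real"
  assumes meas: "\<And>t S. Y t S \<in> borel_measurable borel"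
    and le: "\<And>t S. S \<subseteq> {..<t} \<Longrightarrow> t < n \<Longrightarrow> (\<integral>\<^sup>+v. ennreal (exp (Y t S v)) \<partial>coin) \<le> 1"
  shows "{u \<in> space (coin_space n). (\<Sum>t<n. Y t (qufur_Q d eta C alpha xs u t) (u t)) \<ge> l} \<in> sets (coin_space n) \<and>
    emeasure (coin_space n) {u \<in> space (coin_space n). (\<Sum>t<n. Y t (qufur_Q d eta C alpha xs u t) (u t)) \<ge> l}
      \<le> ennreal (exp (- l))"
proof -
  let ?F = "\<lambda>u. \<Prod>t<n. ennreal (exp (Y t (qufur_Q d eta C alpha xs u t) (u t)))"
  have F: "?F \<in> borel_measurable (coin_space n)" "(\<integral>\<^sup>+u. ?F u \<partial>coin_space n) \<le> 1"
    using coin_supermartingale[of "\<lambda>t S v. ennreal (exp (Y t S v))" n d eta C alpha xs] meas le by auto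
  have FF: "?F u = ennreal (exp (\<Sum>t<n. Y t (qufur_Q d eta C alpha xs u t) (u t)))" for u
    by (simp add: prod_ennreal exp_sum)
  have X: "(\<lambda>u. \<Sum>t<n. Y t (qufur_Q d eta C alpha xs u t) (u t)) \<in> borel_measurable (coin_space n)"
  proof -
    \<comment> \<open>Measurability of the exponent is recovered from that of the product by a
      logarithm.\<close>
    have "(\<lambda>u. ln (enn2real (?F u))) \<in> borel_measurable (coin_space n)" using F(1) by measurable
    then show ?thesis unfolding FF by simp
  qed
  have "ennreal (exp (- l)) * (\<integral>\<^sup>+u. ?F u \<partial>coin_space n) \<le> ennreal (exp (- l)) * 1"
    using F(2) by (intro mult_left_mono) auto
  then show ?thesis using exp_Markov[OF X, of l] unfolding FF by (auto intro: order_trans)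
qed

lemma nn_integral_coin_le_one:
  assumes "0 \<le> p" "p \<le> 1" "p * exp a + (1 - p) * exp b \<le> 1"
  shows "(\<integral>\<^sup>+v. ennreal (exp (if v < p then a else b)) \<partial>coin) \<le> 1"
proof -
  have "(\<integral>\<^sup>+v. ennreal (exp (if v < p then a else b)) \<partial>coin) = (\<integral>\<^sup>+v. ennreal (if v < p then exp a else exp b) \<partial>coin)"
    by (intro nn_integral_cong) auto
  also have "\<dots> = ennreal (p * exp a + (1 - p) * exp b)" using assms by (intro nn_integral_coin) auto
  also have "\<dots> \<le> 1" using assms by (simp only: ennreal_le_1)
  finally show ?thesis .
qed

lemma exp_half_bound:
  fixes a :: real assumes "0 \<le> a" "a \<le> 1" shows "exp (- a) \<le> 1 - a / 2"
proof -
  have "1 + a \<le> exp a" by simp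
  then have "exp (- a) \<le> 1 / (1 + a)" using assms by (simp add: exp_minus field_simps)
  also have "\<dots> \<le> 1 - a / 2"
  proof -
    have "a * a \<le> a * 1" using assms by (intro mult_left_mono) auto
    then show ?thesis using assms by (simp add: field_simps)
  qed
  finally show ?thesis .
qed

text \<open>Makes the width collected at queried rounds at least half of its compensator, the sum of
  \<open>p * a\<close>, up to a logarithm. The half is the loss in exp (-a) \<le> 1 - a/2, which is
  where a \<le> 1 enters.\<close>

lemma coin_exp_lower:
  assumes "0 \<le> p" "p \<le> 1" "0 \<le> a" "a \<le> 1"
  shows "(\<integral>\<^sup>+v. ennreal (exp (if v < p then p * a / 2 - a else p * a / 2)) \<partial>coin) \<le> 1"
proof (rule nn_integral_coin_le_one[OF assms(1,2)])
  have "p * exp (p * a / 2 - a) + (1 - p) * exp (p * a / 2) = exp (p * a / 2) * (1 - p * (1 - exp (- a)))"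
    using exp_add[of "p * a / 2" "- a"] by (simp add: algebra_simps)
  also have "\<dots> \<le> exp (p * a / 2) * exp (- (p * a / 2))"
  proof (intro mult_left_mono)
    have "p * (1 - exp (- a)) \<ge> p * (a / 2)" using exp_half_bound[OF assms(3,4)] assms by (intro mult_left_mono) auto
    then have "1 - p * (1 - exp (- a)) \<le> 1 + (- (p * a / 2))" by simp
    also have "\<dots> \<le> exp (- (p * a / 2))" by (rule exp_ge_add_one_self)
    finally show "1 - p * (1 - exp (- a)) \<le> exp (- (p * a / 2))" .
  qed simp
  also have "\<dots> = 1" by (simp flip: exp_add)
  finally show "p * exp (p * a / 2 - a) + (1 - p) * exp (p * a / 2) \<le> 1" .
qed

text \<open>Makes the number of queries at most twice the sum of their probabilities, up to a
  logarithm. The 2 comes from exp 1 - 1 \<le> 2.\<close>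

lemma coin_exp_upper:
  assumes "0 \<le> p" "p \<le> 1"
  shows "(\<integral>\<^sup>+v. ennreal (exp (if v < p then 1 - 2 * p else - 2 * p)) \<partial>coin) \<le> 1"
proof (rule nn_integral_coin_le_one[OF assms(1,2)])
  have "p * exp (1 - 2 * p) + (1 - p) * exp (- 2 * p) = exp (- 2 * p) * (1 + p * (exp 1 - 1))"
    by (simp add: exp_diff exp_minus field_simps)
  also have "\<dots> \<le> exp (- 2 * p) * exp (2 * p)"
  proof (intro mult_left_mono)
    have "exp 1 \<le> (3::real)" using exp_le by simp
    then have "p * (exp 1 - 1) \<le> p * 2" using assms by (intro mult_left_mono) auto
    then have "1 + p * (exp 1 - 1) \<le> 1 + 2 * p" by simp
    also have "\<dots> \<le> exp (2 * p)" by (rule exp_ge_add_one_self)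
    finally show "1 + p * (exp 1 - 1) \<le> exp (2 * p)" .
  qed simp
  also have "\<dots> = 1" by (simp flip: exp_add)
  finally show "p * exp (1 - 2 * p) + (1 - p) * exp (- 2 * p) \<le> 1" .
qed

section \<open>Tails of sums of sub-Gaussian noise\<close>

lemma noise_space_prob:
  assumes "\<And>t. t < T \<Longrightarrow> prob_space (N t)"
  shows "prob_space (noise_space T N)"
proof -
  \<comment> \<open>\<open>N\<close> is unconstrained from \<open>T\<close> on; padding it with a
    probability measure leaves the product over \<open>{..<T}\<close> unchanged.\<close>
  let ?N = "\<lambda>t. if t < T then N t else coin"
  have "noise_space T N = PiM {..<T} ?N" unfolding noise_space_def by (intro PiM_cong) auto
  moreover have "prob_space (PiM {..<T} ?N)" using assms prob_space_coin by (intro prob_space_PiM) auto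
  ultimately show ?thesis by simp
qed

lemma subgaussian_mgf: "subgaussian N s \<Longrightarrow> (\<integral>\<^sup>+x. ennreal (exp (l * x)) \<partial>N) \<le> ennreal (exp (l\<^sup>2 * s\<^sup>2 / 2))"
  unfolding subgaussian_def by (subst nn_integral_eq_integral) (auto intro: ennreal_leI)

lemma noise_mgf:
  assumes sg: "\<And>t. t < T \<Longrightarrow> subgaussian (N t) s" and S: "S \<subseteq> {..<T}"
  shows "(\<integral>\<^sup>+\<xi>. ennreal (exp (\<Sum>t\<in>S. c t * \<xi> t)) \<partial>noise_space T N) \<le> ennreal (exp ((\<Sum>t\<in>S. (c t)\<^sup>2) * s\<^sup>2 / 2))"
proof -
  let ?N = "\<lambda>t. if t < T then N t else coin"
  have ps: "prob_space (?N t)" for t using sg prob_space_coin by (auto simp: subgaussian_def)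
  interpret P: product_prob_space ?N UNIV
    using ps by (intro product_prob_spaceI)
  have bor: "sets (N t) = sets borel" if "t < T" for t using sg[OF that] by (simp add: subgaussian_def)
  let ?c = "\<lambda>t. if t \<in> S then c t else 0"
  have sumc: "(\<Sum>t\<in>S. f t) = (\<Sum>t<T. if t \<in> S then f t else 0)" for f :: "nat \<Rightarrow> real"
    using S by (simp add: sum.inter_restrict[symmetric] Int_absorb1)
  have "(\<integral>\<^sup>+\<xi>. ennreal (exp (\<Sum>t\<in>S. c t * \<xi> t)) \<partial>noise_space T N)
     = (\<integral>\<^sup>+\<xi>. (\<Prod>t<T. ennreal (exp (?c t * \<xi> t))) \<partial>PiM {..<T} ?N)"
  proof -
    have "noise_space T N = PiM {..<T} ?N" unfolding noise_space_def by (intro PiM_cong) auto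
    moreover have "ennreal (exp (\<Sum>t\<in>S. c t * \<xi> t)) = (\<Prod>t<T. ennreal (exp (?c t * \<xi> t)))" for \<xi>
      unfolding sumc by (simp add: prod_ennreal exp_sum[symmetric]) (intro arg_cong[of _ _ exp] sum.cong; simp)
    ultimately show ?thesis by simp
  qed
  also have "\<dots> = (\<Prod>t<T. \<integral>\<^sup>+x. ennreal (exp (?c t * x)) \<partial>?N t)"
  proof (rule P.product_nn_integral_prod)
    fix t assume "t \<in> {..<T}"
    then have "sets (?N t) = sets borel" using bor by simp
    then show "(\<lambda>x. ennreal (exp (?c t * x))) \<in> borel_measurable (?N t)"
      by (subst measurable_cong_sets[OF _ refl]) auto
  qed simp
  also have "\<dots> \<le> (\<Prod>t<T. ennreal (exp ((?c t)\<^sup>2 * s\<^sup>2 / 2)))"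
    using subgaussian_mgf[OF sg] by (intro prod_mono_ennreal) auto
  also have "\<dots> = ennreal (exp (\<Sum>t<T. (?c t)\<^sup>2 * s\<^sup>2 / 2))"
    by (simp add: prod_ennreal exp_sum)
  also have "(\<Sum>t<T. (?c t)\<^sup>2 * s\<^sup>2 / 2) = (\<Sum>t\<in>S. (c t)\<^sup>2) * s\<^sup>2 / 2"
    unfolding sumc sum_distrib_right sum_divide_distrib by (intro sum.cong) auto
  finally show ?thesis .
qed

lemma noise_measurable:
  assumes "\<And>t. t < T \<Longrightarrow> sets (N t) = sets borel" "t < T"
  shows "(\<lambda>\<xi>. \<xi> t) \<in> borel_measurable (noise_space T N)"
proof -
  have "(\<lambda>\<xi>. \<xi> t) \<in> measurable (noise_space T N) (N t)"
    unfolding noise_space_def using assms by (intro measurable_component_singleton) auto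
  then show ?thesis using assms measurable_cong_sets[OF refl, of "N t" borel "noise_space T N"] by simp
qed

lemma noise_tail_upper:
  assumes sg: "\<And>t. t < T \<Longrightarrow> subgaussian (N t) s" and S: "S \<subseteq> {..<T}" and s: "s > 0"
    and V: "(\<Sum>t\<in>S. (c t)\<^sup>2) \<le> V" "V > 0" and l: "l \<ge> 0"
  shows "emeasure (noise_space T N) {\<xi>\<in>space (noise_space T N). (\<Sum>t\<in>S. c t * \<xi> t) \<ge> s * sqrt (2 * V * l)} \<le> ennreal (exp (- l))"
proof -
  define r where "r = s * sqrt (2 * V * l)"
  \<comment> \<open>The minimiser of q^2 V s^2 / 2 - q r, at which this exponent equals -l.\<close>
  define q where "q = r / (s\<^sup>2 * V)"
  have r2: "r\<^sup>2 = s\<^sup>2 * (2 * V * l)" using V l by (simp add: r_def power_mult_distrib)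
  have q0: "q \<ge> 0" using V s l by (simp add: q_def r_def)
  have ex: "q * r - q\<^sup>2 * V * s\<^sup>2 / 2 = l"
  proof -
    have "q * r = r\<^sup>2 / (s\<^sup>2 * V)" by (simp add: q_def power2_eq_square)
    then have 1: "q * r = 2 * l" unfolding r2 using V s by simp
    have "q\<^sup>2 * V * s\<^sup>2 = q * r" using V s by (simp add: q_def power2_eq_square)
    then show ?thesis using 1 by simp
  qed
  let ?M = "noise_space T N"
  let ?F = "\<lambda>\<xi>. ennreal (exp (\<Sum>t\<in>S. (q * c t) * \<xi> t))"
  have m: "(\<lambda>\<xi>. \<Sum>t\<in>S. (q * c t) * \<xi> t) \<in> borel_measurable ?M"
    using S sg unfolding subgaussian_def by (intro borel_measurable_sum borel_measurable_times noise_measurable) auto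
  have "{\<xi>\<in>space ?M. (\<Sum>t\<in>S. c t * \<xi> t) \<ge> r} \<subseteq> {\<xi>\<in>space ?M. (\<Sum>t\<in>S. (q * c t) * \<xi> t) \<ge> q * r}"
    using mult_left_mono[OF _ q0, of r] by (auto simp: mult.assoc simp flip: sum_distrib_left)
  then have "emeasure ?M {\<xi>\<in>space ?M. (\<Sum>t\<in>S. c t * \<xi> t) \<ge> r}
     \<le> emeasure ?M {\<xi>\<in>space ?M. (\<Sum>t\<in>S. (q * c t) * \<xi> t) \<ge> q * r}"
    by (rule emeasure_mono[OF _ exp_Markov(1)[OF m]])
  also have "\<dots> \<le> ennreal (exp (- q * r)) * (\<integral>\<^sup>+\<xi>. ?F \<xi> \<partial>?M)"
    using exp_Markov(2)[OF m, of "q * r"] by simp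
  also have "ennreal (exp (- q * r)) * (\<integral>\<^sup>+\<xi>. ?F \<xi> \<partial>?M) \<le> ennreal (exp (- q * r)) * ennreal (exp (q\<^sup>2 * V * s\<^sup>2 / 2))"
  proof (intro mult_left_mono)
    have "(\<Sum>t\<in>S. (q * c t)\<^sup>2) * s\<^sup>2 / 2 \<le> q\<^sup>2 * V * s\<^sup>2 / 2"
      using V by (simp add: power_mult_distrib mult_right_mono mult_left_mono flip: sum_distrib_left)
    then show "(\<integral>\<^sup>+\<xi>. ?F \<xi> \<partial>?M) \<le> ennreal (exp (q\<^sup>2 * V * s\<^sup>2 / 2))"
      using noise_mgf[OF sg S, where c = "\<lambda>t. q * c t"] by (meson ennreal_leI exp_le_cancel_iff order_trans)
  qed simp
  also have "\<dots> = ennreal (exp (- l))"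
    using ex by (simp add: algebra_simps flip: ennreal_mult exp_add)
  finally show ?thesis by (simp add: r_def)
qed

lemma noise_tail:
  assumes sg: "\<And>t. t < T \<Longrightarrow> subgaussian (N t) s" and S: "S \<subseteq> {..<T}" and s: "s > 0"
    and V: "(\<Sum>t\<in>S. (c t)\<^sup>2) \<le> V" and l: "l \<ge> 0"
  shows "{\<xi>\<in>space (noise_space T N). \<bar>\<Sum>t\<in>S. c t * \<xi> t\<bar> > s * sqrt (2 * V * l)} \<in> sets (noise_space T N) \<and>
    emeasure (noise_space T N) {\<xi>\<in>space (noise_space T N). \<bar>\<Sum>t\<in>S. c t * \<xi> t\<bar> > s * sqrt (2 * V * l)} \<le> ennreal (2 * exp (- l))"
proof
  let ?M = "noise_space T N"
  have bor: "\<And>t. t < T \<Longrightarrow> sets (N t) = sets borel" using sg by (simp add: subgaussian_def)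
  have m: "(\<lambda>\<xi>. \<Sum>t\<in>S. c t * \<xi> t) \<in> borel_measurable ?M"
    using S bor by (intro borel_measurable_sum borel_measurable_times noise_measurable) auto
  show "{\<xi>\<in>space ?M. \<bar>\<Sum>t\<in>S. c t * \<xi> t\<bar> > s * sqrt (2 * V * l)} \<in> sets ?M"
    using m by measurable
  show "emeasure ?M {\<xi>\<in>space ?M. \<bar>\<Sum>t\<in>S. c t * \<xi> t\<bar> > s * sqrt (2 * V * l)} \<le> ennreal (2 * exp (- l))"
  proof (cases "V > 0")
    case True
    let ?A = "{\<xi>\<in>space ?M. (\<Sum>t\<in>S. c t * \<xi> t) \<ge> s * sqrt (2 * V * l)}"
    let ?B = "{\<xi>\<in>space ?M. (\<Sum>t\<in>S. - c t * \<xi> t) \<ge> s * sqrt (2 * V * l)}"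
    have mB: "(\<lambda>\<xi>. \<Sum>t\<in>S. - c t * \<xi> t) \<in> borel_measurable ?M"
      using S bor by (intro borel_measurable_sum borel_measurable_times noise_measurable) auto
    have AB: "?A \<in> sets ?M" "?B \<in> sets ?M" using m mB by measurable
    have "{\<xi>\<in>space ?M. \<bar>\<Sum>t\<in>S. c t * \<xi> t\<bar> > s * sqrt (2 * V * l)} \<subseteq> ?A \<union> ?B"
      by (auto simp: sum_negf)
    then have "emeasure ?M {\<xi>\<in>space ?M. \<bar>\<Sum>t\<in>S. c t * \<xi> t\<bar> > s * sqrt (2 * V * l)} \<le> emeasure ?M (?A \<union> ?B)"
      using AB by (intro emeasure_mono) auto
    also have "\<dots> \<le> emeasure ?M ?A + emeasure ?M ?B" using AB by (rule emeasure_subadditive)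
    also have "\<dots> \<le> ennreal (exp (- l)) + ennreal (exp (- l))"
      using V noise_tail_upper[OF sg S s V True l] noise_tail_upper[OF sg S s _ True l, where c = "\<lambda>t. - c t"]
      by (intro add_mono) auto
    also have "\<dots> = ennreal (2 * exp (- l))" by (simp flip: ennreal_plus)
    finally show ?thesis .
  next
    \<comment> \<open>All coefficients vanish, and the event is empty because its inequality is
      strict. This covers rounds of width zero, such as those with a zero context.\<close>
    case False
    have fin: "finite S" using S finite_subset by blast
    have "(\<Sum>t\<in>S. (c t)\<^sup>2) = 0" using False V sum_nonneg[of S "\<lambda>t. (c t)\<^sup>2"] by simp
    then have z: "\<forall>t\<in>S. c t = 0" using fin by (simp add: sum_nonneg_eq_0_iff)
    have V0: "V = 0" using False V sum_nonneg[of S "\<lambda>t. (c t)\<^sup>2"] by simp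
    have e: "{\<xi>\<in>space ?M. \<bar>\<Sum>t\<in>S. c t * \<xi> t\<bar> > s * sqrt (2 * V * l)} = {}" using z V0 by simp
    show ?thesis unfolding e by simp
  qed
qed

section \<open>Cost of QuFUR\<close>

locale qufur_env = design d T C xs for d T C xs +
  fixes m :: nat and du Tu :: "nat \<Rightarrow> nat" and I :: "nat \<Rightarrow> nat set" and \<theta> :: vect
    and N :: "nat \<Rightarrow> real measure" and eta c :: real
  assumes m: "m \<ge> 1" and T_def: "T = (\<Sum>u<m. Tu u)"
    and du: "\<And>u. u < m \<Longrightarrow> 0 < du u" "\<And>u. u < m \<Longrightarrow> du u \<le> Tu u"
    and eta: "1 \<le> eta"
    and c_lower: "\<And>u. u < m \<Longrightarrow> real (du u) / real (Tu u) \<le> c"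
    and c_upper: "\<And>u. u < m \<Longrightarrow> c \<le> (1 / eta\<^sup>2) * (real (Tu u) / real (du u))"
    and dom: "domain_structure d m du Tu I xs"
    and env: "lin_env d T eta \<theta> xs N"
    and theta: "vnorm d \<theta> \<le> C" and means: "\<And>t. t < T \<Longrightarrow> \<bar>ip d \<theta> (xs t)\<bar> \<le> 1"
begin

abbreviation Q :: "(nat \<Rightarrow> real) \<Rightarrow> nat \<Rightarrow> nat set" where
  "Q u t \<equiv> qufur_Q d eta C c xs u t"

definition width :: "nat \<Rightarrow> nat set \<Rightarrow> real" where
  "width t S = min 1 (kern S t t)"

definition qprob :: "nat \<Rightarrow> nat set \<Rightarrow> real" where
  "qprob t S = min 1 (c * (eta\<^sup>2 * width t S))"

lemma qDelta_width: "qDelta d eta C xs S t = eta\<^sup>2 * width t S"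
  using eta by (simp add: qDelta_def width_def kern_def max_def)

lemma Q_mem: "t < n \<Longrightarrow> t \<in> Q u n \<longleftrightarrow> u t < qprob t (Q u t)"
  by (simp only: qufur_Q_mem qprob_def qDelta_width)

lemma Q_sub: "t \<le> T \<Longrightarrow> Q u t \<subseteq> {..<T}"
  using qufur_Q_subset[of d eta C c xs u t] by auto

lemma c_pos: "c > 0"
proof -
  have "0 < real (du 0) / real (Tu 0)" using du[of 0] m by simp
  then show ?thesis using c_lower[of 0] m by linarith
qed

lemma width_bounds: "S \<subseteq> {..<T} \<Longrightarrow> t < T \<Longrightarrow> 0 \<le> width t S" "width t S \<le> 1"
  using kern_nonneg by (auto simp: width_def)

lemma qprob_bounds: "S \<subseteq> {..<T} \<Longrightarrow> t < T \<Longrightarrow> 0 \<le> qprob t S" "qprob t S \<le> 1"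
  using width_bounds c_pos by (auto simp: qprob_def)

lemma domain:
  assumes "v < m"
  shows "finite (I v)" "card (I v) = Tu v" "I v \<subseteq> {..<T}"
    "\<exists>B :: nat \<Rightarrow> vect. (\<forall>j<du v. in_dim d (B j)) \<and>
        (\<forall>t\<in>I v. \<exists>a :: nat \<Rightarrow> real. xs t = (\<lambda>i. \<Sum>j<du v. a j * B j i))"
  using dom assms unfolding domain_structure_def T_def by auto

lemma sum_domains: "(\<Sum>t<T. f t) = (\<Sum>v<m. \<Sum>t\<in>I v. f t)" for f :: "nat \<Rightarrow> real"
proof -
  have "{..<T} = (\<Union>v<m. I v)" using dom unfolding domain_structure_def T_def by simp
  moreover have "(\<Sum>t\<in>(\<Union>v<m. I v). f t) = (\<Sum>v<m. \<Sum>t\<in>I v. f t)"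
    using dom unfolding domain_structure_def by (intro sum.UNION_disjoint) auto
  ultimately show ?thesis by simp
qed

lemma m_le_T: "m \<le> T"
proof -
  have "(\<Sum>u<m. 1) \<le> (\<Sum>u<m. Tu u)" using du by (intro sum_mono) (metis Suc_leI lessThan_iff One_nat_def less_le_trans)
  then show ?thesis by (simp add: T_def)
qed

text \<open>The design seen by domain \<open>v\<close> contains the queries of every domain.
  Antitonicity of \<open>kern\<close> discards the foreign ones, and what remains is a potential in
  dimension \<open>du v\<close>.\<close>

lemma sum_width_queried:
  assumes v: "v < m"
  shows "(\<Sum>t\<in>I v. if t \<in> Q u T then width t (Q u t) else 0) \<le> 2 * real (du v) * ln (1 + C\<^sup>2 * real T)"
proof -
  define S where "S = Q u T \<inter> I v"
  have S: "S \<subseteq> {..<T}" using domain(3)[OF v] by (auto simp: S_def)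
  obtain B where B: "\<forall>j<du v. in_dim d (B j)"
    "\<forall>t\<in>I v. \<exists>a :: nat \<Rightarrow> real. xs t = (\<lambda>i. \<Sum>j<du v. a j * B j i)" using domain(4)[OF v] by auto
  have "(\<Sum>t\<in>I v. if t \<in> Q u T then width t (Q u t) else 0) = (\<Sum>t\<in>S. width t (Q u t))"
    using domain(1)[OF v] by (simp add: S_def sum.inter_restrict[symmetric] Int_commute)
  also have "\<dots> \<le> (\<Sum>t\<in>S. min 1 (kern (S \<inter> {..<t}) t t))"
  proof (intro sum_mono)
    fix t assume t: "t \<in> S"
    then have tT: "t < T" using S by auto
    have "S \<inter> {..<t} \<subseteq> Q u T \<inter> {..<t}" by (auto simp: S_def)
    then have "S \<inter> {..<t} \<subseteq> Q u t" using qufur_Q_Int[of t T] tT by auto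
    then have "kern (Q u t) t t \<le> kern (S \<inter> {..<t}) t t"
      using tT Q_sub[of t] by (intro kern_antimono) auto
    then show "width t (Q u t) \<le> min 1 (kern (S \<inter> {..<t}) t t)" by (auto simp: width_def)
  qed
  also have "\<dots> \<le> 2 * real (du v) * ln (1 + C\<^sup>2 * real (card S))"
    using env S B by (intro elliptical_potential[of S "du v" B]) (auto simp: lin_env_def S_def)
  also have "\<dots> \<le> 2 * real (du v) * ln (1 + C\<^sup>2 * real T)"
  proof -
    have "card S \<le> T" using card_mono[OF _ S] by simp
    then have "1 + C\<^sup>2 * real (card S) \<le> 1 + C\<^sup>2 * real T" by (simp add: mult_left_mono)
    moreover have "0 < 1 + C\<^sup>2 * real (card S)" by (simp add: add_pos_nonneg)
    ultimately show ?thesis by (intro mult_left_mono ln_mono) auto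
  qed
  finally show ?thesis .
qed

text \<open>Pointwise AM-GM with weight \<open>y\<close>: rounds queried with probability below 1 satisfy
  \<open>p a = c \<eta>\<^sup>2 a\<^sup>2\<close>, which trades the width \<open>a\<close> against the number of rounds.\<close>
lemma width_le:
  assumes "S \<subseteq> {..<T}" "t < T" "y > 0"
  shows "width t S \<le> (1 + y) * (qprob t S * width t S) + 1 / (4 * c * y)"
proof (cases "c * (eta\<^sup>2 * width t S) \<ge> 1")
  case True
  then have "qprob t S = 1" by (simp add: qprob_def)
  then show ?thesis using width_bounds(1)[OF assms(1,2)] assms(3) c_pos by (simp add: algebra_simps)
next
  case False
  define w where "w = width t S"
  have w: "w \<ge> 0" using width_bounds(1)[OF assms(1,2)] by (simp add: w_def)
  have q: "qprob t S = c * (eta\<^sup>2 * w)" using False by (simp add: qprob_def w_def)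
  have "1 \<le> eta\<^sup>2" using eta by simp
  then have e: "c * w * w \<le> qprob t S * w"
    unfolding q using c_pos w mult_right_mono[of 1 "eta\<^sup>2" "c * w * w"] by (simp add: mult_ac)
  have "0 \<le> (2 * c * y * w - 1)\<^sup>2" by simp
  then have "4 * c * y * w \<le> 4 * c * y * (y * (c * w * w)) + 1" by (simp add: power2_eq_square algebra_simps)
  then have "w \<le> y * (c * w * w) + 1 / (4 * c * y)" using c_pos assms(3) by (simp add: field_simps)
  also have "\<dots> \<le> y * (qprob t S * w) + 1 / (4 * c * y)" using e assms(3) by simp
  also have "\<dots> \<le> (1 + y) * (qprob t S * w) + 1 / (4 * c * y)"
    using qprob_bounds(1)[OF assms(1,2)] w by (simp add: algebra_simps)
  finally show ?thesis by (simp add: w_def)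
qed

lemma sum_width_domain:
  assumes v: "v < m" and L: "L \<ge> 1" and pot: "ln (1 + C\<^sup>2 * real T) \<le> 3 * L"
    and good: "(\<Sum>t\<in>I v. qprob t (Q u t) * width t (Q u t) / 2
          - (if t \<in> Q u T then width t (Q u t) else 0)) \<le> 4 * L"
  shows "c * (\<Sum>t\<in>I v. width t (Q u t)) \<le> 41 * L * sqrt (c * (real (Tu v) * real (du v)))"
proof -
  define D where "D = real (du v)" define n where "n = real (Tu v)"
  have D: "D \<ge> 1" and n: "n > 0" using du[OF v] by (auto simp: D_def n_def)
  have sub: "t < T" "Q u t \<subseteq> {..<T}" if "t \<in> I v" for t
    using that domain(3)[OF v] Q_sub[of t u] by fastforce+
  have "(\<Sum>t\<in>I v. qprob t (Q u t) * width t (Q u t)) / 2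
     \<le> 4 * L + (\<Sum>t\<in>I v. if t \<in> Q u T then width t (Q u t) else 0)"
    using good by (simp add: sum_subtractf sum_divide_distrib)
  also have "\<dots> \<le> 4 * L + 2 * D * (3 * L)"
  proof -
    have "2 * D * ln (1 + C\<^sup>2 * real T) \<le> 2 * D * (3 * L)" using pot D by (intro mult_left_mono) auto
    then show ?thesis using sum_width_queried[OF v, of u] unfolding D_def by linarith
  qed
  also have "\<dots> \<le> 4 * (D * L) + 6 * (D * L)" using mult_right_mono[of 1 D L] D L by simp
  finally have P: "(\<Sum>t\<in>I v. qprob t (Q u t) * width t (Q u t)) \<le> 20 * (D * L)" by simp
  \<comment> \<open>Balances y d_u against T_u / (c y): both become sqrt (T_u d_u / c). The upper
    bound on \<open>c\<close> gives y \<ge> 1 and so 1 + y \<le> 2 y.\<close>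
  define y where "y = sqrt (n / (c * D))"
  have "c \<le> n / D"
  proof -
    have "1 / eta\<^sup>2 \<le> 1" using eta by (simp add: divide_simps)
    then have "(1 / eta\<^sup>2) * (n / D) \<le> 1 * (n / D)" using n D by (intro mult_right_mono) auto
    then show ?thesis using c_upper[OF v] by (simp add: n_def D_def)
  qed
  then have y1: "y \<ge> 1" using c_pos D unfolding y_def by (simp add: field_simps)
  have cnD: "c * D * y = sqrt (c * (n * D))"
  proof -
    have "c * D * y = sqrt ((c * D)\<^sup>2) * sqrt (n / (c * D))" using c_pos D by (simp add: y_def)
    also have "\<dots> = sqrt ((c * D)\<^sup>2 * (n / (c * D)))" by (simp only: real_sqrt_mult)
    also have "(c * D)\<^sup>2 * (n / (c * D)) = c * (n * D)" using c_pos D by (simp add: power2_eq_square)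
    finally show ?thesis .
  qed
  have ny: "n / y = sqrt (c * (n * D))"
  proof -
    have "y\<^sup>2 = n / (c * D)" using c_pos D n by (simp add: y_def)
    then have "n = c * D * y * y" using c_pos D by (simp add: power2_eq_square field_simps)
    then show ?thesis using cnD y1 by (metis nonzero_mult_div_cancel_right not_one_le_zero)
  qed
  have "(\<Sum>t\<in>I v. width t (Q u t)) \<le> (\<Sum>t\<in>I v. (1 + y) * (qprob t (Q u t) * width t (Q u t)) + 1 / (4 * c * y))"
    using sub y1 by (intro sum_mono width_le) auto
  also have "\<dots> = (1 + y) * (\<Sum>t\<in>I v. qprob t (Q u t) * width t (Q u t)) + n / (4 * c * y)"
    using domain(2)[OF v] by (simp add: sum.distrib sum_distrib_left n_def)
  also have "\<dots> \<le> (2 * y) * (20 * (D * L)) + n / (4 * c * y)"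
  proof -
    have "0 \<le> (\<Sum>t\<in>I v. qprob t (Q u t) * width t (Q u t))"
      using sub by (intro sum_nonneg mult_nonneg_nonneg qprob_bounds width_bounds) auto
    then show ?thesis using P y1 by (intro add_right_mono mult_mono) auto
  qed
  finally have "c * (\<Sum>t\<in>I v. width t (Q u t)) \<le> c * ((2 * y) * (20 * (D * L)) + n / (4 * c * y))"
    using c_pos by simp
  also have "\<dots> = 40 * L * (c * D * y) + (n / y) / 4" using c_pos by (simp add: algebra_simps)
  also have "\<dots> = (40 * L + 1 / 4) * sqrt (c * (n * D))" unfolding cnD ny by (simp add: algebra_simps)
  also have "\<dots> \<le> 41 * L * sqrt (c * (n * D))"
    using L c_pos n D by (intro mult_right_mono) auto
  finally show ?thesis by (simp add: n_def D_def)
qed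

text \<open>Clipping to [-1, 1] does not move the prediction away from the mean, and it keeps the
  error at most 2. The latter covers rounds with \<open>kern\<close> above 1, which is how
  \<open>min 1\<close> arises; the 4 is the square of this 2.\<close>

lemma regret_step:
  assumes t: "t < T" and b: "b \<ge> 0"
    and good: "\<bar>\<Sum>s\<in>Q u t. kern (Q u t) s t * \<xi> s\<bar> \<le> eta * sqrt (2 * kern (Q u t) t t * b)"
  shows "(qpred d C xs (labels d \<theta> xs \<xi>) (Q u t) t - ip d \<theta> (xs t))\<^sup>2
    \<le> 4 * (1 + eta * sqrt (2 * b))\<^sup>2 * width t (Q u t)"
proof -
  define k where "k = kern (Q u t) t t"
  define e where "e = ip d (qtheta d C xs (labels d \<theta> xs \<xi>) (Q u t)) (xs t)"
  define p where "p = qpred d C xs (labels d \<theta> xs \<xi>) (Q u t) t"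
  define \<mu> where "\<mu> = ip d \<theta> (xs t)"
  define B where "B = 1 + eta * sqrt (2 * b)"
  have B: "B \<ge> 1" using eta b by (simp add: B_def)
  have k: "k \<ge> 0" unfolding k_def using t Q_sub[of t u] by (intro kern_nonneg) auto
  have "\<bar>e - \<mu>\<bar> \<le> sqrt k + eta * sqrt (2 * k * b)"
    using qtheta_error[OF Q_sub t theta, of t \<xi> u] good t by (simp add: e_def \<mu>_def k_def)
  also have "\<dots> = B * sqrt k" by (simp add: B_def real_sqrt_mult algebra_simps)
  finally have 1: "\<bar>e - \<mu>\<bar> \<le> B * sqrt k" .
  have mu: "\<bar>\<mu>\<bar> \<le> 1" using means[OF t] by (simp add: \<mu>_def)
  have p: "p = min 1 (max (-1) e)" by (simp add: p_def qpred_def e_def)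
  have 2: "\<bar>p - \<mu>\<bar> \<le> \<bar>e - \<mu>\<bar>" "\<bar>p - \<mu>\<bar> \<le> 2" using mu unfolding p by (auto simp: min_def max_def)
  have B2: "1 \<le> B\<^sup>2" using B by simp
  have "(p - \<mu>)\<^sup>2 \<le> 4 * B\<^sup>2 * min 1 k"
  proof (cases "k \<le> 1")
    case True
    have "(p - \<mu>)\<^sup>2 \<le> (B * sqrt k)\<^sup>2" using 1 2 by (metis abs_ge_zero order_trans power2_abs power_mono)
    also have "\<dots> = B\<^sup>2 * k" using k by (simp add: power_mult_distrib)
    also have "\<dots> \<le> 4 * B\<^sup>2 * k" using k by (simp add: mult_right_mono)
    finally show ?thesis using True by simp
  next
    case False
    have "(p - \<mu>)\<^sup>2 \<le> 2\<^sup>2" using 2 by (metis abs_ge_zero power2_abs power_mono)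
    also have "\<dots> \<le> 4 * B\<^sup>2" using B2 by simp
    finally show ?thesis using False by simp
  qed
  then show ?thesis by (simp add: p_def \<mu>_def B_def width_def k_def)
qed

lemma card_Q: "real (card (Q u T)) = (\<Sum>t<T. if t \<in> Q u T then 1 else 0)"
proof -
  have "Q u T \<subseteq> {..<T}" by (rule Q_sub) simp
  then show ?thesis by (simp add: sum.inter_restrict[symmetric] Int_absorb1)
qed

text \<open>No randomness is left: the three \<open>good\<close> assumptions exclude the bad events
  for the queried widths, the number of queries and the noise. The regret contributes 72 * 41 = 2952
  and the queries 2 * 41 + 4 = 86, together below 3100.\<close>

lemma cost_bound:
  assumes L: "L \<ge> 1" and pot: "ln (1 + C\<^sup>2 * real T) \<le> 3 * L" and b: "0 \<le> b" "b \<le> 4 * L"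
    and E: "eta \<le> eta0"
    and good1: "\<And>v. v < m \<Longrightarrow> (\<Sum>t\<in>I v. qprob t (Q u t) * width t (Q u t) / 2
          - (if t \<in> Q u T then width t (Q u t) else 0)) \<le> 4 * L"
    and good2: "(\<Sum>t<T. (if t \<in> Q u T then 1 else 0) - 2 * qprob t (Q u t)) \<le> 4 * L"
    and good3: "\<And>t. t < T \<Longrightarrow> \<bar>\<Sum>s\<in>Q u t. kern (Q u t) s t * \<xi> s\<bar> \<le> eta * sqrt (2 * kern (Q u t) t t * b)"
  shows "qufur_cost d T eta C c c \<theta> xs (u, \<xi>)
    \<le> 3100 * eta0\<^sup>2 * L\<^sup>2 * sqrt c * (\<Sum>v<m. sqrt (real (Tu v) * real (du v)))"
proof -
  define Z where "Z = sqrt c * (\<Sum>v<m. sqrt (real (Tu v) * real (du v)))"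
  define A where "A = (\<Sum>t<T. width t (Q u t))"
  have sub: "Q u t \<subseteq> {..<T}" if "t < T" for t using that by (intro Q_sub) simp
  have A0: "A \<ge> 0" unfolding A_def using sub by (intro sum_nonneg width_bounds) auto
  have Zs: "Z = (\<Sum>v<m. sqrt (c * (real (Tu v) * real (du v))))"
    by (simp add: Z_def sum_distrib_left real_sqrt_mult)
  have "c * A = (\<Sum>v<m. c * (\<Sum>t\<in>I v. width t (Q u t)))"
    unfolding A_def sum_domains by (simp add: sum_distrib_left)
  also have "\<dots> \<le> (\<Sum>v<m. 41 * L * sqrt (c * (real (Tu v) * real (du v))))"
    using sum_width_domain[OF _ L pot good1] by (intro sum_mono) auto
  also have "\<dots> = 41 * L * Z" by (simp add: Zs sum_distrib_left)
  finally have cA: "c * A \<le> 41 * L * Z" .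
  \<comment> \<open>The lower bound on \<open>c\<close> makes c T_0 d_0 at least d_0^2 \<ge> 1. Thus
    the additive 4 L in the number of queries is absorbed by the main term.\<close>
  have Z1: "Z \<ge> 1"
  proof -
    have "1 \<le> c * (real (Tu 0) * real (du 0))"
    proof -
      have p: "real (du 0) \<ge> 1" "real (Tu 0) > 0" using du[of 0] m by auto
      then have "real (du 0) \<le> c * real (Tu 0)" using c_lower[of 0] m by (simp add: divide_le_eq)
      then have "1 * 1 \<le> (c * real (Tu 0)) * real (du 0)" using p by (intro mult_mono) auto
      then show ?thesis by (simp add: mult.assoc)
    qed
    then have "1 \<le> sqrt (c * (real (Tu 0) * real (du 0)))" by simp
    also have "\<dots> \<le> Z" unfolding Zs
      using m c_pos by (intro member_le_sum) auto
    finally show ?thesis .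
  qed
  have e2: "1 \<le> eta\<^sup>2" "eta\<^sup>2 \<le> eta0\<^sup>2" "1 \<le> eta0\<^sup>2" using eta E by (auto intro: power_mono)
  have "(\<Sum>t<T. (qpred d C xs (labels d \<theta> xs \<xi>) (Q u t) t - ip d \<theta> (xs t))\<^sup>2)
     \<le> (\<Sum>t<T. 4 * (1 + eta * sqrt (2 * b))\<^sup>2 * width t (Q u t))"
    using good3 b by (intro sum_mono regret_step) auto
  also have "\<dots> = 4 * (1 + eta * sqrt (2 * b))\<^sup>2 * A" by (simp add: A_def sum_distrib_left)
  also have "\<dots> \<le> 72 * eta0\<^sup>2 * L * A"
  proof (intro mult_right_mono[OF _ A0])
    have "(1 + eta * sqrt (2 * b))\<^sup>2 \<le> 2 * 1 + 2 * (eta * sqrt (2 * b))\<^sup>2"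
      using zero_le_power2[of "1 - eta * sqrt (2 * b)"] by (simp add: power2_eq_square algebra_simps)
    also have "(eta * sqrt (2 * b))\<^sup>2 = eta\<^sup>2 * (2 * b)" using b by (simp add: power_mult_distrib)
    also have "eta\<^sup>2 * (2 * b) \<le> eta0\<^sup>2 * (2 * (4 * L))" using e2 b by (intro mult_mono) auto
    finally have "(1 + eta * sqrt (2 * b))\<^sup>2 \<le> 2 + 16 * (eta0\<^sup>2 * L)" by simp
    moreover have "1 * 1 \<le> eta0\<^sup>2 * L" using e2 L by (intro mult_mono) auto
    ultimately have "4 * (1 + eta * sqrt (2 * b))\<^sup>2 \<le> 72 * (eta0\<^sup>2 * L)" by linarith
    then show "4 * (1 + eta * sqrt (2 * b))\<^sup>2 \<le> 72 * eta0\<^sup>2 * L" by (simp only: mult.assoc)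
  qed
  finally have "c * (\<Sum>t<T. (qpred d C xs (labels d \<theta> xs \<xi>) (Q u t) t - ip d \<theta> (xs t))\<^sup>2)
     \<le> c * (72 * eta0\<^sup>2 * L * A)" using c_pos by simp
  also have "\<dots> = 72 * eta0\<^sup>2 * L * (c * A)" by simp
  also have "\<dots> \<le> 72 * eta0\<^sup>2 * L * (41 * L * Z)" using cA L by (intro mult_left_mono) auto
  finally have R: "c * (\<Sum>t<T. (qpred d C xs (labels d \<theta> xs \<xi>) (Q u t) t - ip d \<theta> (xs t))\<^sup>2)
     \<le> 2952 * (eta0\<^sup>2 * L\<^sup>2 * Z)" by (simp add: power2_eq_square)
  have "real (card (Q u T)) \<le> 2 * (\<Sum>t<T. qprob t (Q u t)) + 4 * L"
    using good2 unfolding card_Q by (simp add: sum_subtractf sum_distrib_left)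
  also have "(\<Sum>t<T. qprob t (Q u t)) \<le> (\<Sum>t<T. c * (eta\<^sup>2 * width t (Q u t)))"
    by (intro sum_mono) (simp add: qprob_def)
  also have "\<dots> = eta\<^sup>2 * (c * A)" by (simp add: A_def sum_distrib_left mult_ac)
  also have "\<dots> \<le> eta0\<^sup>2 * (41 * L * Z)"
    using mult_mono[OF e2(2) cA] c_pos A0 by simp
  finally have "real (card (Q u T)) \<le> 82 * (eta0\<^sup>2 * L * Z) + 4 * L" by simp
  also have "\<dots> \<le> 82 * (eta0\<^sup>2 * L\<^sup>2 * Z) + 4 * (eta0\<^sup>2 * L\<^sup>2 * Z)"
  proof -
    have LL: "L \<le> L\<^sup>2" using L by (simp add: power2_eq_square)
    then have "eta0\<^sup>2 * L * Z \<le> eta0\<^sup>2 * L\<^sup>2 * Z" using Z1 by (intro mult_right_mono mult_left_mono) auto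
    moreover have "1 * L * 1 \<le> eta0\<^sup>2 * L\<^sup>2 * Z" using LL e2 Z1 L by (intro mult_mono) auto
    ultimately show ?thesis by linarith
  qed
  finally have C1: "real (card (Q u T)) \<le> 86 * (eta0\<^sup>2 * L\<^sup>2 * Z)" by linarith
  have "0 \<le> eta0\<^sup>2 * L\<^sup>2 * Z" using Z1 by simp
  then have "qufur_cost d T eta C c c \<theta> xs (u, \<xi>) \<le> 3100 * (eta0\<^sup>2 * L\<^sup>2 * Z)"
    using R C1 unfolding qufur_cost_def Let_def fst_conv snd_conv by linarith
  then show ?thesis by (simp add: Z_def mult.assoc)
qed

lemma noise_borel: "t < T \<Longrightarrow> sets (N t) = sets borel"
  using env by (simp add: lin_env_def subgaussian_def)

text \<open>The query set takes finitely many values, and for a fixed set the unclipped prediction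
  is affine in the noise.\<close>

lemma measurable_cost: "qufur_cost d T eta C c c \<theta> xs \<in> borel_measurable (coin_space T \<Otimes>\<^sub>M noise_space T N)"
proof -
  let ?M = "coin_space T \<Otimes>\<^sub>M noise_space T N"
  have Qm: "(\<lambda>\<omega>. Q (fst \<omega>) t) \<in> measurable ?M (count_space (Pow {..<t}))" if "t \<le> T" for t
    using measurable_compose[OF measurable_fst measurable_qufur_Q[OF that]] .
  have sndm: "(\<lambda>\<omega>. snd \<omega> s) \<in> borel_measurable ?M" if "s < T" for s
    using measurable_compose[OF measurable_snd noise_measurable[OF noise_borel that]] .
  have "(\<lambda>\<omega>. qpred d C xs (labels d \<theta> xs (snd \<omega>)) (Q (fst \<omega>) t) t) \<in> borel_measurable ?M" if t: "t < T" for t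
  proof (rule measurable_compose_countable'[of "Pow {..<t}" "\<lambda>S \<omega>. qpred d C xs (labels d \<theta> xs (snd \<omega>)) S t"])
    show "countable (Pow {..<t})" by (simp add: countable_finite)
    show "(\<lambda>\<omega>. Q (fst \<omega>) t) \<in> measurable ?M (count_space (Pow {..<t}))" using t by (intro Qm) simp
    fix S assume "S \<in> Pow {..<t}"
    then have S: "S \<subseteq> {..<T}" using t by auto
    have "(\<lambda>\<omega>. \<Sum>s\<in>S. (ip d \<theta> (xs s) + snd \<omega> s) * kern S s t) \<in> borel_measurable ?M"
      using S sndm by (intro borel_measurable_sum borel_measurable_times borel_measurable_add) auto
    then show "(\<lambda>\<omega>. qpred d C xs (labels d \<theta> xs (snd \<omega>)) S t) \<in> borel_measurable ?M"
      unfolding qpred_def ip_qtheta[OF S t] labels_def by simp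
  qed
  then have 1: "(\<lambda>\<omega>. \<Sum>t<T. (qpred d C xs (labels d \<theta> xs (snd \<omega>)) (Q (fst \<omega>) t) t - ip d \<theta> (xs t))\<^sup>2) \<in> borel_measurable ?M"
    by (intro borel_measurable_sum borel_measurable_power borel_measurable_diff) auto
  have "(\<lambda>\<omega>. real (card (Q (fst \<omega>) T))) \<in> borel_measurable ?M"
    using measurable_compose[OF Qm[of T], of "\<lambda>S. real (card S)" borel] by simp
  then show ?thesis unfolding qufur_cost_def Let_def using 1 by simp
qed

text \<open>Failure budget: \<delta>/(3 m) for each of the \<open>m\<close> domains and \<delta>/3
  for the number of queries. The last third of \<delta> is kept for the noise.\<close>

lemma coins_good:
  assumes \<delta>: "0 < \<delta>"
  obtains G where "G \<in> sets (coin_space T)" "emeasure (coin_space T) (space (coin_space T) - G) \<le> ennreal (2 * \<delta> / 3)"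
    and "\<forall>u\<in>G. \<forall>v<m. (\<Sum>t\<in>I v. qprob t (Q u t) * width t (Q u t) / 2
          - (if t \<in> Q u T then width t (Q u t) else 0)) \<le> ln (3 * real m / \<delta>)"
    and "\<forall>u\<in>G. (\<Sum>t<T. (if t \<in> Q u T then 1 else 0) - 2 * qprob t (Q u t)) \<le> ln (3 / \<delta>)"
proof -
  let ?M = "coin_space T"
  define Y where "Y v t S x = (if t \<in> I v then if x < qprob t S then qprob t S * width t S / 2 - width t S
      else qprob t S * width t S / 2 else 0)" for v t S and x :: real
  define Y' where "Y' t S x = (if x < qprob t S then 1 - 2 * qprob t S else - 2 * qprob t S)" for t S and x :: real
  define X where "X v u = (\<Sum>t<T. Y v t (Q u t) (u t))" for v u
  define X' where "X' u = (\<Sum>t<T. Y' t (Q u t) (u t))" for u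
  define A where "A v = {u \<in> space ?M. X v u \<ge> ln (3 * real m / \<delta>)}" for v
  define A' where "A' = {u \<in> space ?M. X' u \<ge> ln (3 / \<delta>)}"
  have mp: "real m > 0" using m by simp
  have A: "A v \<in> sets ?M" "emeasure ?M (A v) \<le> ennreal (\<delta> / (3 * m))" for v
  proof -
    have le: "(\<integral>\<^sup>+x. ennreal (exp (Y v t S x)) \<partial>coin) \<le> 1" if "S \<subseteq> {..<t}" "t < T" for t S
    proof -
      interpret coin: prob_space coin by (rule prob_space_coin)
      have "S \<subseteq> {..<T}" using that by auto
      then show ?thesis
        using coin_exp_lower[of "qprob t S" "width t S"] qprob_bounds width_bounds that coin.emeasure_space_1
        by (cases "t \<in> I v") (auto simp: Y_def)
    qed
    have meas: "Y v t S \<in> borel_measurable borel" for t S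
      unfolding Y_def by (cases "t \<in> I v") auto
    have "exp (- ln (3 * real m / \<delta>)) = \<delta> / (3 * m)" using mp \<delta> by (simp add: exp_minus)
    note e = this
    show "A v \<in> sets ?M" "emeasure ?M (A v) \<le> ennreal (\<delta> / (3 * m))"
      using coin_tail[where Y = "Y v" and n = T and d = d and eta = eta and C = C and alpha = c and xs = xs
          and l = "ln (3 * real m / \<delta>)", OF meas le]
      unfolding A_def X_def e by blast+
  qed
  have A': "A' \<in> sets ?M" "emeasure ?M A' \<le> ennreal (\<delta> / 3)"
  proof -
    have le: "(\<integral>\<^sup>+x. ennreal (exp (Y' t S x)) \<partial>coin) \<le> 1" if "S \<subseteq> {..<t}" "t < T" for t S
    proof -
      have "S \<subseteq> {..<T}" using that by auto
      then show ?thesis using coin_exp_upper[of "qprob t S"] qprob_bounds that by (auto simp: Y'_def)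
    qed
    have meas: "Y' t S \<in> borel_measurable borel" for t S
      unfolding Y'_def by auto
    have "exp (- ln (3 / \<delta>)) = \<delta> / 3" using \<delta> by (simp add: exp_minus)
    note e = this
    show "A' \<in> sets ?M" "emeasure ?M A' \<le> ennreal (\<delta> / 3)"
      using coin_tail[where Y = Y' and n = T and d = d and eta = eta and C = C and alpha = c and xs = xs
          and l = "ln (3 / \<delta>)", OF meas le]
      unfolding A'_def X'_def e by blast+
  qed
  define G where "G = space ?M - ((\<Union>v<m. A v) \<union> A')"
  have G: "G \<in> sets ?M" using A A' by (auto simp: G_def)
  have sp: "space ?M - G = (\<Union>v<m. A v) \<union> A'" by (auto simp: G_def A_def A'_def)
  have "emeasure ?M (space ?M - G) \<le> emeasure ?M (\<Union>v<m. A v) + emeasure ?M A'"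
    unfolding sp using A A' by (intro emeasure_subadditive) auto
  also have "\<dots> \<le> (\<Sum>v<m. emeasure ?M (A v)) + emeasure ?M A'"
    using A by (intro add_right_mono emeasure_subadditive_finite) auto
  also have "\<dots> \<le> (\<Sum>v<m. ennreal (\<delta> / (3 * m))) + ennreal (\<delta> / 3)"
    using A A' by (intro add_mono sum_mono) auto
  also have "\<dots> = ennreal (m * (\<delta> / (3 * m)) + \<delta> / 3)"
    using \<delta> by (subst sum_ennreal) (auto simp flip: ennreal_plus)
  also have "m * (\<delta> / (3 * m)) + \<delta> / 3 = 2 * \<delta> / 3" using mp by simp
  finally have 1: "emeasure ?M (space ?M - G) \<le> ennreal (2 * \<delta> / 3)" .
  have 2: "(\<Sum>t\<in>I v. qprob t (Q u t) * width t (Q u t) / 2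
          - (if t \<in> Q u T then width t (Q u t) else 0)) \<le> ln (3 * real m / \<delta>)" if "u \<in> G" "v < m" for u v
  proof -
    have "X v u = (\<Sum>t\<in>{..<T} \<inter> I v. qprob t (Q u t) * width t (Q u t) / 2 - (if t \<in> Q u T then width t (Q u t) else 0))"
      unfolding X_def by (subst sum.inter_restrict) (auto simp: Y_def Q_mem intro!: sum.cong)
    also have "{..<T} \<inter> I v = I v" using domain(3)[OF that(2)] by auto
    finally have e: "X v u = (\<Sum>t\<in>I v. qprob t (Q u t) * width t (Q u t) / 2 - (if t \<in> Q u T then width t (Q u t) else 0))" .
    have "u \<notin> A v" "u \<in> space ?M" using that by (auto simp: G_def)
    then have "X v u < ln (3 * real m / \<delta>)" by (auto simp: A_def)
    then show ?thesis unfolding e by simp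
  qed
  have 3: "(\<Sum>t<T. (if t \<in> Q u T then 1 else 0) - 2 * qprob t (Q u t)) \<le> ln (3 / \<delta>)" if "u \<in> G" for u
  proof -
    have e: "X' u = (\<Sum>t<T. (if t \<in> Q u T then 1 else 0) - 2 * qprob t (Q u t))"
      unfolding X'_def by (auto simp: Y'_def Q_mem intro!: sum.cong)
    have "X' u < ln (3 / \<delta>)" using that by (auto simp: G_def A'_def)
    then show ?thesis unfolding e by simp
  qed
  show ?thesis using that[OF G 1] 2 3 by blast
qed

text \<open>With the coins fixed the designs are deterministic, and a union bound over the rounds
  suffices, each with failure probability 2 exp (-l) = \<delta>/(3 T). The bad set \<open>B\<close>
  may depend on the coins.\<close>

lemma noise_good:
  assumes \<delta>: "0 < \<delta>" "\<delta> < 1"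
  obtains B where "B \<in> sets (noise_space T N)" "emeasure (noise_space T N) B \<le> ennreal (\<delta> / 3)"
    and "\<forall>\<xi>\<in>space (noise_space T N) - B. \<forall>t<T.
      \<bar>\<Sum>s\<in>Q u t. kern (Q u t) s t * \<xi> s\<bar> \<le> eta * sqrt (2 * kern (Q u t) t t * ln (6 * real T / \<delta>))"
proof -
  let ?M = "noise_space T N"
  have Tp: "real T \<ge> 1" using m m_le_T by simp
  define l where "l = ln (6 * real T / \<delta>)"
  have l: "l \<ge> 0" unfolding l_def using \<delta> Tp by (intro ln_ge_zero) (simp add: field_simps)
  define A where "A t = {\<xi>\<in>space ?M. \<bar>\<Sum>s\<in>Q u t. kern (Q u t) s t * \<xi> s\<bar> > eta * sqrt (2 * kern (Q u t) t t * l)}" for t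
  have A: "A t \<in> sets ?M \<and> emeasure ?M (A t) \<le> ennreal (2 * exp (- l))" if "t < T" for t
    unfolding A_def
  proof (rule noise_tail[OF _ _ _ _ l])
    show "\<And>t. t < T \<Longrightarrow> subgaussian (N t) eta" using env by (simp add: lin_env_def)
    show "Q u t \<subseteq> {..<T}" using that by (intro Q_sub) simp
    show "0 < eta" using eta by simp
    show "(\<Sum>s\<in>Q u t. (kern (Q u t) s t)\<^sup>2) \<le> kern (Q u t) t t"
      using that by (intro sum_kern_sq_le Q_sub) auto
  qed
  have ex: "2 * exp (- l) = \<delta> / (3 * T)" using \<delta> Tp by (simp add: l_def exp_minus)
  define B where "B = (\<Union>t<T. A t)"
  have B: "B \<in> sets ?M" using A by (auto simp: B_def)
  have "emeasure ?M B \<le> (\<Sum>t<T. emeasure ?M (A t))"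
    unfolding B_def using A by (intro emeasure_subadditive_finite) auto
  also have "\<dots> \<le> (\<Sum>t<T. ennreal (\<delta> / (3 * T)))" using A unfolding ex by (intro sum_mono) auto
  also have "\<dots> = ennreal (T * (\<delta> / (3 * T)))" using \<delta> by (subst sum_ennreal) auto
  also have "T * (\<delta> / (3 * T)) = \<delta> / 3" using Tp by simp
  finally have "emeasure ?M B \<le> ennreal (\<delta> / 3)" .
  moreover have "\<bar>\<Sum>s\<in>Q u t. kern (Q u t) s t * \<xi> s\<bar> \<le> eta * sqrt (2 * kern (Q u t) t t * l)"
    if "\<xi> \<in> space ?M - B" "t < T" for \<xi> t
    using that by (auto simp: B_def A_def not_less)
  ultimately show ?thesis using that[OF B] unfolding l_def by blast
qed

text \<open>Everything is compared with X = 2 + T + 1/\<delta> + C \<ge> 4: the determinant term 1 +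
  C^2 T is at most X^3, and numerical constants up to 16 are paid for by X^2.\<close>

lemma log_bounds:
  assumes \<delta>: "0 < \<delta>" "\<delta> < 1" and L_def: "L = ln (2 + real T + 1 / \<delta> + C)"
  shows "L \<ge> 1" "ln (1 + C\<^sup>2 * real T) \<le> 3 * L" "0 \<le> ln (6 * real T / \<delta>)" "ln (6 * real T / \<delta>) \<le> 4 * L"
    "ln (3 * real m / \<delta>) \<le> 4 * L" "ln (3 / \<delta>) \<le> 4 * L"
proof -
  define X where "X = 2 + real T + 1 / \<delta> + C"
  have Tp: "real T \<ge> 1" and mT: "real m \<le> real T" "real m \<ge> 1" using m m_le_T by auto
  have d1: "1 / \<delta> > 1" using \<delta> by simp
  have X: "X \<ge> 4" "C \<le> X" "real T \<le> X - 1" "1 / \<delta> \<le> X" using Tp d1 C_pos by (auto simp: X_def)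
  have LX: "L = ln X" by (simp add: L_def X_def)
  have "exp 1 \<le> X" using X exp_le by linarith
  then show "L \<ge> 1" unfolding LX using X by (subst ln_ge_iff) auto
  have "1 + C\<^sup>2 * real T \<le> X ^ 3"
  proof -
    have "C\<^sup>2 * real T \<le> X\<^sup>2 * (X - 1)" using X C_pos by (intro mult_mono power_mono) auto
    moreover have "X ^ 3 = X\<^sup>2 * (X - 1) + X\<^sup>2" by (simp add: power3_eq_cube power2_eq_square algebra_simps)
    moreover have "1 \<le> X\<^sup>2" using X by simp
    ultimately show ?thesis by linarith
  qed
  then have "ln (1 + C\<^sup>2 * real T) \<le> ln (X ^ 3)" by (intro ln_mono) (auto simp: add_pos_nonneg)
  then show "ln (1 + C\<^sup>2 * real T) \<le> 3 * L" using X by (simp add: LX ln_realpow)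
  have big: "ln (a * b / \<delta>) \<le> 4 * L" if "0 < a" "a \<le> 16" "0 < b" "b \<le> real T" for a b
  proof -
    have "4\<^sup>2 \<le> X\<^sup>2" using X by (intro power_mono) auto
    then have "a * b * (1 / \<delta>) \<le> X\<^sup>2 * X * X" using that X d1 \<delta> by (intro mult_mono) auto
    then have "a * b / \<delta> \<le> X ^ 4" by (simp add: power4_eq_xxxx power2_eq_square mult.assoc)
    then have "ln (a * b / \<delta>) \<le> ln (X ^ 4)" using that \<delta> by (intro ln_mono) auto
    then show ?thesis using X by (simp add: LX ln_realpow)
  qed
  show "ln (6 * real T / \<delta>) \<le> 4 * L" using big[of 6 "real T"] Tp by simp
  show "ln (3 * real m / \<delta>) \<le> 4 * L" using big[of 3 "real m"] mT by simp
  show "ln (3 / \<delta>) \<le> 4 * L" using big[of 3 1] Tp by simp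
  show "0 \<le> ln (6 * real T / \<delta>)" using \<delta> Tp by (intro ln_ge_zero) (simp add: field_simps)
qed

theorem qufur_upper_bound:
  assumes \<delta>: "0 < \<delta>" "\<delta> < 1" and E: "eta \<le> eta0"
  shows "measure (coin_space T \<Otimes>\<^sub>M noise_space T N)
      {\<omega> \<in> space (coin_space T \<Otimes>\<^sub>M noise_space T N). qufur_cost d T eta C c c \<theta> xs \<omega>
         \<le> 3100 * eta0\<^sup>2 * (ln (2 + real T + 1 / \<delta> + C)) powr 2 * sqrt c * (\<Sum>u<m. sqrt (real (Tu u) * real (du u)))}
    \<ge> 1 - \<delta>"
proof -
  let ?M = "coin_space T" and ?N = "noise_space T N"
  define L where "L = ln (2 + real T + 1 / \<delta> + C)"
  note lb = log_bounds[OF \<delta> L_def]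
  define bd where "bd = 3100 * eta0\<^sup>2 * L\<^sup>2 * sqrt c * (\<Sum>u<m. sqrt (real (Tu u) * real (du u)))"
  have bd: "3100 * eta0\<^sup>2 * L powr 2 * sqrt c * (\<Sum>u<m. sqrt (real (Tu u) * real (du u))) = bd"
    using lb(1) by (simp add: bd_def)
  interpret M: prob_space ?M by (rule prob_space_coin_space)
  interpret N: prob_space ?N
    using env by (intro noise_space_prob) (auto simp: lin_env_def subgaussian_def)
  interpret P: pair_prob_space ?M ?N ..
  obtain G where G: "G \<in> sets ?M" "emeasure ?M (space ?M - G) \<le> ennreal (2 * \<delta> / 3)"
    and good1: "\<forall>u\<in>G. \<forall>v<m. (\<Sum>t\<in>I v. qprob t (Q u t) * width t (Q u t) / 2
          - (if t \<in> Q u T then width t (Q u t) else 0)) \<le> ln (3 * real m / \<delta>)"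
    and good2: "\<forall>u\<in>G. (\<Sum>t<T. (if t \<in> Q u T then 1 else 0) - 2 * qprob t (Q u t)) \<le> ln (3 / \<delta>)"
    by (rule coins_good[OF \<delta>(1)]) (rule that; assumption)
  let ?c = "qufur_cost d T eta C c c \<theta> xs"
  define bad where "bad = {\<omega> \<in> space (?M \<Otimes>\<^sub>M ?N). \<not> ?c \<omega> \<le> bd}"
  have bad: "bad \<in> sets (?M \<Otimes>\<^sub>M ?N)" unfolding bad_def using measurable_cost by measurable
  \<comment> \<open>The coins are the outer variable: for coins in \<open>G\<close> the slice of
    \<open>bad\<close> lies in the bad noise set belonging to these coins, and for all others the
    slice is bounded by 1.\<close>
  have "emeasure (?M \<Otimes>\<^sub>M ?N) bad = (\<integral>\<^sup>+u. emeasure ?N (Pair u -` bad) \<partial>?M)"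
    using bad by (rule N.emeasure_pair_measure_alt)
  also have "\<dots> \<le> (\<integral>\<^sup>+u. ennreal (\<delta> / 3) + indicator (space ?M - G) u \<partial>?M)"
  proof (intro nn_integral_mono)
    fix u assume u: "u \<in> space ?M"
    show "emeasure ?N (Pair u -` bad) \<le> ennreal (\<delta> / 3) + indicator (space ?M - G) u"
    proof (cases "u \<in> G")
      case False
      have "emeasure ?N (Pair u -` bad) \<le> 1" by (rule N.emeasure_le_1)
      also have "1 \<le> ennreal (\<delta> / 3) + indicator (space ?M - G) u" using False u by simp
      finally show ?thesis .
    next
      case True
      obtain B where B: "B \<in> sets ?N" "emeasure ?N B \<le> ennreal (\<delta> / 3)"
        and good3: "\<forall>\<xi>\<in>space ?N - B. \<forall>t<T.
          \<bar>\<Sum>s\<in>Q u t. kern (Q u t) s t * \<xi> s\<bar> \<le> eta * sqrt (2 * kern (Q u t) t t * ln (6 * real T / \<delta>))"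
        by (rule noise_good[OF \<delta>, of u]) (rule that; assumption)
      have "Pair u -` bad \<subseteq> B"
      proof
        fix \<xi> assume "\<xi> \<in> Pair u -` bad"
        then have x: "\<xi> \<in> space ?N" "\<not> ?c (u, \<xi>) \<le> bd" by (auto simp: bad_def space_pair_measure)
        show "\<xi> \<in> B"
        proof (rule ccontr)
          assume "\<xi> \<notin> B"
          then have "?c (u, \<xi>) \<le> bd"
            unfolding bd_def using x good1[rule_format, OF True] good2[rule_format, OF True] good3 lb \<open>\<xi> \<notin> B\<close>
            by (intro cost_bound[OF lb(1-4) E]) (auto intro: order_trans)
          then show False using x by simp
        qed
      qed
      then have "emeasure ?N (Pair u -` bad) \<le> emeasure ?N B" using B by (intro emeasure_mono)
      also have "\<dots> \<le> ennreal (\<delta> / 3)" by (rule B)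
      finally show ?thesis by (simp add: add_increasing2)
    qed
  qed
  also have "\<dots> = ennreal (\<delta> / 3) + emeasure ?M (space ?M - G)"
    using G by (subst nn_integral_add) (auto simp: M.emeasure_space_1)
  also have "\<dots> \<le> ennreal (\<delta> / 3) + ennreal (2 * \<delta> / 3)" using G by (intro add_left_mono)
  also have "\<dots> = ennreal \<delta>" using \<delta> by (simp flip: ennreal_plus)
  finally have "P.prob bad \<le> \<delta>" using \<delta> by (simp add: P.emeasure_eq_measure)
  moreover have "{\<omega> \<in> space (?M \<Otimes>\<^sub>M ?N). ?c \<omega> \<le> bd} = space (?M \<Otimes>\<^sub>M ?N) - bad" by (auto simp: bad_def)
  ultimately have "P.prob {\<omega> \<in> space (?M \<Otimes>\<^sub>M ?N). ?c \<omega> \<le> bd} \<ge> 1 - \<delta>"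
    using P.prob_compl[OF bad] by simp
  then show ?thesis using bd by (simp add: L_def)
qed

end

section \<open>Random signs\<close>

text \<open>For v = 1 and v = -1, the probability of the label \<open>v\<close> when labels are
  random signs with mean \<mu>.\<close>

definition sign_prob :: "real \<Rightarrow> real \<Rightarrow> real" where
  "sign_prob \<mu> v = (1 + \<mu> * v) / 2"

text \<open>The centred sign, so that \<mu> plus the noise is a sign. Labels then take two values,
  and expectations over them become finite sums.\<close>

definition sign_noise :: "real \<Rightarrow> real measure" where
  "sign_noise \<mu> = distr (measure_pmf (bernoulli_pmf ((1 + \<mu>) / 2))) borel (\<lambda>b. if b then 1 - \<mu> else - 1 - \<mu>)"

lemma sign_prob_sum: "sign_prob \<mu> 1 + sign_prob \<mu> (- 1) = 1"
  by (simp add: sign_prob_def field_simps)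

lemma sign_prob_nonneg: "\<bar>\<mu>\<bar> \<le> 1 \<Longrightarrow> sign_prob \<mu> 1 \<ge> 0" "\<bar>\<mu>\<bar> \<le> 1 \<Longrightarrow> sign_prob \<mu> (- 1) \<ge> 0"
  by (auto simp: sign_prob_def)

lemma nn_integral_sign_noise:
  assumes "\<bar>\<mu>\<bar> \<le> 1" "f \<in> borel_measurable borel"
  shows "(\<integral>\<^sup>+x. f x \<partial>sign_noise \<mu>)
    = ennreal (sign_prob \<mu> 1) * f (1 - \<mu>) + ennreal (sign_prob \<mu> (- 1)) * f (- 1 - \<mu>)"
proof -
  have "(\<integral>\<^sup>+x. f x \<partial>sign_noise \<mu>) = (\<integral>\<^sup>+b. f (if b then 1 - \<mu> else - 1 - \<mu>) \<partial>bernoulli_pmf ((1 + \<mu>) / 2))"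
    unfolding sign_noise_def using assms by (subst nn_integral_distr) auto
  also have "\<dots> = f (1 - \<mu>) * ennreal ((1 + \<mu>) / 2) + f (- 1 - \<mu>) * ennreal (1 - (1 + \<mu>) / 2)"
    using assms by (subst nn_integral_bernoulli_pmf) auto
  also have "1 - (1 + \<mu>) / 2 = sign_prob \<mu> (- 1)" by (simp add: sign_prob_def field_simps)
  finally show ?thesis by (simp add: sign_prob_def mult.commute)
qed

lemma prob_space_sign_noise: "prob_space (sign_noise \<mu>)"
  unfolding sign_noise_def by (intro prob_space.prob_space_distr prob_space_measure_pmf) simp

lemma sets_sign_noise [simp]: "sets (sign_noise \<mu>) = sets borel"
  by (simp add: sign_noise_def)

text \<open>Hoeffding's lemma on an interval of length 2, whence the variance proxy 1. For negative
  \<open>l\<close> the pair (\<mu>, l) is reflected to (-\<mu>, -l).\<close>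

lemma sign_mgf:
  assumes "\<bar>\<mu>\<bar> \<le> 1"
  shows "sign_prob \<mu> 1 * exp (l * (1 - \<mu>)) + sign_prob \<mu> (- 1) * exp (l * (- 1 - \<mu>)) \<le> exp (l\<^sup>2 / 2)"
proof -
  have nonneg: "sign_prob \<mu> 1 * exp (l * (1 - \<mu>)) + sign_prob \<mu> (- 1) * exp (l * (- 1 - \<mu>)) \<le> exp (l\<^sup>2 / 2)"
    if \<mu>: "\<bar>\<mu>\<bar> \<le> 1" and l: "l \<ge> 0" for \<mu> l :: real
  proof -
    define p where "p = (1 + \<mu>) / 2"
    have p: "p \<ge> 0" using \<mu> by (simp add: p_def)
    have "exp (2 * l) \<ge> 1" using l by simp
    then have pos: "1 + p * (exp (2 * l) - 1) > 0" using p by (intro add_pos_nonneg mult_nonneg_nonneg) auto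
    have "exp (l * (1 - \<mu>)) = exp (l * (- 1 - \<mu>)) * exp (2 * l)"
      by (simp add: algebra_simps flip: exp_add)
    then have "sign_prob \<mu> 1 * exp (l * (1 - \<mu>)) + sign_prob \<mu> (- 1) * exp (l * (- 1 - \<mu>))
       = exp (l * (- 1 - \<mu>)) * (1 + p * (exp (2 * l) - 1))"
      by (simp add: sign_prob_def p_def field_simps)
    also have "\<dots> = exp (- (2 * l) * p + ln (1 + p * (exp (2 * l) - 1)))"
    proof -
      have e: "l * (- 1 - \<mu>) = - (2 * l) * p" by (simp add: p_def field_simps)
      show ?thesis unfolding e exp_add using pos by simp
    qed
    also have "\<dots> \<le> exp ((2 * l)\<^sup>2 / 8)"
      using Hoeffdings_lemma_aux[of "2 * l" p] l p by simp
    also have "(2 * l)\<^sup>2 / 8 = l\<^sup>2 / 2" by (simp add: power2_eq_square)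
    finally show ?thesis .
  qed
  show ?thesis
  proof (cases "l \<ge> 0")
    case True
    then show ?thesis using nonneg assms by blast
  next
    case False
    have "sign_prob \<mu> 1 * exp (l * (1 - \<mu>)) + sign_prob \<mu> (- 1) * exp (l * (- 1 - \<mu>))
       = sign_prob (- \<mu>) 1 * exp (- l * (1 - - \<mu>)) + sign_prob (- \<mu>) (- 1) * exp (- l * (- 1 - - \<mu>))"
      by (simp add: sign_prob_def algebra_simps)
    also have "\<dots> \<le> exp ((- l)\<^sup>2 / 2)" using False assms by (intro nonneg) auto
    finally show ?thesis by simp
  qed
qed

lemma integral_sign_noise:
  fixes f :: "real \<Rightarrow> real"
  assumes "\<bar>\<mu>\<bar> \<le> 1" "f \<in> borel_measurable borel"
  shows "integrable (sign_noise \<mu>) f"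
    "(\<integral>x. f x \<partial>sign_noise \<mu>) = sign_prob \<mu> 1 * f (1 - \<mu>) + sign_prob \<mu> (- 1) * f (- 1 - \<mu>)"
proof -
  show "integrable (sign_noise \<mu>) f"
    unfolding sign_noise_def using assms
    by (subst integrable_distr_eq) (auto intro!: integrable_measure_pmf_finite)
  have "(\<integral>x. f x \<partial>sign_noise \<mu>) = (\<integral>b. f (if b then 1 - \<mu> else - 1 - \<mu>) \<partial>bernoulli_pmf ((1 + \<mu>) / 2))"
    unfolding sign_noise_def using assms by (subst integral_distr) auto
  also have "\<dots> = f (1 - \<mu>) * ((1 + \<mu>) / 2) + f (- 1 - \<mu>) * (1 - (1 + \<mu>) / 2)"
    using assms by (subst integral_bernoulli_pmf) auto
  finally show "(\<integral>x. f x \<partial>sign_noise \<mu>) = sign_prob \<mu> 1 * f (1 - \<mu>) + sign_prob \<mu> (- 1) * f (- 1 - \<mu>)"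
    by (simp add: sign_prob_def field_simps)
qed

lemma subgaussian_sign_noise:
  assumes "\<bar>\<mu>\<bar> \<le> 1" "s \<ge> 1"
  shows "subgaussian (sign_noise \<mu>) s"
  unfolding subgaussian_def
proof (intro conjI allI)
  show "prob_space (sign_noise \<mu>)" by (rule prob_space_sign_noise)
  show "integrable (sign_noise \<mu>) (\<lambda>x. x)" using assms by (intro integral_sign_noise) auto
  show "(\<integral>x. x \<partial>sign_noise \<mu>) = 0"
    using assms by (subst integral_sign_noise) (auto simp: sign_prob_def field_simps)
  fix l
  show "integrable (sign_noise \<mu>) (\<lambda>x. exp (l * x))" using assms by (intro integral_sign_noise) auto
  have "(\<integral>x. exp (l * x) \<partial>sign_noise \<mu>) \<le> exp (l\<^sup>2 / 2)"
    using assms sign_mgf by (subst integral_sign_noise) auto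
  also have "\<dots> \<le> exp (l\<^sup>2 * s\<^sup>2 / 2)" using assms mult_left_mono[of 1 "s\<^sup>2" "l\<^sup>2"] by simp
  finally show "(\<integral>x. exp (l * x) \<partial>sign_noise \<mu>) \<le> exp (l\<^sup>2 * s\<^sup>2 / 2)" .
qed simp

text \<open>Expectation over the random labels of rounds \<open>s, \<dots>, s + n - 1\<close>, the earlier ones being fixed.\<close>
fun label_exp :: "(nat \<Rightarrow> real) \<Rightarrow> nat \<Rightarrow> nat \<Rightarrow> ((nat \<Rightarrow> real) \<Rightarrow> real) \<Rightarrow> (nat \<Rightarrow> real) \<Rightarrow> real" where
  "label_exp \<mu> s 0 H y = H y"
| "label_exp \<mu> s (Suc n) H y = sign_prob (\<mu> s) 1 * label_exp \<mu> (Suc s) n H (y(s := 1))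
     + sign_prob (\<mu> s) (- 1) * label_exp \<mu> (Suc s) n H (y(s := - 1))"

text \<open>\<open>label_exp\<close> branches on the earliest label because algorithms act forward
  in time, whereas the product measure is integrated from its last coordinate.\<close>

lemma label_exp_snoc:
  "label_exp \<mu> s (Suc n) H y = label_exp \<mu> s n (\<lambda>y. sign_prob (\<mu> (s + n)) 1 * H (y(s + n := 1))
     + sign_prob (\<mu> (s + n)) (- 1) * H (y(s + n := - 1))) y"
proof (induction n arbitrary: s y)
  case (Suc n)
  show ?case
    unfolding label_exp.simps(2)[of \<mu> s "Suc n"] label_exp.simps(2)[of \<mu> s n] Suc.IH
    by (simp only: add_Suc add_Suc_right)
qed simp

text \<open>Assumption \<open>dep\<close> settles the values outside \<open>{..<n}\<close>: points
  of the product space are \<open>undefined\<close> there, whereas the recursion starts from the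
  zero sequence.\<close>

lemma nn_integral_labels:
  assumes \<mu>: "\<And>t. \<bar>\<mu> t\<bar> \<le> 1" and nn: "\<And>y. H y \<ge> 0"
    and meas: "(\<lambda>\<xi>. H (\<lambda>t. \<mu> t + \<xi> t)) \<in> borel_measurable (PiM {..<n} (\<lambda>_. borel))"
    and dep: "\<And>y y'. (\<And>t. t < n \<Longrightarrow> y t = y' t) \<Longrightarrow> H y = H y'"
  shows "(\<integral>\<^sup>+\<xi>. ennreal (H (\<lambda>t. \<mu> t + \<xi> t)) \<partial>PiM {..<n} (\<lambda>t. sign_noise (\<mu> t))) = ennreal (label_exp \<mu> 0 n H (\<lambda>_. 0))"
  using nn meas dep
proof (induction n arbitrary: H)
  case 0
  have "(\<integral>\<^sup>+\<xi>. ennreal (H (\<lambda>t. \<mu> t + \<xi> t)) \<partial>PiM {..<0::nat} (\<lambda>t. sign_noise (\<mu> t))) = ennreal (H (\<lambda>t. \<mu> t + undefined))"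
    by (simp add: PiM_empty nn_integral_count_space_finite)
  also have "H (\<lambda>t. \<mu> t + undefined) = H (\<lambda>_. 0)" by (rule "0.prems"(3)) simp
  finally show ?case by simp
next
  case (Suc n)
  interpret P: product_prob_space "\<lambda>t. sign_noise (\<mu> t)" UNIV
    using prob_space_sign_noise by (intro product_prob_spaceI)
  have ins: "{..<Suc n} = insert n {..<n}" by auto
  have sets: "sets (PiM J (\<lambda>t. sign_noise (\<mu> t))) = sets (PiM J (\<lambda>_. borel))" for J :: "nat set"
    by (intro sets_PiM_cong) auto
  have meas1: "(\<lambda>\<xi>. ennreal (H (\<lambda>t. \<mu> t + \<xi> t))) \<in> borel_measurable (PiM (insert n {..<n}) (\<lambda>t. sign_noise (\<mu> t)))"
    using Suc.prems(2) unfolding ins by (subst measurable_cong_sets[OF sets refl]) simp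
  define H' where "H' y = sign_prob (\<mu> n) 1 * H (y(n := 1)) + sign_prob (\<mu> n) (- 1) * H (y(n := - 1))" for y
  have upd: "(\<lambda>t. \<mu> t + (\<xi>(n := v - \<mu> n)) t) = (\<lambda>t. \<mu> t + \<xi> t)(n := v)" for \<xi> v by auto
  have "(\<integral>\<^sup>+\<xi>. ennreal (H (\<lambda>t. \<mu> t + \<xi> t)) \<partial>PiM {..<Suc n} (\<lambda>t. sign_noise (\<mu> t)))
     = (\<integral>\<^sup>+\<xi>. (\<integral>\<^sup>+x. ennreal (H (\<lambda>t. \<mu> t + (\<xi>(n := x)) t)) \<partial>sign_noise (\<mu> n)) \<partial>PiM {..<n} (\<lambda>t. sign_noise (\<mu> t)))"
    unfolding ins using meas1 by (intro P.product_nn_integral_insert) auto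
  also have "\<dots> = (\<integral>\<^sup>+\<xi>. ennreal (H' (\<lambda>t. \<mu> t + \<xi> t)) \<partial>PiM {..<n} (\<lambda>t. sign_noise (\<mu> t)))"
  proof (intro nn_integral_cong)
    fix \<xi> assume \<xi>: "\<xi> \<in> space (PiM {..<n} (\<lambda>t. sign_noise (\<mu> t)))"
    have "(\<lambda>x. \<xi>(n := x)) \<in> measurable borel (PiM (insert n {..<n}) (\<lambda>_. borel))"
    proof (rule measurable_fun_upd[of _ "{..<n}"])
      have "\<xi> \<in> space (PiM {..<n} (\<lambda>_. borel))" using \<xi> sets_eq_imp_space_eq[OF sets] by simp
      then show "(\<lambda>x. \<xi>) \<in> measurable borel (PiM {..<n} (\<lambda>_. borel))" by simp
    qed auto
    then have "(\<lambda>x. H (\<lambda>t. \<mu> t + (\<xi>(n := x)) t)) \<in> borel_measurable borel"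
      using measurable_compose[OF _ Suc.prems(2)] unfolding ins by blast
    then have "(\<integral>\<^sup>+x. ennreal (H (\<lambda>t. \<mu> t + (\<xi>(n := x)) t)) \<partial>sign_noise (\<mu> n))
      = ennreal (sign_prob (\<mu> n) 1) * ennreal (H ((\<lambda>t. \<mu> t + \<xi> t)(n := 1)))
        + ennreal (sign_prob (\<mu> n) (- 1)) * ennreal (H ((\<lambda>t. \<mu> t + \<xi> t)(n := - 1)))"
      using \<mu> by (subst nn_integral_sign_noise) (simp_all only: upd, simp)
    also have "\<dots> = ennreal (H' (\<lambda>t. \<mu> t + \<xi> t))"
      using sign_prob_nonneg[OF \<mu>] Suc.prems(1) by (simp add: H'_def ennreal_mult' ennreal_plus)
    finally show "(\<integral>\<^sup>+x. ennreal (H (\<lambda>t. \<mu> t + (\<xi>(n := x)) t)) \<partial>sign_noise (\<mu> n)) = ennreal (H' (\<lambda>t. \<mu> t + \<xi> t))" .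
  qed
  also have "\<dots> = ennreal (label_exp \<mu> 0 n H' (\<lambda>_. 0))"
  proof (rule Suc.IH)
    show "0 \<le> H' y" for y unfolding H'_def using sign_prob_nonneg[OF \<mu>] Suc.prems(1) by simp
    have m: "(\<lambda>\<xi>. H ((\<lambda>t. \<mu> t + \<xi> t)(n := v))) \<in> borel_measurable (PiM {..<n} (\<lambda>_. borel))" for v
    proof -
      have "(\<lambda>\<xi>. \<xi>(n := v - \<mu> n)) \<in> measurable (PiM {..<n} (\<lambda>_. borel)) (PiM (insert n {..<n}) (\<lambda>_. borel))"
        by (rule measurable_fun_upd[of _ "{..<n}"]) auto
      from measurable_compose[OF this Suc.prems(2)[unfolded ins]] show ?thesis unfolding upd .
    qed
    show "(\<lambda>\<xi>. H' (\<lambda>t. \<mu> t + \<xi> t)) \<in> borel_measurable (PiM {..<n} (\<lambda>_. borel))"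
      unfolding H'_def using m by simp
    fix y y' :: "nat \<Rightarrow> real" assume "\<And>t. t < n \<Longrightarrow> y t = y' t"
    then have "H (y(n := v)) = H (y'(n := v))" for v by (intro Suc.prems(3)) auto
    then show "H' y = H' y'" by (simp add: H'_def)
  qed
  also have "label_exp \<mu> 0 n H' (\<lambda>_. 0) = label_exp \<mu> 0 (Suc n) H (\<lambda>_. 0)"
    by (subst label_exp_snoc) (simp add: H'_def[abs_def])
  finally show ?case .
qed

section \<open>Expected cost as a recursion over histories\<close>

lemma alg_hist_cong: "(\<And>s. s < t \<Longrightarrow> y s = y' s) \<Longrightarrow> alg_hist A r xs y t = alg_hist A r xs y' t"
  by (induction t) auto

lemma alg_act_cong: "(\<And>s. s < t \<Longrightarrow> y s = y' s) \<Longrightarrow> alg_act A r xs y t = alg_act A r xs y' t"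
  unfolding alg_act_def using alg_hist_cong by metis

text \<open>Expected cost of the rounds \<open>s, \<dots>, s + n - 1\<close> after history \<open>h\<close>, when the round cost is \<open>\<phi>\<close>
  applied to the round and the algorithm's action.\<close>
fun cost_to_go :: "algorithm \<Rightarrow> real \<Rightarrow> (nat \<Rightarrow> vect) \<Rightarrow> (nat \<Rightarrow> real) \<Rightarrow> (nat \<Rightarrow> real \<times> bool \<Rightarrow> real)
   \<Rightarrow> nat \<Rightarrow> nat \<Rightarrow> (vect \<times> real option) list \<Rightarrow> real" where
  "cost_to_go A r xs \<mu> \<phi> s 0 h = 0"
| "cost_to_go A r xs \<mu> \<phi> s (Suc n) h = \<phi> s (A r h (xs s))
     + sign_prob (\<mu> s) 1 * cost_to_go A r xs \<mu> \<phi> (Suc s) n (h @ [(xs s, if snd (A r h (xs s)) then Some 1 else None)])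
     + sign_prob (\<mu> s) (- 1) * cost_to_go A r xs \<mu> \<phi> (Suc s) n (h @ [(xs s, if snd (A r h (xs s)) then Some (- 1) else None)])"

lemma label_exp_add_const:
  assumes "\<And>y'. (\<And>t. t < s \<Longrightarrow> y' t = y t) \<Longrightarrow> H y' = k + H' y'"
  shows "label_exp \<mu> s n H y = k + label_exp \<mu> s n H' y"
  using assms
proof (induction n arbitrary: s y)
  case (Suc n)
  have IH: "label_exp \<mu> (Suc s) n H (y(s := v)) = k + label_exp \<mu> (Suc s) n H' (y(s := v))" for v
    by (rule Suc.IH) (auto intro!: Suc.prems)
  show ?case using sign_prob_sum[of "\<mu> s"] unfolding label_exp.simps IH by algebra
qed auto

text \<open>The action of a round depends only on earlier labels, so its cost leaves the expectation
  as a constant. Passing from label sequences to histories makes visible that an unqueried label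
  changes nothing afterwards.\<close>

lemma label_exp_cost:
  "label_exp \<mu> s n (\<lambda>y. \<Sum>t\<in>{s..<s + n}. \<phi> t (alg_act A r xs y t)) y = cost_to_go A r xs \<mu> \<phi> s n (alg_hist A r xs y s)"
proof (induction n arbitrary: s y)
  case (Suc n)
  let ?H = "\<lambda>s n y. \<Sum>t\<in>{s..<s + n}. \<phi> t (alg_act A r xs y t)"
  have split: "?H s (Suc n) y' = \<phi> s (alg_act A r xs y' s) + ?H (Suc s) n y'" for y'
    by (subst sum.atLeast_Suc_lessThan) auto
  have "label_exp \<mu> s (Suc n) (?H s (Suc n)) y = \<phi> s (alg_act A r xs y s) + label_exp \<mu> s (Suc n) (?H (Suc s) n) y"
    by (rule label_exp_add_const) (unfold split, metis alg_act_cong)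
  also have "\<dots> = cost_to_go A r xs \<mu> \<phi> s (Suc n) (alg_hist A r xs y s)"
  proof -
    have "alg_hist A r xs (y(s := v)) (Suc s) = alg_hist A r xs y s @ [(xs s, if snd (A r (alg_hist A r xs y s) (xs s)) then Some v else None)]" for v
      using alg_hist_cong[of s "y(s := v)" y A r xs] by simp
    then show ?thesis unfolding label_exp.simps(2) Suc.IH cost_to_go.simps(2)
      by (simp add: alg_act_def)
  qed
  finally show ?case .
qed simp

lemma cost_to_go_sum:
  "cost_to_go A r xs \<mu> (\<lambda>t a. \<Sum>k\<in>K. \<phi> k t a) s n h = (\<Sum>k\<in>K. cost_to_go A r xs \<mu> (\<phi> k) s n h)"
  by (induction n arbitrary: s h) (auto simp: sum.distrib sum_distrib_left)

lemma cost_to_go_cong: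
  assumes "\<And>t a. s \<le> t \<Longrightarrow> t < s + n \<Longrightarrow> \<phi> t a = \<psi> t a" "\<And>t. s \<le> t \<Longrightarrow> t < s + n \<Longrightarrow> \<mu> t = \<nu> t"
  shows "cost_to_go A r xs \<mu> \<phi> s n h = cost_to_go A r xs \<nu> \<psi> s n h"
  using assms by (induction n arbitrary: s h) auto

section \<open>Bayesian comparison of two opposite signs\<close>

text \<open>The weighted loss is smallest at the posterior mean p = e (a - b) / (a + b), where it
  equals the left-hand side.\<close>

lemma two_point_loss:
  fixes a b e p :: real
  assumes "a > 0" "b > 0"
  shows "4 * e\<^sup>2 * (a * b / (a + b)) \<le> a * (p - e)\<^sup>2 + b * (p + e)\<^sup>2"
proof -
  have "(a + b) * (a * (p - e)\<^sup>2 + b * (p + e)\<^sup>2) - 4 * e\<^sup>2 * (a * b) = ((a + b) * p - (a - b) * e)\<^sup>2"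
    by algebra
  then have "4 * e\<^sup>2 * (a * b) \<le> (a + b) * (a * (p - e)\<^sup>2 + b * (p + e)\<^sup>2)"
    using zero_le_power2[of "(a + b) * p - (a - b) * e"] by linarith
  then show ?thesis using assms by (simp add: field_simps)
qed

text \<open>With \<open>a\<close>, \<open>b\<close> the posterior weights of the two signs, \<open>a b / (a + b)\<close> is (up to
  normalisation) the posterior variance; one query lowers it by at most \<open>e\<^sup>2 (a + b) / 4\<close> on average.\<close>
lemma posterior_variance_query:
  fixes a b e :: real
  assumes ab: "a > 0" "b > 0" and e: "0 \<le> e" "e < 1"
  defines "w \<equiv> \<lambda>v. (a * sign_prob e v) * (b * sign_prob (- e) v) / (a * sign_prob e v + b * sign_prob (- e) v)"
  shows "w 1 + w (- 1) \<ge> a * b / (a + b) - e\<^sup>2 * (a + b) / 4"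
proof -
  define s where "s = a + b" define g where "g = a - b"
  have s: "s > 0" using ab by (simp add: s_def)
  have "\<bar>e * g\<bar> \<le> 1 * \<bar>g\<bar>" unfolding abs_mult using e by (intro mult_right_mono) auto
  also have "\<dots> < s" using ab by (auto simp: g_def s_def)
  finally have eg: "\<bar>e * g\<bar> < s" by simp
  \<comment> \<open>The two likelihoods of either label multiply to (1 - e^2) / 4, so both outcomes
    share this numerator and differ only in the denominator.\<close>
  define X where "X = a * b * (1 - e\<^sup>2) / 4"
  have n1: "(a * sign_prob e 1) * (b * sign_prob (- e) 1) = X"
    and n2: "(a * sign_prob e (- 1)) * (b * sign_prob (- e) (- 1)) = X"
    by (simp_all add: X_def sign_prob_def power2_eq_square field_simps)
  have d1: "a * sign_prob e 1 + b * sign_prob (- e) 1 = (s + e * g) / 2"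
    and d2: "a * sign_prob e (- 1) + b * sign_prob (- e) (- 1) = (s - e * g) / 2"
    by (simp_all add: sign_prob_def s_def g_def field_simps)
  have p: "s + e * g > 0" "s - e * g > 0" using eg by (auto simp: abs_less_iff)
  \<comment> \<open>Convexity of the reciprocal at two points with mean \<open>s\<close>.\<close>
  have sum: "1 / (s + e * g) + 1 / (s - e * g) \<ge> 2 / s"
  proof -
    have "1 / (s + e * g) + 1 / (s - e * g) = 2 * s / ((s + e * g) * (s - e * g))"
      using p by (simp add: field_simps)
    moreover have "(s + e * g) * (s - e * g) \<le> s * s"
      using zero_le_power2[of "e * g"] by (simp add: algebra_simps power2_eq_square)
    moreover have "0 < (s + e * g) * (s - e * g)" using p by simp
    ultimately have "1 / (s + e * g) + 1 / (s - e * g) \<ge> 2 * s / (s * s)"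
      using s by (simp only:) (intro divide_left_mono; simp)
    then show ?thesis using s by simp
  qed
  have "e\<^sup>2 \<le> 1" using e by (simp add: power_le_one)
  then have X: "2 * X \<ge> 0" using ab by (simp add: X_def)
  have "w 1 + w (- 1) = 2 * X * (1 / (s + e * g) + 1 / (s - e * g))"
    unfolding w_def n1 n2 d1 d2 by (simp add: distrib_left mult.commute)
  moreover have "\<dots> \<ge> 2 * X * (2 / s)" using sum X by (intro mult_left_mono)
  moreover have "2 * X * (2 / s) = a * b / s - e\<^sup>2 * (a * b / s)" using s by (simp add: X_def field_simps)
  ultimately have 1: "w 1 + w (- 1) \<ge> a * b / s - e\<^sup>2 * (a * b / s)" by simp
  have "a * b \<le> s * s / 4" using zero_le_power2[of "a - b"] by (simp add: s_def power2_eq_square algebra_simps)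
  then have "a * b / s \<le> s / 4" using s by (simp add: field_simps)
  then have "e\<^sup>2 * (a * b / s) \<le> e\<^sup>2 * (s / 4)" by (intro mult_left_mono) auto
  then show ?thesis using 1 by (simp add: s_def)
qed

text \<open>Backward induction in which \<open>a\<close> and \<open>b\<close> are prior weights
  times the likelihoods of the labels seen so far. With M rounds of coordinate \<open>k\<close>
  still to come, a query costs a + b and, summed over its two outcomes, lowers the bound on these
  rounds by at most c M e^4 (a + b) \<le> a + b. Hence no query strategy undercuts the loss at the
  present weights, repeated in every round.\<close>

lemma two_sign_cost:
  fixes e c :: real
  assumes e: "0 \<le> e" "e < 1" and c: "c \<ge> 0"
    and \<mu>: "\<And>t. \<kappa> t = k \<Longrightarrow> \<mu> t = e" "\<And>t. \<kappa> t = k \<Longrightarrow> \<nu> t = - e" "\<And>t. \<kappa> t \<noteq> k \<Longrightarrow> \<mu> t = \<nu> t"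
      "\<And>t. \<bar>\<mu> t\<bar> < 1"
    and small: "c * real (card {t\<in>{s..<s + n}. \<kappa> t = k}) * e ^ 4 \<le> 1"
    and ab: "a > 0" "b > 0"
  defines "\<phi> \<equiv> \<lambda>x t p. if \<kappa> t = k then c * (fst p - x)\<^sup>2 + of_bool (snd p) else 0"
  shows "a * cost_to_go A r xs \<mu> (\<phi> e) s n h + b * cost_to_go A r xs \<nu> (\<phi> (- e)) s n h
    \<ge> 4 * c * e\<^sup>2 * real (card {t\<in>{s..<s + n}. \<kappa> t = k}) * (a * b / (a + b))"
  using small ab
proof (induction n arbitrary: s h a b)
  case (Suc n)
  define q where "q = snd (A r h (xs s))" define p where "p = fst (A r h (xs s))"
  define M where "M = real (card {t\<in>{Suc s..<Suc s + n}. \<kappa> t = k})"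
  define W where "W = a * b / (a + b)"
  define h' where "h' v = h @ [(xs s, if q then Some v else None)]" for v :: real
  define G where "G v = cost_to_go A r xs \<mu> (\<phi> e) (Suc s) n (h' v)" for v
  define G' where "G' v = cost_to_go A r xs \<nu> (\<phi> (- e)) (Suc s) n (h' v)" for v
  have split: "{t\<in>{s..<s + Suc n}. \<kappa> t = k} = (if \<kappa> s = k then insert s {t\<in>{Suc s..<Suc s + n}. \<kappa> t = k}
      else {t\<in>{Suc s..<Suc s + n}. \<kappa> t = k})"
    by (auto simp: Suc_le_eq order_le_less)
  have cardM: "real (card {t\<in>{s..<s + Suc n}. \<kappa> t = k}) = (if \<kappa> s = k then M + 1 else M)"
    unfolding split M_def by auto
  have M0: "M \<ge> 0" by (simp add: M_def)
  have "c * M * e ^ 4 \<le> c * real (card {t\<in>{s..<s + Suc n}. \<kappa> t = k}) * e ^ 4"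
    unfolding cardM using c e by (intro mult_right_mono mult_left_mono) auto
  then have smallM: "c * M * e ^ 4 \<le> 1" using Suc.prems(1) by linarith
  have IH: "a * G v + b * G' v \<ge> 4 * c * e\<^sup>2 * M * (a * b / (a + b))" if "a > 0" "b > 0" for a b v
    unfolding G_def G'_def M_def using that smallM unfolding M_def by (intro Suc.IH)
  have ab: "a > 0" "b > 0" "W \<ge> 0" using Suc.prems by (auto simp: W_def)
  have exp1: "cost_to_go A r xs \<mu> (\<phi> e) s (Suc n) h = \<phi> e s (p, q) + sign_prob (\<mu> s) 1 * G 1 + sign_prob (\<mu> s) (- 1) * G (- 1)"
    by (simp add: G_def h'_def p_def q_def)
  have exp2: "cost_to_go A r xs \<nu> (\<phi> (- e)) s (Suc n) h = \<phi> (- e) s (p, q) + sign_prob (\<nu> s) 1 * G' 1 + sign_prob (\<nu> s) (- 1) * G' (- 1)"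
    by (simp add: G'_def h'_def p_def q_def)
  let ?L = "a * cost_to_go A r xs \<mu> (\<phi> e) s (Suc n) h + b * cost_to_go A r xs \<nu> (\<phi> (- e)) s (Suc n) h"
  have L: "?L = a * \<phi> e s (p, q) + b * \<phi> (- e) s (p, q)
     + ((a * sign_prob (\<mu> s) 1) * G 1 + (b * sign_prob (\<nu> s) 1) * G' 1)
     + ((a * sign_prob (\<mu> s) (- 1)) * G (- 1) + (b * sign_prob (\<nu> s) (- 1)) * G' (- 1))"
    unfolding exp1 exp2 by (simp add: algebra_simps)
  have pp: "sign_prob x v > 0" if "\<bar>x\<bar> < 1" "v = 1 \<or> v = - 1" for x v
    using that by (auto simp: sign_prob_def)
  show ?case
  proof (cases "\<kappa> s = k")
    case False
    have eq: "\<nu> s = \<mu> s" using \<mu>(3) False by simp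
    \<comment> \<open>Outside coordinate \<open>k\<close> a label has the same likelihood under both
      signs, so it scales both weights by one factor. The bounds for the two labels then add up to
      the old one.\<close>
    have half: "(a * sign_prob (\<mu> s) v) * G v + (b * sign_prob (\<mu> s) v) * G' v \<ge> 4 * c * e\<^sup>2 * M * (W * sign_prob (\<mu> s) v)"
      if "v = 1 \<or> v = - 1" for v
    proof -
      define x where "x = sign_prob (\<mu> s) v"
      have x: "x > 0" unfolding x_def using that \<mu>(4) by (intro pp) auto
      have "(a * x) * (b * x) / (a * x + b * x) = (x * (a * b * x)) / (x * (a + b))" by (simp add: algebra_simps)
      also have "\<dots> = W * x" using x by (simp add: W_def)
      finally show ?thesis using IH[of "a * x" "b * x" v] x ab by (simp add: x_def)
    qed
    have "4 * c * e\<^sup>2 * M * W = 4 * c * e\<^sup>2 * M * (W * sign_prob (\<mu> s) 1) + 4 * c * e\<^sup>2 * M * (W * sign_prob (\<mu> s) (- 1))"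
      using sign_prob_sum[of "\<mu> s"] by (simp flip: distrib_left)
    also have "\<dots> \<le> ?L"
    proof -
      have "a * \<phi> e s (p, q) + b * \<phi> (- e) s (p, q) = 0" using False by (simp add: \<phi>_def)
      then show ?thesis using half[of 1] half[of "- 1"] unfolding L eq by linarith
    qed
    finally show ?thesis unfolding cardM using False by (simp add: W_def)
  next
    case True
    have eq: "\<mu> s = e" "\<nu> s = - e" using \<mu>(1,2) True by auto
    have inst: "a * \<phi> e s (p, q) + b * \<phi> (- e) s (p, q) \<ge> 4 * c * e\<^sup>2 * W + (a + b) * of_bool q"
    proof -
      have "c * (4 * e\<^sup>2 * W) \<le> c * (a * (p - e)\<^sup>2 + b * (p + e)\<^sup>2)"
        using two_point_loss[OF ab(1,2), of e p] c unfolding W_def by (intro mult_left_mono)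
      then show ?thesis using True by (simp add: \<phi>_def algebra_simps)
    qed
    have main: "((a * sign_prob (\<mu> s) 1) * G 1 + (b * sign_prob (\<nu> s) 1) * G' 1)
     + ((a * sign_prob (\<mu> s) (- 1)) * G (- 1) + (b * sign_prob (\<nu> s) (- 1)) * G' (- 1))
      \<ge> 4 * c * e\<^sup>2 * M * W - (a + b) * of_bool q"
    proof (cases q)
      case False
      have G: "G (- 1) = G 1" "G' (- 1) = G' 1" using False by (simp_all add: G_def G'_def h'_def)
      have "((a * sign_prob (\<mu> s) 1) * G 1 + (b * sign_prob (\<nu> s) 1) * G' 1)
         + ((a * sign_prob (\<mu> s) (- 1)) * G (- 1) + (b * sign_prob (\<nu> s) (- 1)) * G' (- 1))
         = a * (sign_prob (\<mu> s) 1 + sign_prob (\<mu> s) (- 1)) * G 1 + b * (sign_prob (\<nu> s) 1 + sign_prob (\<nu> s) (- 1)) * G' 1"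
        unfolding G by (simp add: algebra_simps)
      also have "\<dots> = a * G 1 + b * G' 1" by (simp add: sign_prob_sum)
      finally show ?thesis using IH[OF ab(1,2), of 1] False by (simp add: W_def)
    next
      case True
      let ?w = "\<lambda>v. (a * sign_prob e v) * (b * sign_prob (- e) v) / (a * sign_prob e v + b * sign_prob (- e) v)"
      have "4 * c * e\<^sup>2 * M * W - (a + b) \<le> 4 * c * e\<^sup>2 * M * (W - e\<^sup>2 * (a + b) / 4)"
      proof -
        have "4 * c * e\<^sup>2 * M * (e\<^sup>2 * (a + b) / 4) = (c * M * e ^ 4) * (a + b)"
          by (simp add: power2_eq_square power4_eq_xxxx)
        also have "\<dots> \<le> 1 * (a + b)" using smallM ab by (intro mult_right_mono) auto
        finally show ?thesis by (simp add: right_diff_distrib)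
      qed
      also have "\<dots> \<le> 4 * c * e\<^sup>2 * M * (?w 1 + ?w (- 1))"
        using posterior_variance_query[OF ab(1,2) e] c M0 unfolding W_def by (intro mult_left_mono) auto
      also have "\<dots> = 4 * c * e\<^sup>2 * M * ?w 1 + 4 * c * e\<^sup>2 * M * ?w (- 1)" by (rule distrib_left)
      also have "\<dots> \<le> ((a * sign_prob e 1) * G 1 + (b * sign_prob (- e) 1) * G' 1)
         + ((a * sign_prob e (- 1)) * G (- 1) + (b * sign_prob (- e) (- 1)) * G' (- 1))"
        using e ab by (intro add_mono IH mult_pos_pos pp) auto
      finally show ?thesis using True unfolding eq by simp
    qed
    have "4 * c * e\<^sup>2 * (M + 1) * W = 4 * c * e\<^sup>2 * W + 4 * c * e\<^sup>2 * M * W" by (simp add: algebra_simps)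
    also have "\<dots> \<le> ?L" unfolding L using inst main by linarith
    finally show ?thesis unfolding cardM using True by (simp add: W_def)
  qed
qed simp

section \<open>Lower bound\<close>

definition unit_vec :: "nat \<Rightarrow> vect" where
  "unit_vec k = (\<lambda>i. if i = k then 1 else 0)"

lemma ip_unit_vec: "ip d \<theta> (unit_vec k) = (if k < d then \<theta> k else 0)"
  by (simp add: ip_def unit_vec_def if_distrib cong: if_cong)

definition sign_param :: "nat \<Rightarrow> (nat \<Rightarrow> real) \<Rightarrow> nat set \<Rightarrow> vect" where
  "sign_param D \<epsilon> \<sigma> = (\<lambda>i. if i < D then if i \<in> \<sigma> then \<epsilon> i else - \<epsilon> i else 0)"

lemma sum_card_eq: "real (card {t. t < T \<and> P t}) = (\<Sum>t<(T::nat). of_bool (P t))"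
proof -
  have "{t. t < T \<and> P t} = {..<T} \<inter> {t. P t}" by auto
  then show ?thesis by (simp add: of_bool_def sum.If_cases)
qed

text \<open>Round \<open>t\<close> shows the basis vector of index \<kappa> t, and the sign of a
  coordinate is coded by membership in a set \<sigma>. Assumption \<open>small\<close> is the
  condition of \<open>two_sign_cost\<close> under which queries do not pay.\<close>

locale sign_family =
  fixes d T D :: nat and c :: real and \<kappa> :: "nat \<Rightarrow> nat" and \<epsilon> :: "nat \<Rightarrow> real"
    and A :: algorithm and Rm :: "real measure"
  assumes D: "D \<le> d" and c: "c \<ge> 0" and \<kappa>: "\<And>t. t < T \<Longrightarrow> \<kappa> t < D"
    and \<epsilon>: "\<And>k. 0 \<le> \<epsilon> k" "\<And>k. \<epsilon> k < 1"
    and small: "\<And>k. k < D \<Longrightarrow> c * real (card {t\<in>{0..<T}. \<kappa> t = k}) * \<epsilon> k ^ 4 \<le> 1"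
    and Rm: "prob_space Rm" "sets Rm = sets borel" and A: "admissible_alg Rm A"
begin

definition ctx :: "nat \<Rightarrow> vect" where "ctx t = unit_vec (\<kappa> t)"

definition mean :: "nat set \<Rightarrow> nat \<Rightarrow> real" where "mean \<sigma> t = sign_param D \<epsilon> \<sigma> (\<kappa> t)"

definition loss :: "nat set \<Rightarrow> nat \<Rightarrow> real \<times> bool \<Rightarrow> real" where
  "loss \<sigma> t p = c * (fst p - mean \<sigma> t)\<^sup>2 + of_bool (snd p)"

definition coord_loss :: "nat \<Rightarrow> real \<Rightarrow> nat \<Rightarrow> real \<times> bool \<Rightarrow> real" where
  "coord_loss k x t p = (if \<kappa> t = k then c * (fst p - x)\<^sup>2 + of_bool (snd p) else 0)"

abbreviation noise :: "nat set \<Rightarrow> (nat \<Rightarrow> real) measure" where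
  "noise \<sigma> \<equiv> noise_space T (\<lambda>t. sign_noise (mean \<sigma> t))"

lemma mean_eq: "ip d (sign_param D \<epsilon> \<sigma>) (ctx t) = mean \<sigma> t"
  using D by (auto simp: ctx_def ip_unit_vec mean_def sign_param_def)

lemma mean_less: "\<bar>mean \<sigma> t\<bar> < 1"
  using \<epsilon>[of "\<kappa> t"] by (auto simp: mean_def sign_param_def)

text \<open>The two environments differ only in the rounds of coordinate \<open>k\<close>. Equal
  weights a = b = 1 give a b / (a + b) = 1/2, which turns the factor 4 into 2.\<close>

lemma expected_coord_cost:
  assumes k: "k < D" "k \<in> \<sigma>"
  shows "cost_to_go A r ctx (mean \<sigma>) (coord_loss k (\<epsilon> k)) 0 T []
     + cost_to_go A r ctx (mean (\<sigma> - {k})) (coord_loss k (- \<epsilon> k)) 0 T []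
    \<ge> 2 * (c * (\<epsilon> k)\<^sup>2 * real (card {t\<in>{0..<T}. \<kappa> t = k}))"
proof -
  have "1 * cost_to_go A r ctx (mean \<sigma>) (coord_loss k (\<epsilon> k)) 0 T []
     + 1 * cost_to_go A r ctx (mean (\<sigma> - {k})) (coord_loss k (- \<epsilon> k)) 0 T []
    \<ge> 4 * c * (\<epsilon> k)\<^sup>2 * real (card {t\<in>{0..<0 + T}. \<kappa> t = k}) * (1 * 1 / (1 + 1))"
    unfolding coord_loss_def
    using \<epsilon> c k small[OF k(1)] mean_less by (intro two_sign_cost) (auto simp: mean_def sign_param_def)
  then show ?thesis by simp
qed

lemma cost_decompose:
  "cost_to_go A r ctx (mean \<sigma>) (loss \<sigma>) 0 T []
    = (\<Sum>k<D. cost_to_go A r ctx (mean \<sigma>) (coord_loss k (sign_param D \<epsilon> \<sigma> k)) 0 T [])"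
proof -
  have "cost_to_go A r ctx (mean \<sigma>) (loss \<sigma>) 0 T []
    = cost_to_go A r ctx (mean \<sigma>) (\<lambda>t p. \<Sum>k<D. coord_loss k (sign_param D \<epsilon> \<sigma> k) t p) 0 T []"
    using \<kappa> by (intro cost_to_go_cong) (auto simp: loss_def coord_loss_def mean_def)
  then show ?thesis by (simp only: cost_to_go_sum)
qed

text \<open>As in Assouad's lemma, each coordinate pairs every sign pattern with the one flipped
  there; the flip is an involution, so the sum over patterns is half the sum over these
  pairs.\<close>

lemma average_cost:
  "(\<Sum>\<sigma>\<in>Pow {..<D}. cost_to_go A r ctx (mean \<sigma>) (loss \<sigma>) 0 T [])
    \<ge> 2 ^ D * (\<Sum>k<D. c * (\<epsilon> k)\<^sup>2 * real (card {t\<in>{0..<T}. \<kappa> t = k}))"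
proof -
  define g where "g k \<sigma> = cost_to_go A r ctx (mean \<sigma>) (coord_loss k (sign_param D \<epsilon> \<sigma> k)) 0 T []" for k \<sigma>
  define B where "B k = c * (\<epsilon> k)\<^sup>2 * real (card {t\<in>{0..<T}. \<kappa> t = k})" for k
  define flip where "flip k \<sigma> = (if k \<in> \<sigma> then \<sigma> - {k} else insert k \<sigma>)" for k :: nat and \<sigma>
  have pair: "g k \<sigma> + g k (flip k \<sigma>) \<ge> 2 * B k" if k: "k < D" for k \<sigma>
  proof (cases "k \<in> \<sigma>")
    case True
    then show ?thesis using expected_coord_cost[OF k True, of r] k
      by (simp add: g_def B_def flip_def sign_param_def)
  next
    case False
    then have "insert k \<sigma> - {k} = \<sigma>" by auto
    then show ?thesis using expected_coord_cost[OF k, of "insert k \<sigma>" r] k False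
      by (simp add: g_def B_def flip_def sign_param_def add.commute)
  qed
  have "2 ^ D * B k \<le> (\<Sum>\<sigma>\<in>Pow {..<D}. g k \<sigma>)" if k: "k < D" for k
  proof -
    have "(\<Sum>\<sigma>\<in>Pow {..<D}. g k (flip k \<sigma>)) = (\<Sum>\<sigma>\<in>Pow {..<D}. g k \<sigma>)"
      using k by (intro sum.reindex_bij_witness[where i = "flip k" and j = "flip k"]) (auto simp: flip_def)
    then have "2 * (\<Sum>\<sigma>\<in>Pow {..<D}. g k \<sigma>) = (\<Sum>\<sigma>\<in>Pow {..<D}. g k \<sigma> + g k (flip k \<sigma>))"
      by (simp add: sum.distrib)
    also have "\<dots> \<ge> (\<Sum>\<sigma>\<in>Pow {..<D}. 2 * B k)" using pair[OF k] by (intro sum_mono)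
    finally show ?thesis by (simp add: card_Pow)
  qed
  then have "(\<Sum>k<D. 2 ^ D * B k) \<le> (\<Sum>k<D. \<Sum>\<sigma>\<in>Pow {..<D}. g k \<sigma>)" by (intro sum_mono) auto
  also have "\<dots> = (\<Sum>\<sigma>\<in>Pow {..<D}. \<Sum>k<D. g k \<sigma>)" by (rule sum.swap)
  finally show ?thesis unfolding cost_decompose by (simp add: g_def B_def sum_distrib_left)
qed

lemma alg_cost_loss:
  "alg_cost A d T c (sign_param D \<epsilon> \<sigma>) ctx (r, \<xi>)
    = (\<Sum>t\<in>{0..<0 + T}. loss \<sigma> t (alg_act A r ctx (\<lambda>t. mean \<sigma> t + \<xi> t) t))"
proof -
  have "labels d (sign_param D \<epsilon> \<sigma>) ctx \<xi> = (\<lambda>t. mean \<sigma> t + \<xi> t)"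
    by (auto simp: labels_def mean_eq)
  then show ?thesis
    by (simp add: alg_cost_def Let_def loss_def mean_eq sum_card_eq sum.distrib sum_distrib_left atLeast0LessThan)
qed

lemma noise_prob: "prob_space (noise \<sigma>)"
  unfolding noise_space_def by (intro prob_space_PiM prob_space_sign_noise)

lemma sets_noise: "sets (noise \<sigma>) = sets (PiM {..<T} (\<lambda>_. borel))"
  unfolding noise_space_def by (intro sets_PiM_cong) auto

lemma measurable_alg_cost:
  "alg_cost A d T c (sign_param D \<epsilon> \<sigma>) ctx \<in> borel_measurable (Rm \<Otimes>\<^sub>M noise \<sigma>)"
proof -
  have "alg_cost A d T c (sign_param D \<epsilon> \<sigma>) ctx \<in> borel_measurable (Rm \<Otimes>\<^sub>M PiM {..<T} (\<lambda>_. borel))"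
  proof -
    let ?M = "Rm \<Otimes>\<^sub>M PiM {..<T} (\<lambda>_. borel)"
    let ?a = "\<lambda>t \<omega>. alg_act A (fst \<omega>) ctx (labels d (sign_param D \<epsilon> \<sigma>) ctx (snd \<omega>)) t"
    have act: "?a t \<in> measurable ?M (borel \<Otimes>\<^sub>M count_space UNIV)" if "t < T" for t
      using A that unfolding admissible_alg_def by blast
    have 1: "(\<lambda>\<omega>. fst (?a t \<omega>)) \<in> borel_measurable ?M" if "t < T" for t
      using measurable_compose[OF act[OF that] measurable_fst] .
    have "(\<lambda>\<omega>. snd (?a t \<omega>)) \<in> measurable ?M (count_space UNIV)" if "t < T" for t
      using measurable_compose[OF act[OF that] measurable_snd] .
    then have 2: "(\<lambda>\<omega>. of_bool (snd (?a t \<omega>)) :: real) \<in> borel_measurable ?M" if "t < T" for t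
      using that measurable_compose[of _ ?M "count_space UNIV" "\<lambda>b. of_bool b :: real" borel] by simp
    have 3: "(\<lambda>\<omega>. \<Sum>t<T. (fst (?a t \<omega>) - ip d (sign_param D \<epsilon> \<sigma>) (ctx t))\<^sup>2) \<in> borel_measurable ?M"
      using 1 by (intro borel_measurable_sum borel_measurable_power borel_measurable_diff) auto
    have 4: "(\<lambda>\<omega>. \<Sum>t<T. of_bool (snd (?a t \<omega>)) :: real) \<in> borel_measurable ?M"
      using 2 by (intro borel_measurable_sum) auto
    show ?thesis unfolding alg_cost_def Let_def sum_card_eq using 3 4 by simp
  qed
  moreover have "sets (Rm \<Otimes>\<^sub>M PiM {..<T} (\<lambda>_. borel)) = sets (Rm \<Otimes>\<^sub>M noise \<sigma>)"
    by (intro sets_pair_measure_cong refl sets_noise[symmetric])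
  ultimately show ?thesis using measurable_cong_sets by blast
qed

lemma expected_alg_cost:
  "(\<lambda>r. ennreal (cost_to_go A r ctx (mean \<sigma>) (loss \<sigma>) 0 T [])) \<in> borel_measurable Rm"
  "(\<integral>\<^sup>+\<omega>. ennreal (alg_cost A d T c (sign_param D \<epsilon> \<sigma>) ctx \<omega>) \<partial>(Rm \<Otimes>\<^sub>M noise \<sigma>))
    = (\<integral>\<^sup>+r. ennreal (cost_to_go A r ctx (mean \<sigma>) (loss \<sigma>) 0 T []) \<partial>Rm)"
proof -
  let ?f = "\<lambda>\<omega>. ennreal (alg_cost A d T c (sign_param D \<epsilon> \<sigma>) ctx \<omega>)"
  interpret N: prob_space "noise \<sigma>" by (rule noise_prob)
  have f: "?f \<in> borel_measurable (Rm \<Otimes>\<^sub>M noise \<sigma>)" using measurable_alg_cost by simp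
  have inner: "(\<integral>\<^sup>+\<xi>. ?f (r, \<xi>) \<partial>noise \<sigma>) = ennreal (cost_to_go A r ctx (mean \<sigma>) (loss \<sigma>) 0 T [])" for r
  proof -
    have r: "r \<in> space Rm" using sets_eq_imp_space_eq[OF Rm(2)] by simp
    let ?H = "\<lambda>y. \<Sum>t\<in>{0..<0 + T}. loss \<sigma> t (alg_act A r ctx y t)"
    have "(\<lambda>\<xi>. alg_cost A d T c (sign_param D \<epsilon> \<sigma>) ctx (r, \<xi>)) \<in> borel_measurable (noise \<sigma>)"
      using measurable_compose[OF measurable_Pair1'[OF r] measurable_alg_cost] .
    then have m: "(\<lambda>\<xi>. ?H (\<lambda>t. mean \<sigma> t + \<xi> t)) \<in> borel_measurable (PiM {..<T} (\<lambda>_. borel))"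
      unfolding alg_cost_loss using measurable_cong_sets[OF sets_noise refl] by blast
    have "(\<integral>\<^sup>+\<xi>. ?f (r, \<xi>) \<partial>noise \<sigma>)
       = (\<integral>\<^sup>+\<xi>. ennreal (?H (\<lambda>t. mean \<sigma> t + \<xi> t)) \<partial>PiM {..<T} (\<lambda>t. sign_noise (mean \<sigma> t)))"
      unfolding alg_cost_loss noise_space_def ..
    also have "\<dots> = ennreal (label_exp (mean \<sigma>) 0 T ?H (\<lambda>_. 0))"
    proof (rule nn_integral_labels[OF _ _ m])
      show "\<bar>mean \<sigma> t\<bar> \<le> 1" for t using mean_less[of \<sigma> t] by simp
      show "0 \<le> ?H y" for y using c by (intro sum_nonneg) (simp add: loss_def)
      fix y y' :: "nat \<Rightarrow> real" assume y: "\<And>t. t < T \<Longrightarrow> y t = y' t"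
      have "alg_act A r ctx y t = alg_act A r ctx y' t" if "t < T" for t
        using y that by (intro alg_act_cong) auto
      then show "?H y = ?H y'" by (intro sum.cong) auto
    qed
    also have "label_exp (mean \<sigma>) 0 T ?H (\<lambda>_. 0) = cost_to_go A r ctx (mean \<sigma>) (loss \<sigma>) 0 T []"
      by (subst label_exp_cost) simp
    finally show ?thesis .
  qed
  show "(\<lambda>r. ennreal (cost_to_go A r ctx (mean \<sigma>) (loss \<sigma>) 0 T [])) \<in> borel_measurable Rm"
    using N.borel_measurable_nn_integral_fst[OF f] unfolding inner .
  show "(\<integral>\<^sup>+\<omega>. ?f \<omega> \<partial>(Rm \<Otimes>\<^sub>M noise \<sigma>)) = (\<integral>\<^sup>+r. ennreal (cost_to_go A r ctx (mean \<sigma>) (loss \<sigma>) 0 T []) \<partial>Rm)"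
    using N.nn_integral_fst[OF f] unfolding inner by simp
qed

lemma cost_to_go_nonneg: "cost_to_go A r ctx (mean \<sigma>) (loss \<sigma>) s n h \<ge> 0"
proof (induction n arbitrary: s h)
  case (Suc n)
  have "loss \<sigma> s p \<ge> 0" for p using c by (simp add: loss_def)
  moreover have "\<bar>mean \<sigma> s\<bar> \<le> 1" using mean_less[of \<sigma> s] by simp
  ultimately show ?case using Suc sign_prob_nonneg by simp
qed simp

text \<open>The pattern may not depend on the seed \<open>r\<close>, so the sum over patterns is
  integrated over \<open>r\<close> before a pattern is selected. Under the negated claim every
  expectation is finite, which permits the strict comparison in the reals.\<close>

theorem exists_hard_sign:
  "\<exists>\<sigma>. (\<integral>\<^sup>+\<omega>. ennreal (alg_cost A d T c (sign_param D \<epsilon> \<sigma>) ctx \<omega>) \<partial>(Rm \<Otimes>\<^sub>M noise \<sigma>))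
    \<ge> ennreal (\<Sum>k<D. c * (\<epsilon> k)\<^sup>2 * real (card {t\<in>{0..<T}. \<kappa> t = k}))"
proof (rule ccontr)
  let ?E = "\<lambda>\<sigma>. \<integral>\<^sup>+\<omega>. ennreal (alg_cost A d T c (sign_param D \<epsilon> \<sigma>) ctx \<omega>) \<partial>(Rm \<Otimes>\<^sub>M noise \<sigma>)"
  let ?B = "\<Sum>k<D. c * (\<epsilon> k)\<^sup>2 * real (card {t\<in>{0..<T}. \<kappa> t = k})"
  let ?g = "\<lambda>r \<sigma>. cost_to_go A r ctx (mean \<sigma>) (loss \<sigma>) 0 T []"
  assume "\<not> (\<exists>\<sigma>. ?E \<sigma> \<ge> ennreal ?B)"
  then have lt: "?E \<sigma> < ennreal ?B" for \<sigma> by (simp add: not_le)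
  have fin: "?E \<sigma> = ennreal (enn2real (?E \<sigma>))" for \<sigma>
    using less_trans[OF lt ennreal_less_top] by (intro ennreal_enn2real[symmetric])
  interpret R: prob_space Rm by (rule Rm)
  have "ennreal (2 ^ D * ?B) = (\<integral>\<^sup>+r. ennreal (2 ^ D * ?B) \<partial>Rm)" by (simp add: R.emeasure_space_1)
  also have "\<dots> \<le> (\<integral>\<^sup>+r. (\<Sum>\<sigma>\<in>Pow {..<D}. ennreal (?g r \<sigma>)) \<partial>Rm)"
  proof (intro nn_integral_mono)
    fix r
    have "ennreal (2 ^ D * ?B) \<le> ennreal (\<Sum>\<sigma>\<in>Pow {..<D}. ?g r \<sigma>)" by (intro ennreal_leI average_cost)
    also have "\<dots> = (\<Sum>\<sigma>\<in>Pow {..<D}. ennreal (?g r \<sigma>))" using cost_to_go_nonneg by (subst sum_ennreal) auto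
    finally show "ennreal (2 ^ D * ?B) \<le> (\<Sum>\<sigma>\<in>Pow {..<D}. ennreal (?g r \<sigma>))" .
  qed
  also have "\<dots> = (\<Sum>\<sigma>\<in>Pow {..<D}. ?E \<sigma>)"
    unfolding expected_alg_cost(2) using expected_alg_cost(1) by (intro nn_integral_sum)
  also have "\<dots> = ennreal (\<Sum>\<sigma>\<in>Pow {..<D}. enn2real (?E \<sigma>))"
  proof -
    have "(\<Sum>\<sigma>\<in>Pow {..<D}. ?E \<sigma>) = (\<Sum>\<sigma>\<in>Pow {..<D}. ennreal (enn2real (?E \<sigma>)))"
      by (intro sum.cong refl fin)
    also have "\<dots> = ennreal (\<Sum>\<sigma>\<in>Pow {..<D}. enn2real (?E \<sigma>))" by (intro sum_ennreal) simp
    finally show ?thesis .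
  qed
  finally have "2 ^ D * ?B \<le> (\<Sum>\<sigma>\<in>Pow {..<D}. enn2real (?E \<sigma>))"
    by (subst (asm) ennreal_le_iff) (auto intro: sum_nonneg)
  moreover have "enn2real (?E \<sigma>) < ?B" for \<sigma>
  proof -
    have "ennreal (enn2real (?E \<sigma>)) < ennreal ?B" by (subst fin[symmetric]) (rule lt)
    then show ?thesis by (simp only: ennreal_less_iff[OF enn2real_nonneg])
  qed
  then have "(\<Sum>\<sigma>\<in>Pow {..<D}. enn2real (?E \<sigma>)) < (\<Sum>\<sigma>\<in>Pow {..<D}. ?B)"
    by (intro sum_strict_mono) auto
  ultimately show False by (simp add: card_Pow)
qed

end

section \<open>Contexts that realise the domain structure\<close>

definition prefix_sum :: "(nat \<Rightarrow> nat) \<Rightarrow> nat \<Rightarrow> nat" where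
  "prefix_sum f u = (\<Sum>v<u. f v)"

definition block :: "(nat \<Rightarrow> nat) \<Rightarrow> nat \<Rightarrow> nat" where
  "block Tu t = (LEAST u. t < prefix_sum Tu (Suc u))"

text \<open>Round robin: block \<open>u\<close> owns the basis vectors from
  \<open>prefix_sum du u\<close> on and cycles through \<open>du u\<close> of them.\<close>

definition coord :: "(nat \<Rightarrow> nat) \<Rightarrow> (nat \<Rightarrow> nat) \<Rightarrow> nat \<Rightarrow> nat" where
  "coord du Tu t = prefix_sum du (block Tu t) + (t - prefix_sum Tu (block Tu t)) mod du (block Tu t)"

lemma prefix_sum_Suc [simp]: "prefix_sum f (Suc u) = prefix_sum f u + f u"
  by (simp add: prefix_sum_def)

lemma prefix_sum_mono: "u \<le> v \<Longrightarrow> prefix_sum f u \<le> prefix_sum f v"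
  unfolding prefix_sum_def by (intro sum_mono2) auto

lemma prefix_sum_ex: "t < prefix_sum f m \<Longrightarrow> \<exists>u<m. prefix_sum f u \<le> t \<and> t < prefix_sum f (Suc u)"
proof (induction m)
  case (Suc m)
  then show ?case by (cases "t < prefix_sum f m") (auto simp: less_Suc_eq)
qed (simp add: prefix_sum_def)

lemma block_eq:
  assumes "prefix_sum Tu u \<le> t" "t < prefix_sum Tu (Suc u)"
  shows "block Tu t = u"
  unfolding block_def
proof (rule Least_equality)
  show "t < prefix_sum Tu (Suc u)" by (rule assms(2))
  fix w assume w: "t < prefix_sum Tu (Suc w)"
  show "u \<le> w"
  proof (rule ccontr)
    assume "\<not> u \<le> w"
    then have "prefix_sum Tu (Suc w) \<le> prefix_sum Tu u" by (intro prefix_sum_mono) simp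
    then show False using w assms by linarith
  qed
qed

lemma coord_in_block:
  assumes "prefix_sum Tu u \<le> t" "t < prefix_sum Tu (Suc u)"
  shows "coord du Tu t = prefix_sum du u + (t - prefix_sum Tu u) mod du u"
  using block_eq[OF assms] by (simp add: coord_def)

lemma coord_less:
  assumes "t < prefix_sum Tu m" "\<And>u. u < m \<Longrightarrow> 0 < du u"
  shows "coord du Tu t < prefix_sum du m"
proof -
  obtain u where u: "u < m" "prefix_sum Tu u \<le> t" "t < prefix_sum Tu (Suc u)"
    using prefix_sum_ex[OF assms(1)] by blast
  have "coord du Tu t < prefix_sum du (Suc u)"
    using coord_in_block[OF u(2,3), of du] assms(2)[OF u(1)] by simp
  also have "\<dots> \<le> prefix_sum du m" using u by (intro prefix_sum_mono) simp
  finally show ?thesis .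
qed

lemma coord_domain_structure:
  assumes pos: "\<And>u. u < m \<Longrightarrow> 0 < du u \<and> 0 < Tu u" and d: "prefix_sum du m \<le> d"
  shows "domain_structure d m du Tu (\<lambda>u. {prefix_sum Tu u..<prefix_sum Tu (Suc u)}) (\<lambda>t. unit_vec (coord du Tu t))"
  unfolding domain_structure_def
proof (intro conjI allI impI)
  fix u assume u: "u < m"
  show "finite {prefix_sum Tu u..<prefix_sum Tu (Suc u)}" by simp
  show "{prefix_sum Tu u..<prefix_sum Tu (Suc u)} \<noteq> {}" using pos[OF u] by simp
  show "card {prefix_sum Tu u..<prefix_sum Tu (Suc u)} = Tu u" by simp
  show "\<exists>B :: nat \<Rightarrow> vect. (\<forall>j<du u. in_dim d (B j)) \<and>
        (\<forall>t\<in>{prefix_sum Tu u..<prefix_sum Tu (Suc u)}. \<exists>a :: nat \<Rightarrow> real.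
           unit_vec (coord du Tu t) = (\<lambda>i. \<Sum>j<du u. a j * B j i))"
  proof (intro exI[of _ "\<lambda>j. unit_vec (prefix_sum du u + j)"] conjI allI impI ballI)
    fix j assume "j < du u"
    then have "prefix_sum du u + j < prefix_sum du (Suc u)" by simp
    also have "\<dots> \<le> d" using prefix_sum_mono[of "Suc u" m du] u d by simp
    finally show "in_dim d (unit_vec (prefix_sum du u + j))" by (auto simp: in_dim_def unit_vec_def)
  next
    fix t assume t: "t \<in> {prefix_sum Tu u..<prefix_sum Tu (Suc u)}"
    define k where "k = (t - prefix_sum Tu u) mod du u"
    have k: "k < du u" using pos[OF u] by (simp add: k_def)
    have "unit_vec (coord du Tu t) = unit_vec (prefix_sum du u + k)"
      using coord_in_block[of Tu u t du] t by (simp add: k_def)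
    also have "\<dots> = (\<lambda>i. \<Sum>j<du u. (if j = k then 1 else 0) * unit_vec (prefix_sum du u + j) i)"
      using k by (simp add: if_distrib[of "\<lambda>x. x * _"] cong: if_cong)
    finally show "\<exists>a :: nat \<Rightarrow> real. unit_vec (coord du Tu t) = (\<lambda>i. \<Sum>j<du u. a j * unit_vec (prefix_sum du u + j) i)"
      by (rule exI[of _ "\<lambda>j. if j = k then 1 else 0"])
  qed
  fix v assume v: "v < m" "u \<noteq> v"
  have *: "{prefix_sum Tu a..<prefix_sum Tu (Suc a)} \<inter> {prefix_sum Tu b..<prefix_sum Tu (Suc b)} = {}" if "a < b" for a b
    using prefix_sum_mono[of "Suc a" b Tu] that by auto
  show "{prefix_sum Tu u..<prefix_sum Tu (Suc u)} \<inter> {prefix_sum Tu v..<prefix_sum Tu (Suc v)} = {}"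
    using v(2) *[of u v] *[of v u] by (metis Int_commute linorder_neq_iff)
next
  show "(\<Union>u<m. {prefix_sum Tu u..<prefix_sum Tu (Suc u)}) = {..<\<Sum>u<m. Tu u}"
  proof (intro equalityI subsetI)
    fix t assume "t \<in> (\<Union>u<m. {prefix_sum Tu u..<prefix_sum Tu (Suc u)})"
    then obtain u where u: "u < m" "t < prefix_sum Tu (Suc u)" by auto
    then have "t < prefix_sum Tu m" using prefix_sum_mono[of "Suc u" m Tu] by linarith
    then show "t \<in> {..<\<Sum>u<m. Tu u}" by (simp add: prefix_sum_def)
  next
    fix t assume "t \<in> {..<\<Sum>u<m. Tu u}"
    then show "t \<in> (\<Union>u<m. {prefix_sum Tu u..<prefix_sum Tu (Suc u)})"
      using prefix_sum_ex[of t Tu m] by (auto simp: prefix_sum_def)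
  qed
qed

lemma coord_count:
  assumes u: "u < m" and j: "j < du u"
  shows "Tu u div du u \<le> card {t\<in>{0..<prefix_sum Tu m}. coord du Tu t = prefix_sum du u + j}"
proof -
  \<comment> \<open>The rounds of the block congruent to \<open>j\<close> modulo
    \<open>du u\<close>, one for each complete cycle.\<close>
  let ?f = "\<lambda>i. prefix_sum Tu u + (i * du u + j)"
  have inj: "inj_on ?f {..<Tu u div du u}" using j by (auto simp: inj_on_def)
  have "?f ` {..<Tu u div du u} \<subseteq> {t\<in>{0..<prefix_sum Tu m}. coord du Tu t = prefix_sum du u + j}"
  proof clarify
    fix i assume i: "i < Tu u div du u"
    have "i * du u + j < Suc i * du u" using j by simp
    also have "\<dots> \<le> (Tu u div du u) * du u" using i by (intro mult_right_mono) auto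
    also have "\<dots> \<le> Tu u" by simp
    finally have lt: "?f i < prefix_sum Tu (Suc u)" by simp
    then have "coord du Tu (?f i) = prefix_sum du u + j" using coord_in_block[of Tu u "?f i" du] j by simp
    moreover have "?f i < prefix_sum Tu m" using lt prefix_sum_mono[of "Suc u" m Tu] u by linarith
    ultimately show "?f i \<in> {0..<prefix_sum Tu m} \<and> coord du Tu (?f i) = prefix_sum du u + j" by simp
  qed
  then have "card (?f ` {..<Tu u div du u}) \<le> card {t\<in>{0..<prefix_sum Tu m}. coord du Tu t = prefix_sum du u + j}"
    by (intro card_mono) auto
  then show ?thesis using inj by (simp add: card_image)
qed

text \<open>Rounding T_u / d_u \<ge> 1 down to an integer loses at most a factor 2.\<close>

lemma coord_count_real:
  assumes u: "u < m" and j: "j < du u" and le: "du u \<le> Tu u"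
  shows "real (Tu u) / (2 * real (du u)) \<le> real (card {t\<in>{0..<prefix_sum Tu m}. coord du Tu t = prefix_sum du u + j})"
proof -
  have p: "du u > 0" using j by simp
  have "1 \<le> Tu u div du u" using le p by (simp add: Suc_le_eq div_greater_zero_iff)
  then have "du u \<le> Tu u div du u * du u" by (metis mult_le_mono1 mult_1)
  moreover have "Tu u < Tu u div du u * du u + du u" using p by (metis add_less_cancel_left div_mult_mod_eq mod_less_divisor)
  ultimately have "Tu u \<le> 2 * (Tu u div du u * du u)" by linarith
  then have "real (Tu u) \<le> real (2 * (Tu u div du u * du u))" by (simp only: of_nat_le_iff)
  then have "real (Tu u) \<le> real (Tu u div du u) * (2 * real (du u))" by (simp only: of_nat_mult of_nat_numeral mult_ac)
  then have "real (Tu u) / (2 * real (du u)) \<le> real (Tu u div du u)" using p by (simp only: divide_le_eq) simp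
  also have "\<dots> \<le> real (card {t\<in>{0..<prefix_sum Tu m}. coord du Tu t = prefix_sum du u + j})"
    using coord_count[of u m j du Tu, OF u j] by (simp only: of_nat_le_iff)
  finally show ?thesis .
qed

lemma sum_prefix_blocks: "(\<Sum>k<prefix_sum f m. g k) = (\<Sum>u<m. \<Sum>j<f u. g (prefix_sum f u + j))" for g :: "nat \<Rightarrow> real"
proof -
  have split: "(\<Sum>k<a + b. g k) = (\<Sum>k<a. g k) + (\<Sum>j<b. g (a + j))" for a b by (induction b) auto
  show ?thesis by (induction m) (simp_all add: split, simp add: prefix_sum_def)
qed

theorem query_cost_lower_bound:
  fixes c eta :: real
  assumes m: "m \<ge> 1" and du: "\<And>u. u < m \<Longrightarrow> 0 < du u \<and> du u \<le> Tu u" and d: "(\<Sum>u<m. du u) \<le> d"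
    and eta: "1 \<le> eta" and c_lower: "\<And>u. u < m \<Longrightarrow> real (du u) / real (Tu u) \<le> c"
    and Rm: "prob_space Rm" "sets Rm = sets borel" and A: "admissible_alg Rm A"
    and T: "T = (\<Sum>u<m. Tu u)"
  shows "\<exists>I xs \<theta> N. domain_structure d m du Tu I xs \<and> lin_env d T eta \<theta> xs N \<and>
           vnorm d \<theta> \<le> sqrt (real d) \<and> (\<forall>t<T. \<bar>ip d \<theta> (xs t)\<bar> \<le> 1) \<and>
           (\<integral>\<^sup>+\<omega>. ennreal (alg_cost A d T c \<theta> xs \<omega>) \<partial>(Rm \<Otimes>\<^sub>M noise_space T N))
             \<ge> ennreal (1 / 4 * sqrt c * (\<Sum>u<m. sqrt (real (Tu u) * real (du u))))"
proof -
  define D where "D = prefix_sum du m"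
  have Tp: "T = prefix_sum Tu m" by (simp add: T prefix_sum_def)
  have D: "D \<le> d" using d by (simp add: D_def prefix_sum_def)
  define n where "n k = real (card {t\<in>{0..<T}. coord du Tu t = k})" for k
  have cp: "c > 0"
  proof -
    have "0 < real (du 0) / real (Tu 0)" using du[of 0] m by simp
    then show ?thesis using c_lower[of 0] m by linarith
  qed
  have n: "real (Tu u) / (2 * real (du u)) \<le> n (prefix_sum du u + j)" if "u < m" "j < du u" for u j
    using coord_count_real[of u m j du Tu] that du[OF that(1)] by (simp add: n_def Tp)
  \<comment> \<open>Combines c \<ge> d_u / T_u with n \<ge> T_u / (2 d_u). Below it yields 2 sqrt (c
    n) > 1 and therefore \<epsilon> < 1.\<close>
  have cn: "1 / 2 \<le> c * n k" if kD: "k < D" for k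
  proof -
    obtain u where u: "u < m" "prefix_sum du u \<le> k" "k < prefix_sum du (Suc u)"
      using prefix_sum_ex[OF kD[unfolded D_def]] by blast
    have p: "0 < real (du u)" "0 < real (Tu u)" using du[OF u(1)] by auto
    have "1 / 2 = (real (du u) / real (Tu u)) * (real (Tu u) / (2 * real (du u)))" using p by simp
    also have "\<dots> \<le> c * n k"
      using n[of u "k - prefix_sum du u"] u c_lower[OF u(1)] p cp by (intro mult_mono) auto
    finally show ?thesis .
  qed
  \<comment> \<open>Balances the regret \<open>c n \<epsilon>\<^sup>2\<close> of an undetected sign against the \<open>1 / \<epsilon>\<^sup>2\<close> queries that detect it.\<close>
  define \<epsilon> where "\<epsilon> k = (if k < D then sqrt (1 / (2 * sqrt (c * n k))) else 0)" for k
  have \<epsilon>2: "(\<epsilon> k)\<^sup>2 = 1 / (2 * sqrt (c * n k))" if "k < D" for k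
    using that cn[OF that] by (simp add: \<epsilon>_def)
  have \<epsilon>0: "0 \<le> \<epsilon> k" for k using cn[of k] by (auto simp: \<epsilon>_def)
  have \<epsilon>1: "\<epsilon> k < 1" for k
  proof (cases "k < D")
    case True
    have "1 / 2 < sqrt (c * n k)"
    proof (rule real_less_rsqrt)
      show "(1 / 2)\<^sup>2 < c * n k" using cn[OF True] by (simp add: power2_eq_square)
    qed
    then have lt: "1 < 2 * sqrt (c * n k)" by simp
    have "(\<epsilon> k)\<^sup>2 < 1\<^sup>2"
      unfolding \<epsilon>2[OF True] power_one by (subst divide_less_eq_1_pos) (use lt in linarith)+
    then show ?thesis by (rule power2_less_imp_less) simp
  qed (simp add: \<epsilon>_def)
  interpret sign_family d T D c "coord du Tu" \<epsilon> A Rm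
  proof (rule sign_family.intro)
    show "D \<le> d" by (rule D)
    show "0 \<le> c" using cp by simp
    show "coord du Tu t < D" if "t < T" for t
      using coord_less[of t Tu m du] that du by (simp add: D_def Tp)
    show "0 \<le> \<epsilon> k" "\<epsilon> k < 1" for k by (rule \<epsilon>0, rule \<epsilon>1)
    show "prob_space Rm" "sets Rm = sets borel" "admissible_alg Rm A" by (fact Rm A)+
    show "c * real (card {t \<in> {0..<T}. coord du Tu t = k}) * \<epsilon> k ^ 4 \<le> 1" if k: "k < D" for k
    proof -
      have pos: "c * n k > 0" using cn[OF k] by linarith
      have "\<epsilon> k ^ 4 = (1 / (2 * sqrt (c * n k)))\<^sup>2" 
        unfolding \<epsilon>2[OF k, symmetric] by (simp flip: power_mult)
      also have "\<dots> = 1 / (4 * (c * n k))" using pos by (simp add: power_divide power_mult_distrib)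
      finally have "c * n k * \<epsilon> k ^ 4 = c * n k * (1 / (4 * (c * n k)))" by simp
      also have "\<dots> = 1 / 4" using pos by (auto simp: zero_less_mult_iff)
      finally show ?thesis by (simp add: n_def)
    qed
  qed
  obtain \<sigma> where \<sigma>: "(\<integral>\<^sup>+\<omega>. ennreal (alg_cost A d T c (sign_param D \<epsilon> \<sigma>) ctx \<omega>) \<partial>(Rm \<Otimes>\<^sub>M noise \<sigma>))
    \<ge> ennreal (\<Sum>k<D. c * (\<epsilon> k)\<^sup>2 * n k)" using exists_hard_sign unfolding n_def by blast
  have "1 / 4 * sqrt c * (\<Sum>u<m. sqrt (real (Tu u) * real (du u))) \<le> (\<Sum>k<D. c * (\<epsilon> k)\<^sup>2 * n k)"
  proof -
    have "1 / 4 * sqrt c * (\<Sum>u<m. sqrt (real (Tu u) * real (du u)))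
       = (\<Sum>u<m. 1 / 4 * sqrt (c * (real (Tu u) * real (du u))))"
      by (simp add: sum_distrib_left real_sqrt_mult)
    also have "\<dots> \<le> (\<Sum>u<m. \<Sum>j<du u. sqrt (c * n (prefix_sum du u + j)) / 2)"
    proof (intro sum_mono)
      fix u assume "u \<in> {..<m}"
      then have u: "u < m" by simp
      have p: "0 < real (du u)" "0 < real (Tu u)" using du[OF u] by auto
      \<comment> \<open>The d_u coordinates contribute at least sqrt (c T_u / (2 d_u)) / 2 each, in
        total sqrt (c T_u d_u / 8); the constant 1/4 = sqrt (1/16) is a rational number below sqrt
        (1/8).\<close>
      have "c * (real (Tu u) * real (du u)) / 16 \<le> (real (du u))\<^sup>2 * (c * (real (Tu u) / (2 * real (du u))) / 4)"
      proof -
        have e: "(real (du u))\<^sup>2 * (c * (real (Tu u) / (2 * real (du u))) / 4) = c * (real (Tu u) * real (du u)) / 8"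
          using p by (simp add: power2_eq_square field_simps)
        have "0 \<le> c * (real (Tu u) * real (du u))" using cp p by simp
        then show ?thesis unfolding e by (intro divide_left_mono) auto
      qed
      then have sq: "sqrt (c * (real (Tu u) * real (du u)) / 16) \<le> sqrt ((real (du u))\<^sup>2 * (c * (real (Tu u) / (2 * real (du u))) / 4))"
        by (rule real_sqrt_le_mono)
      have "1 / 4 * sqrt (c * (real (Tu u) * real (du u))) = sqrt (c * (real (Tu u) * real (du u)) / 16)"
        by (simp add: real_sqrt_divide)
      also have "\<dots> \<le> sqrt ((real (du u))\<^sup>2 * (c * (real (Tu u) / (2 * real (du u))) / 4))" by (rule sq)
      also have "\<dots> = real (du u) * (sqrt (c * (real (Tu u) / (2 * real (du u)))) / 2)"
        by (simp only: real_sqrt_mult real_sqrt_divide real_sqrt_abs real_sqrt_four abs_of_nat)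
      also have "\<dots> = (\<Sum>j<du u. sqrt (c * (real (Tu u) / (2 * real (du u)))) / 2)" by simp
      also have "\<dots> \<le> (\<Sum>j<du u. sqrt (c * n (prefix_sum du u + j)) / 2)"
        using n[OF u] cp by (intro sum_mono divide_right_mono real_sqrt_le_mono mult_left_mono) auto
      finally show "1 / 4 * sqrt (c * (real (Tu u) * real (du u))) \<le> (\<Sum>j<du u. sqrt (c * n (prefix_sum du u + j)) / 2)" .
    qed
    also have "\<dots> = (\<Sum>k<D. sqrt (c * n k) / 2)" unfolding D_def by (rule sum_prefix_blocks[symmetric])
    also have "\<dots> = (\<Sum>k<D. c * (\<epsilon> k)\<^sup>2 * n k)"
    proof (intro sum.cong refl)
      fix k assume "k \<in> {..<D}"
      then have k: "k < D" by simp
      have pos: "c * n k > 0" using cn[OF k] by linarith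
      have "c * (\<epsilon> k)\<^sup>2 * n k = (c * n k) / sqrt (c * n k) / 2" using \<epsilon>2[OF k] by simp
      also have "(c * n k) / sqrt (c * n k) = sqrt (c * n k)" using pos by (intro real_div_sqrt) simp
      finally show "sqrt (c * n k) / 2 = c * (\<epsilon> k)\<^sup>2 * n k" by simp
    qed
    finally show ?thesis .
  qed
  then have cost: "(\<integral>\<^sup>+\<omega>. ennreal (alg_cost A d T c (sign_param D \<epsilon> \<sigma>) ctx \<omega>) \<partial>(Rm \<Otimes>\<^sub>M noise \<sigma>))
     \<ge> ennreal (1 / 4 * sqrt c * (\<Sum>u<m. sqrt (real (Tu u) * real (du u))))"
    using \<sigma> by (meson ennreal_leI order_trans)
  have dom: "domain_structure d m du Tu (\<lambda>u. {prefix_sum Tu u..<prefix_sum Tu (Suc u)}) ctx"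
  proof -
    have "ctx = (\<lambda>t. unit_vec (coord du Tu t))" by (auto simp: ctx_def)
    moreover have "0 < du u \<and> 0 < Tu u" if "u < m" for u using du[OF that] by simp
    ultimately show ?thesis using coord_domain_structure[of m du Tu d] D by (simp only: D_def)
  qed
  have abs1: "\<bar>sign_param D \<epsilon> \<sigma> i\<bar> \<le> 1" for i
    using \<epsilon>0[of i] \<epsilon>1[of i] by (auto simp: sign_param_def)
  have env: "lin_env d T eta (sign_param D \<epsilon> \<sigma>) ctx (\<lambda>t. sign_noise (mean \<sigma> t))"
    unfolding lin_env_def
  proof (intro conjI allI impI)
    show "in_dim d (sign_param D \<epsilon> \<sigma>)" using D by (auto simp: in_dim_def sign_param_def)
    fix t assume "t < T"
    then have "coord du Tu t < d" using coord_less[of t Tu m du] du D by (simp add: Tp D_def)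
    then show "in_dim d (ctx t)" "vnorm d (ctx t) \<le> 1"
      by (auto simp: in_dim_def ctx_def vnorm_def ip_unit_vec) (auto simp: unit_vec_def)
    show "subgaussian (sign_noise (mean \<sigma> t)) eta"
      using mean_less[of \<sigma> t] eta by (intro subgaussian_sign_noise) auto
  qed
  have "ip d (sign_param D \<epsilon> \<sigma>) (sign_param D \<epsilon> \<sigma>) \<le> (\<Sum>i<d. 1)"
    unfolding ip_def
  proof (intro sum_mono)
    fix i
    have "sign_param D \<epsilon> \<sigma> i * sign_param D \<epsilon> \<sigma> i = \<bar>sign_param D \<epsilon> \<sigma> i\<bar> * \<bar>sign_param D \<epsilon> \<sigma> i\<bar>" by simp
    also have "\<dots> \<le> 1 * 1" using abs1[of i] by (intro mult_mono) auto
    finally show "sign_param D \<epsilon> \<sigma> i * sign_param D \<epsilon> \<sigma> i \<le> 1" by simp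
  qed
  then have "vnorm d (sign_param D \<epsilon> \<sigma>) \<le> sqrt (real d)" by (simp add: vnorm_def)
  moreover have "\<forall>t<T. \<bar>ip d (sign_param D \<epsilon> \<sigma>) (ctx t)\<bar> \<le> 1"
    using mean_less[of \<sigma>] by (simp add: mean_eq less_imp_le)
  ultimately show ?thesis using dom env cost by blast
qed

theorem mainTheorem15:
  shows
  "(\<forall>eta0::real. eta0 \<ge> 1 \<longrightarrow>
     (\<exists>K a::real. \<forall>d m du Tu I xs \<theta> N eta C c \<delta>.
        let T = (\<Sum>u<m. Tu u) in
        (m \<ge> 1 \<and> (\<forall>u<m. 0 < du u \<and> du u \<le> Tu u) \<and> (\<Sum>u<m. du u) \<le> d \<and>
         1 \<le> eta \<and> eta \<le> eta0 \<and> (\<forall>u<m. eta \<le> real (Tu u) / real (du u)) \<and>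
         (\<forall>u<m. real (du u) / real (Tu u) \<le> c) \<and>
         (\<forall>u<m. c \<le> (1 / eta\<^sup>2) * (real (Tu u) / real (du u))) \<and>
         0 < C \<and> 0 < \<delta> \<and> \<delta> < 1 \<and>
         domain_structure d m du Tu I xs \<and> lin_env d T eta \<theta> xs N \<and>
         vnorm d \<theta> \<le> C \<and> (\<forall>t<T. \<bar>ip d \<theta> (xs t)\<bar> \<le> 1))
        \<longrightarrow>
        measure (coin_space T \<Otimes>\<^sub>M noise_space T N)
          {\<omega> \<in> space (coin_space T \<Otimes>\<^sub>M noise_space T N).
             qufur_cost d T eta C c c \<theta> xs \<omega>
               \<le> K * (ln (2 + real T + 1 / \<delta> + C)) powr a * sqrt c *
                   (\<Sum>u<m. sqrt (real (Tu u) * real (du u)))}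
          \<ge> 1 - \<delta>))
   \<and>
   (\<forall>eta0::real. eta0 \<ge> 1 \<longrightarrow>
     (\<exists>K::real. K > 0 \<and> (\<forall>d m du Tu eta c Rm A.
        let T = (\<Sum>u<m. Tu u) in
        (m \<ge> 1 \<and> (\<forall>u<m. 0 < du u \<and> du u \<le> Tu u) \<and> (\<Sum>u<m. du u) \<le> d \<and>
         1 \<le> eta \<and> eta \<le> eta0 \<and> (\<forall>u<m. eta \<le> real (Tu u) / real (du u)) \<and>
         (\<forall>u<m. real (du u) / real (Tu u) \<le> c) \<and>
         (\<forall>u<m. c \<le> (1 / eta\<^sup>2) * (real (Tu u) / real (du u))) \<and>
         prob_space Rm \<and> sets Rm = sets borel \<and> admissible_alg Rm A)
        \<longrightarrow>
        (\<exists>I xs \<theta> N. domain_structure d m du Tu I xs \<and> lin_env d T eta \<theta> xs N \<and>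
           vnorm d \<theta> \<le> sqrt (real d) \<and> (\<forall>t<T. \<bar>ip d \<theta> (xs t)\<bar> \<le> 1) \<and>
           (\<integral>\<^sup>+\<omega>. ennreal (alg_cost A d T c \<theta> xs \<omega>) \<partial>(Rm \<Otimes>\<^sub>M noise_space T N))
             \<ge> ennreal (K * sqrt c * (\<Sum>u<m. sqrt (real (Tu u) * real (du u))))))))"
proof (intro conjI allI impI)
  fix eta0 :: real
  assume "1 \<le> eta0"
  show "\<exists>K a::real. \<forall>d m du Tu I xs \<theta> N eta C c \<delta>.
        let T = (\<Sum>u<m. Tu u) in
        (m \<ge> 1 \<and> (\<forall>u<m. 0 < du u \<and> du u \<le> Tu u) \<and> (\<Sum>u<m. du u) \<le> d \<and>
         1 \<le> eta \<and> eta \<le> eta0 \<and> (\<forall>u<m. eta \<le> real (Tu u) / real (du u)) \<and>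
         (\<forall>u<m. real (du u) / real (Tu u) \<le> c) \<and>
         (\<forall>u<m. c \<le> (1 / eta\<^sup>2) * (real (Tu u) / real (du u))) \<and>
         0 < C \<and> 0 < \<delta> \<and> \<delta> < 1 \<and>
         domain_structure d m du Tu I xs \<and> lin_env d T eta \<theta> xs N \<and>
         vnorm d \<theta> \<le> C \<and> (\<forall>t<T. \<bar>ip d \<theta> (xs t)\<bar> \<le> 1))
        \<longrightarrow>
        measure (coin_space T \<Otimes>\<^sub>M noise_space T N)
          {\<omega> \<in> space (coin_space T \<Otimes>\<^sub>M noise_space T N).
             qufur_cost d T eta C c c \<theta> xs \<omega>
               \<le> K * (ln (2 + real T + 1 / \<delta> + C)) powr a * sqrt c *
                   (\<Sum>u<m. sqrt (real (Tu u) * real (du u)))}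
          \<ge> 1 - \<delta>"
    unfolding Let_def
  proof (rule exI[of _ "3100 * eta0\<^sup>2"], rule exI[of _ 2], intro allI impI, elim conjE)
    fix d m :: nat and du Tu :: "nat \<Rightarrow> nat" and I :: "nat \<Rightarrow> nat set" and xs :: "nat \<Rightarrow> vect"
      and \<theta> :: vect and N :: "nat \<Rightarrow> real measure" and eta C c \<delta> :: real
    assume *: "m \<ge> 1" "\<forall>u<m. 0 < du u \<and> du u \<le> Tu u" "1 \<le> eta" "eta \<le> eta0"
      "\<forall>u<m. real (du u) / real (Tu u) \<le> c"
      "\<forall>u<m. c \<le> (1 / eta\<^sup>2) * (real (Tu u) / real (du u))" "0 < C" "0 < \<delta>" "\<delta> < 1"
      "domain_structure d m du Tu I xs" "lin_env d (\<Sum>u<m. Tu u) eta \<theta> xs N"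
      "vnorm d \<theta> \<le> C" "\<forall>t<(\<Sum>u<m. Tu u). \<bar>ip d \<theta> (xs t)\<bar> \<le> 1"
    interpret qufur_env d "\<Sum>u<m. Tu u" C xs m du Tu I \<theta> N eta c
      using * by unfold_locales (auto simp: lin_env_def)
    show "measure (coin_space (\<Sum>u<m. Tu u) \<Otimes>\<^sub>M noise_space (\<Sum>u<m. Tu u) N)
          {\<omega> \<in> space (coin_space (\<Sum>u<m. Tu u) \<Otimes>\<^sub>M noise_space (\<Sum>u<m. Tu u) N).
             qufur_cost d (\<Sum>u<m. Tu u) eta C c c \<theta> xs \<omega>
               \<le> 3100 * eta0\<^sup>2 * (ln (2 + real (\<Sum>u<m. Tu u) + 1 / \<delta> + C)) powr 2 * sqrt c *
                   (\<Sum>u<m. sqrt (real (Tu u) * real (du u)))}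
          \<ge> 1 - \<delta>"
      by (rule qufur_upper_bound) fact+
  qed
next
  fix eta0 :: real
  assume "1 \<le> eta0"
  show "\<exists>K::real. K > 0 \<and> (\<forall>d m du Tu eta c Rm A.
        let T = (\<Sum>u<m. Tu u) in
        (m \<ge> 1 \<and> (\<forall>u<m. 0 < du u \<and> du u \<le> Tu u) \<and> (\<Sum>u<m. du u) \<le> d \<and>
         1 \<le> eta \<and> eta \<le> eta0 \<and> (\<forall>u<m. eta \<le> real (Tu u) / real (du u)) \<and>
         (\<forall>u<m. real (du u) / real (Tu u) \<le> c) \<and>
         (\<forall>u<m. c \<le> (1 / eta\<^sup>2) * (real (Tu u) / real (du u))) \<and>
         prob_space Rm \<and> sets Rm = sets borel \<and> admissible_alg Rm A)
        \<longrightarrow>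
        (\<exists>I xs \<theta> N. domain_structure d m du Tu I xs \<and> lin_env d T eta \<theta> xs N \<and>
           vnorm d \<theta> \<le> sqrt (real d) \<and> (\<forall>t<T. \<bar>ip d \<theta> (xs t)\<bar> \<le> 1) \<and>
           (\<integral>\<^sup>+\<omega>. ennreal (alg_cost A d T c \<theta> xs \<omega>) \<partial>(Rm \<Otimes>\<^sub>M noise_space T N))
             \<ge> ennreal (K * sqrt c * (\<Sum>u<m. sqrt (real (Tu u) * real (du u))))))"
    unfolding Let_def
  \<comment> \<open>One constant serves every \<open>eta0\<close>: the sign noise has variance proxy
    1 and so is admissible for each eta \<ge> 1.\<close>
  proof (intro exI[of _ "1 / 4"] conjI allI impI, simp, elim conjE, rule query_cost_lower_bound)
  qed auto
qed

end
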